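(* Connected Feedback Vertex Set Extension can be solved in polynomial time on $P_4$-free graphs.
   Context: A graph is $H$-free if it contains no induced subgraph isomorphic to $H$; $P_r$ denotes the path on $r$ vertices. A feedback vertex set of a graph $G$ is a set $S\subseteq V(G)$ such that $G-S$ is a forest; it is connected if $G[S]$ is connected. Connected Feedback Vertex Set Extension is the problem: given a graph $G=(V,E)$, a subset $W\subseteq V$ and a positive integer $k$, decide whether $G$ has a connected feedback vertex set $S_W$ with $W\subseteq S_W$ and $|S_W|\le k$. *)

theory Defs
  imports
    "Graph_Theory.Graph_Theory"
    "HOL-Computational_Algebra.Polynomial"
    "HOL-Library.Log_Nat"
begin

section \<open>Graphs\<close>

text \<open>
  Finite simple undirected graphs are rendered as \<^locale>\<open>pair_graph\<close>: finite, loop-free,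
  symmetric sets of ordered pairs, the edge $uv$ being the two arcs $(u,v)$ and $(v,u)$.
  Going back and forth along one edge is a directed cycle of length 2, so the predicate
  \<^const>\<open>forest\<close> of the library holds for such a graph only if it is edgeless. A cycle of the
  undirected graph is a directed cycle of length at least 3.
\<close>

definition undirected_forest :: "('a, 'b) pre_digraph \<Rightarrow> bool" where
  "undirected_forest G \<longleftrightarrow> \<not> (\<exists>p. pre_digraph.cycle G p \<and> length p \<ge> 3)"

definition induced_free :: "('a, 'b) pre_digraph \<Rightarrow> ('c, 'd) pre_digraph \<Rightarrow> bool" where
  "induced_free H G \<longleftrightarrow> \<not> (\<exists>K. induced_subgraph K G \<and> digraph_iso H K)"

definition path_graph :: "nat \<Rightarrow> nat pair_pre_digraph" where
  "path_graph r =
    \<lparr> pverts = {..<r}, parcs = {(u, v). u < r \<and> v < r \<and> (v = Suc u \<or> u = Suc v)} \<rparr>"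

definition feedback_vertex_set :: "('a, 'b) pre_digraph \<Rightarrow> 'a set \<Rightarrow> bool" where
  "feedback_vertex_set G S \<longleftrightarrow> S \<subseteq> verts G \<and> undirected_forest (G \<restriction> (verts G - S))"

text \<open>
  The library's notion of connectedness excludes the empty graph. For the extension problem below
  this matters only on the graph without vertices: there \<open>k\<close> is positive, and on a nonempty graph
  for which the empty set would be a solution, every singleton is one.
\<close>

definition connected_feedback_vertex_set :: "('a, 'b) pre_digraph \<Rightarrow> 'a set \<Rightarrow> bool" where
  "connected_feedback_vertex_set G S \<longleftrightarrow>
    feedback_vertex_set G S \<and> Digraph_Component.connected (G \<restriction> S)"


section \<open>Connected Feedback Vertex Set Extension\<close>

type_synonym cfvse_instance = "nat pair_pre_digraph \<times> nat set \<times> nat"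

text \<open>As inputs, graphs have vertices numbered $0, \dots, n-1$.\<close>

definition valid_instance :: "cfvse_instance \<Rightarrow> bool" where
  "valid_instance = (\<lambda>(G, W, k).
    pair_graph G \<and> (\<exists>n. pverts G = {..<n}) \<and> W \<subseteq> pverts G \<and> k > 0)"

definition cfvse :: "cfvse_instance \<Rightarrow> bool" where
  "cfvse = (\<lambda>(G, W, k).
    \<exists>S. connected_feedback_vertex_set (with_proj G) S \<and> W \<subseteq> S \<and> card S \<le> k)"

text \<open>
  The number of vertices in unary (closed by a 0), the characteristic vector of \<open>W\<close>, the adjacency
  matrix row by row, and \<open>k\<close> in binary with the least significant bit first.
\<close>

definition encode :: "cfvse_instance \<Rightarrow> bool list" where
  "encode = (\<lambda>(G, W, k). let n = card (pverts G) in
    replicate n True @ [False]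
    @ map (\<lambda>v. v \<in> W) [0..<n]
    @ map (\<lambda>uv. uv \<in> parcs G) (List.product [0..<n] [0..<n])
    @ map (bit k) [0..<floorlog 2 k])"


section \<open>Polynomial time\<close>

text \<open>
  The machine model is the random access machine of Cook and Reckhow (1973) with logarithmic cost,
  with natural numbers in the registers (so subtraction is truncated) and a read-only input tape of
  bits. It has no multiplication, and the cost of an instruction is the total length in binary of
  the operands and addresses it handles; up to a polynomial, this is the running time of a
  deterministic Turing machine.
\<close>

datatype instr =
    Const nat nat      \<comment> \<open>\<open>X\<^sub>i := c\<close>\<close>
  | Add nat nat nat    \<comment> \<open>\<open>X\<^sub>i := X\<^sub>j + X\<^sub>l\<close>\<close>
  | Sub nat nat nat    \<comment> \<open>\<open>X\<^sub>i := X\<^sub>j - X\<^sub>l\<close>\<close>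
  | Load nat nat       \<comment> \<open>\<open>X\<^sub>i := X\<^bsub>X\<^sub>j\<^esub>\<close>\<close>
  | Store nat nat      \<comment> \<open>\<open>X\<^bsub>X\<^sub>i\<^esub> := X\<^sub>j\<close>\<close>
  | Read nat           \<comment> \<open>\<open>X\<^sub>i\<close> := next input bit, or 2 at the end of the input\<close>
  | JumpPos nat nat    \<comment> \<open>go to instruction \<open>m\<close> if \<open>X\<^sub>j > 0\<close>\<close>

text \<open>Program counter, register contents, unread part of the input.\<close>

type_synonym config = "nat \<times> (nat \<Rightarrow> nat) \<times> bool list"

fun next_symbol :: "bool list \<Rightarrow> nat" where
  "next_symbol [] = 2"
| "next_symbol (b # w) = of_bool b"

fun exec_instr :: "instr \<Rightarrow> config \<Rightarrow> config" where
  "exec_instr (Const i c) (pc, X, w) = (Suc pc, X(i := c), w)"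
| "exec_instr (Add i j l) (pc, X, w) = (Suc pc, X(i := X j + X l), w)"
| "exec_instr (Sub i j l) (pc, X, w) = (Suc pc, X(i := X j - X l), w)"
| "exec_instr (Load i j) (pc, X, w) = (Suc pc, X(i := X (X j)), w)"
| "exec_instr (Store i j) (pc, X, w) = (Suc pc, X(X i := X j), w)"
| "exec_instr (Read i) (pc, X, w) = (Suc pc, X(i := next_symbol w), tl w)"
| "exec_instr (JumpPos j m) (pc, X, w) = (if X j > 0 then m else Suc pc, X, w)"

definition bit_length :: "nat \<Rightarrow> nat" where
  "bit_length x = max 1 (floorlog 2 x)"

fun cost :: "instr \<Rightarrow> config \<Rightarrow> nat" where
  "cost (Const i c) (pc, X, w) = bit_length c"
| "cost (Add i j l) (pc, X, w) = bit_length (X j) + bit_length (X l)"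
| "cost (Sub i j l) (pc, X, w) = bit_length (X j) + bit_length (X l)"
| "cost (Load i j) (pc, X, w) = bit_length (X j) + bit_length (X (X j))"
| "cost (Store i j) (pc, X, w) = bit_length (X i) + bit_length (X j)"
| "cost (Read i) (pc, X, w) = bit_length (next_symbol w)"
| "cost (JumpPos j m) (pc, X, w) = bit_length (X j)"

text \<open>
  \<open>halts_in P c t X\<close>: started in configuration \<open>c\<close>, program \<open>P\<close> runs past its last instruction
  at total cost \<open>t\<close>, with final register contents \<open>X\<close>.
\<close>

inductive halts_in :: "instr list \<Rightarrow> config \<Rightarrow> nat \<Rightarrow> (nat \<Rightarrow> nat) \<Rightarrow> bool" for P where
  halt: "pc \<ge> length P \<Longrightarrow> halts_in P (pc, X, w) 0 X"
| step: "pc < length P \<Longrightarrow> halts_in P (exec_instr (P ! pc) (pc, X, w)) t Y \<Longrightarrow>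
    halts_in P (pc, X, w) (cost (P ! pc) (pc, X, w) + t) Y"

definition initial_config :: "bool list \<Rightarrow> config" where
  "initial_config w = (0, \<lambda>_. 0, w)"

text \<open>
  The decision problem \<open>yes\<close> on the instance class \<open>C\<close> is a promise problem: nothing is required of
  the program on inputs that do not encode a member of \<open>C\<close>. The answer is yes iff the final
  content of register 0 is positive.
\<close>

definition poly_time_solvable_on ::
  "('i \<Rightarrow> bool list) \<Rightarrow> 'i set \<Rightarrow> ('i \<Rightarrow> bool) \<Rightarrow> bool" where
  "poly_time_solvable_on enc C yes \<longleftrightarrow>
    (\<exists>(P :: instr list) (p :: nat poly). \<forall>x \<in> C. \<exists>t X.
      halts_in P (initial_config (enc x)) t X \<and>
      t \<le> poly p (length (enc x)) \<and>
      (X 0 > 0 \<longleftrightarrow> yes x))"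

end

(*
  Every induced subgraph with at least two vertices of a graph without induced P_4 has a pair of
  twins, so such a graph can be contracted to one vertex by merging twins repeatedly. Each remaining
  vertex stands for a module, and merging two twins forms either the disjoint union or the join of
  their modules. For a module M and a set F of its vertices that may become the forest, it suffices to
  know the type of F (empty, one vertex, edgeless, acyclic, cyclic) and that of M - F (empty,
  connected, disconnected): both types of a union or a join are determined by the types of the parts.
  Hence a table with the maximal size of F for each pair of types can be maintained, and the table of
  the whole graph gives the answer.

  Polynomial time is obtained by compiling a language whose loops all run once per input symbol.
*)
theory Submission
  imports Defs
begin

section \<open>Twins in graphs without induced paths on four vertices\<close>

text \<open>Merging twins replaces a decomposition tree: no recursion and no stored tree are needed,
  since a module is named by one of its own vertices. The graph on the surviving vertices is then
  always an induced subgraph of the input, so it stays without induced paths on four vertices, and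
  its adjacencies can be read off the input matrix. Keeping the smaller of two twins makes vertex 0
  the last survivor.

  The types are as coarse as the two operations allow. A join of two nonempty sets is a forest only
  if it is a star, so single vertices and edgeless sets have to be told apart from other forests,
  and nothing else about a forest matters. A join of two nonempty sets is always connected and their
  disjoint union never is, so the number of components is irrelevant. Empty sets are neutral for
  both operations. This leaves 5 times 3 pairs, a constant number of table entries per vertex.
  Maximising \<open>F\<close> minimises its complement, the connected feedback vertex set, and the
  vertices of \<open>W\<close> are simply barred from \<open>F\<close>.\<close>

definition complement :: "('a \<Rightarrow> 'a \<Rightarrow> bool) \<Rightarrow> 'a \<Rightarrow> 'a \<Rightarrow> bool" where
  "complement E u v \<longleftrightarrow> u \<noteq> v \<and> \<not> E u v"

definition p4_free :: "('a \<Rightarrow> 'a \<Rightarrow> bool) \<Rightarrow> 'a set \<Rightarrow> bool" where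
  "p4_free E V \<longleftrightarrow> \<not> (\<exists>a\<in>V. \<exists>b\<in>V. \<exists>c\<in>V. \<exists>d\<in>V. distinct [a, b, c, d] \<and>
    E a b \<and> E b c \<and> E c d \<and> \<not> E a c \<and> \<not> E a d \<and> \<not> E b d)"

lemma p4_freeD:
  "p4_free E V \<Longrightarrow> {a, b, c, d} \<subseteq> V \<Longrightarrow> distinct [a, b, c, d] \<Longrightarrow>
    E a b \<Longrightarrow> E b c \<Longrightarrow> E c d \<Longrightarrow> E a c \<or> E a d \<or> E b d"
  unfolding p4_free_def by blast

lemma p4_free_subset: "p4_free E V \<Longrightarrow> U \<subseteq> V \<Longrightarrow> p4_free E U"
  unfolding p4_free_def by blast

text \<open>The path on four vertices is self-complementary.\<close>

lemma p4_free_complement: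
  assumes "symp E" "p4_free E V"
  shows "p4_free (complement E) V"
  unfolding p4_free_def
proof (intro notI, elim bexE conjE)
  fix a b c d
  assume "a \<in> V" "b \<in> V" "c \<in> V" "d \<in> V" and dist: "distinct [a, b, c, d]"
    and "complement E a b" "complement E b c" "complement E c d"
    and "\<not> complement E a c" "\<not> complement E a d" "\<not> complement E b d"
  then have "E c a" "E a d" "E d b" "\<not> E c d" "\<not> E c b" "\<not> E a b"
    using assms(1) by (auto simp: complement_def dest: sympD)
  then show False
    using p4_freeD[OF assms(2), of c a d b] dist \<open>a \<in> V\<close> \<open>b \<in> V\<close> \<open>c \<in> V\<close> \<open>d \<in> V\<close> by auto
qed

section \<open>Decomposition into a disjoint union or a join\<close>

text \<open>With \<open>complement E\<close> for \<open>E\<close>, all pairs across are adjacent, so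
  one predicate serves for disjoint unions and for joins.\<close>

definition separates :: "('a \<Rightarrow> 'a \<Rightarrow> bool) \<Rightarrow> 'a set \<Rightarrow> 'a set \<Rightarrow> 'a set \<Rightarrow> bool" where
  "separates E A B V \<longleftrightarrow> A \<noteq> {} \<and> B \<noteq> {} \<and> A \<inter> B = {} \<and> A \<union> B = V \<and> (\<forall>a\<in>A. \<forall>b\<in>B. \<not> E a b)"

lemma separates_sym: "symp E \<Longrightarrow> separates E A B V \<Longrightarrow> separates E B A V"
  unfolding separates_def symp_def by blast

lemma symp_complement: "symp E \<Longrightarrow> symp (complement E)"
  unfolding complement_def symp_def by blast

text \<open>Let \<open>w\<close> lie in \<open>A\<close>. If \<open>A\<close> has an edge from a
  non-neighbour \<open>x\<close> of \<open>v\<close> to a neighbour \<open>y\<close> of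
  \<open>v\<close>, then a neighbour \<open>z\<close> of \<open>v\<close> in \<open>B\<close> would
  give the induced path \<open>x\<close>, \<open>y\<close>, \<open>v\<close>, \<open>z\<close>;
  hence \<open>v\<close> has no neighbour in \<open>B\<close> and can be added to \<open>A\<close>.
  Otherwise the non-neighbours of \<open>v\<close> in \<open>A\<close> have no neighbours among the
  other vertices and form a side of their own.\<close>

lemma separates_insert:
  assumes "symp E" "p4_free E (insert v V)" "v \<notin> V" "separates E A B V" "w \<in> V" "\<not> E v w"
  shows "\<exists>A B. separates E A B (insert v V)"
proof -
  have *: "\<exists>A B. separates E A B (insert v V)" if sep: "separates E A B V" and "w \<in> A" for A B
  proof (cases "\<exists>x\<in>A. \<exists>y\<in>A. \<not> E v x \<and> E v y \<and> E x y")
    case True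
    then obtain x y where xy: "x \<in> A" "y \<in> A" "\<not> E v x" "E v y" "E x y" by blast
    have "\<not> E v z" if "z \<in> B" for z
    proof
      assume "E v z"
      have "distinct [x, y, v, z]"
        using xy sep assms(3) \<open>z \<in> B\<close> by (auto simp: separates_def)
      then have "E x v \<or> E x z \<or> E y z"
        using p4_freeD[OF assms(2), of x y v z] xy sep \<open>z \<in> B\<close> \<open>E v z\<close> assms(1)
        by (auto simp: separates_def dest: sympD)
      then show False using xy sep \<open>z \<in> B\<close> assms(1) by (auto simp: separates_def dest: sympD)
    qed
    then have "separates E (insert v A) B (insert v V)"
      using sep assms(3) by (auto simp: separates_def)
    then show ?thesis by blast
  next
    case False
    let ?A = "{x \<in> A. \<not> E v x}"
    have "separates E ?A (insert v (V - ?A)) (insert v V)"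
      using False sep \<open>w \<in> A\<close> assms(1,3,6) by (auto simp: separates_def dest: sympD)
    then show ?thesis by blast
  qed
  have "w \<in> A \<or> w \<in> B" using assms(4,5) by (auto simp: separates_def)
  then show ?thesis
    using *[OF assms(4)] *[OF separates_sym[OF assms(1,4)]] by blast
qed

lemma separates_complement_insert:
  assumes "separates (complement E) A B V" "symp E" "p4_free E (insert v V)" "v \<notin> V"
    and "w \<in> V" "E v w"
  shows "\<exists>A B. separates (complement E) A B (insert v V)"
  using separates_insert[OF symp_complement[OF assms(2)] p4_free_complement[OF assms(2,3)] assms(4,1,5)]
    assms(6) by (simp add: complement_def)

text \<open>Seinsche's theorem. A vertex \<open>v\<close> added to a disconnected graph either
  misses some vertex, and a separation persists, or is adjacent to all, and then \<open>v\<close>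
  alone is one side in the complement. A disconnected complement is treated dually, because the
  forbidden path is self-complementary.\<close>

theorem p4_free_decomposition:
  assumes "finite V" "card V \<ge> 2" "symp E" "p4_free E V"
  shows "\<exists>A B. separates E A B V \<or> separates (complement E) A B V"
  using assms
proof (induction V rule: finite_induct)
  case (insert v V)
  show ?case
  proof (cases "card V \<ge> 2")
    case False
    then have "card V = 1" using insert by simp
    then obtain u where "V = {u}" using card_1_singletonE by blast
    then have "separates E {v} V (insert v V) \<or> separates (complement E) {v} V (insert v V)"
      using insert by (auto simp: separates_def complement_def)
    then show ?thesis by blast
  next
    case True
    consider A B where "separates E A B V" | A B where "separates (complement E) A B V"
      using insert.IH[OF True insert.prems(2) p4_free_subset[OF insert.prems(3)]] by blast
    then show ?thesis
    proof cases
      case 1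
      show ?thesis
      proof (cases "\<exists>w\<in>V. \<not> E v w")
        case True
        then show ?thesis using separates_insert[OF insert.prems(2,3) insert.hyps(2) 1] by blast
      next
        case False
        then have "separates (complement E) {v} V (insert v V)"
          using 1 insert.hyps(2) by (auto simp: separates_def complement_def)
        then show ?thesis by blast
      qed
    next
      case 2
      show ?thesis
      proof (cases "\<exists>w\<in>V. E v w")
        case True
        then show ?thesis
          using separates_complement_insert[OF 2 insert.prems(2,3) insert.hyps(2)] by blast
      next
        case False
        then have "separates E {v} V (insert v V)"
          using 2 insert.hyps(2) by (auto simp: separates_def)
        then show ?thesis by blast
      qed
    qed
  qed
qed simp

section \<open>Existence of twins\<close>

text \<open>Whether \<open>u\<close> and \<open>v\<close> are themselves adjacent is left open: both
  true and false twins can be merged, and their adjacency only decides between join and disjoint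
  union.\<close>

definition twins :: "('a \<Rightarrow> 'a \<Rightarrow> bool) \<Rightarrow> 'a set \<Rightarrow> 'a \<Rightarrow> 'a \<Rightarrow> bool" where
  "twins E V u v \<longleftrightarrow> u \<in> V \<and> v \<in> V \<and> u \<noteq> v \<and> (\<forall>w\<in>V - {u, v}. E u w \<longleftrightarrow> E v w)"

lemma twins_sym: "twins E V u v \<Longrightarrow> twins E V v u"
  by (auto simp: twins_def)

text \<open>Twins inside one side of a decomposition are twins in \<open>V\<close>, since a vertex
  of the other side is adjacent to all of this side or to none of it. If both sides are single
  vertices, no third vertex can tell them apart.\<close>

lemma p4_free_twins:
  assumes "finite V" "card V \<ge> 2" "symp E" "p4_free E V"
  shows "\<exists>u v. twins E V u v"
  using assms
proof (induction V rule: finite_psubset_induct)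
  case (psubset V)
  obtain A B where AB: "separates E A B V \<or> separates (complement E) A B V"
    using p4_free_decomposition[OF psubset.hyps psubset.prems] by blast
  have *: "\<exists>u v. twins E V u v" if A: "card A \<ge> 2"
    and sep: "separates E A B V \<or> separates (complement E) A B V" for A B
  proof -
    have "A \<subset> V" using sep unfolding separates_def by blast
    then obtain u v where "twins E A u v"
      using psubset.IH[OF _ A psubset.prems(2) p4_free_subset[OF psubset.prems(3)]] by blast
    then have "twins E V u v"
      using sep by (auto simp: twins_def separates_def complement_def)
    then show ?thesis by blast
  qed
  have swap: "separates E B A V \<or> separates (complement E) B A V"
    using AB separates_sym symp_complement psubset.prems(2) by blast
  have sub: "finite A" "finite B" "A \<noteq> {}" "B \<noteq> {}" "V = A \<union> B"
    using AB finite_subset[OF _ psubset.hyps] by (auto simp: separates_def)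
  show ?case
  proof (cases "card A \<ge> 2 \<or> card B \<ge> 2")
    case True
    then show ?thesis using * AB swap by blast
  next
    case False
    moreover have "card A \<noteq> 0" "card B \<noteq> 0" using sub by auto
    ultimately have "card A = 1" "card B = 1" by simp_all
    then obtain a b where "A = {a}" "B = {b}" by (meson card_1_singletonE)
    then have "twins E V a b" using AB by (auto simp: twins_def separates_def)
    then show ?thesis by blast
  qed
qed

section \<open>Forests and connectedness of unions and joins\<close>

text \<open>Cycles are closed vertex lists instead of walks, which reduces arguments about them to
  indices modulo the length.\<close>

definition acyclic_on :: "('a \<Rightarrow> 'a \<Rightarrow> bool) \<Rightarrow> 'a set \<Rightarrow> bool" where
  "acyclic_on E X \<longleftrightarrow> \<not> (\<exists>vs. length vs \<ge> 3 \<and> distinct vs \<and> set vs \<subseteq> X \<and>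
    (\<forall>i<length vs. E (vs ! i) (vs ! (Suc i mod length vs))))"

definition edgeless :: "('a \<Rightarrow> 'a \<Rightarrow> bool) \<Rightarrow> 'a set \<Rightarrow> bool" where
  "edgeless E X \<longleftrightarrow> (\<forall>u\<in>X. \<forall>v\<in>X. \<not> E u v)"

definition reachable_in :: "('a \<Rightarrow> 'a \<Rightarrow> bool) \<Rightarrow> 'a set \<Rightarrow> 'a \<Rightarrow> 'a \<Rightarrow> bool" where
  "reachable_in E X = (\<lambda>u v. u \<in> X \<and> v \<in> X \<and> E u v)\<^sup>*\<^sup>*"

definition connected_on :: "('a \<Rightarrow> 'a \<Rightarrow> bool) \<Rightarrow> 'a set \<Rightarrow> bool" where
  "connected_on E X \<longleftrightarrow> X \<noteq> {} \<and> (\<forall>u\<in>X. \<forall>v\<in>X. reachable_in E X u v)"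

lemma acyclic_on_subset: "acyclic_on E X \<Longrightarrow> Y \<subseteq> X \<Longrightarrow> acyclic_on E Y"
  unfolding acyclic_on_def by blast

text \<open>No edge leads from one part to the other, so a cycle stays in the part of its first
  vertex.\<close>

lemma acyclic_on_Un:
  assumes "acyclic_on E X" "acyclic_on E Y" "\<forall>x\<in>X. \<forall>y\<in>Y. \<not> E x y" "symp E"
  shows "acyclic_on E (X \<union> Y)"
  unfolding acyclic_on_def
proof (intro notI, elim exE conjE)
  fix vs
  assume vs: "length vs \<ge> 3" "distinct vs" "set vs \<subseteq> X \<union> Y"
    "\<forall>i<length vs. E (vs ! i) (vs ! (Suc i mod length vs))"
  have in_part: "set vs \<subseteq> A" if "vs ! 0 \<in> A" "set vs \<subseteq> A \<union> B"
    "\<forall>x\<in>A. \<forall>y\<in>B. \<not> E x y" for A B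
  proof -
    have "vs ! i \<in> A" if "i < length vs" for i
      using that
    proof (induction i)
      case (Suc i)
      then have "E (vs ! i) (vs ! Suc i)" using vs(4) by (metis Suc_lessD mod_less)
      moreover have "vs ! i \<in> A" using Suc by simp
      moreover have "vs ! Suc i \<in> A \<union> B"
        using Suc.prems \<open>set vs \<subseteq> A \<union> B\<close> by (meson nth_mem subsetD)
      ultimately show ?case
        using \<open>\<forall>x\<in>A. \<forall>y\<in>B. \<not> E x y\<close> by blast
    qed (use \<open>vs ! 0 \<in> A\<close> in simp)
    then show ?thesis by (auto simp: in_set_conv_nth)
  qed
  have "vs ! 0 \<in> set vs" using vs(1) by (intro nth_mem) linarith
  then have "vs ! 0 \<in> X \<or> vs ! 0 \<in> Y" using vs(3) by blast
  then have "set vs \<subseteq> X \<or> set vs \<subseteq> Y"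
    using in_part[of X Y] in_part[of Y X] vs(3) assms(3,4) by (auto dest: sympD)
  then show False using assms(1,2) vs unfolding acyclic_on_def by blast
qed

text \<open>Every edge has the end \<open>c\<close>, so of two consecutive vertices on a cycle one
  is \<open>c\<close>. As \<open>c\<close> occurs only once, the positions 0, 1, 2 force it to
  position 1; then the edge leaving position 2 has no end at \<open>c\<close>.\<close>

lemma acyclic_on_star:
  assumes "irreflp E" "edgeless E X"
  shows "acyclic_on E (insert c X)"
  unfolding acyclic_on_def
proof (intro notI, elim exE conjE)
  fix vs
  assume vs: "length vs \<ge> 3" "distinct vs" "set vs \<subseteq> insert c X"
    "\<forall>i<length vs. E (vs ! i) (vs ! (Suc i mod length vs))"
  have "vs ! i = c \<or> vs ! (Suc i mod length vs) = c" if "i < length vs" for i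
  proof -
    have "vs ! i \<in> set vs" "vs ! (Suc i mod length vs) \<in> set vs"
      using that vs(1) by (auto intro!: nth_mem mod_less_divisor)
    then show ?thesis using subsetD[OF vs(3)] vs(4) that assms(2) unfolding edgeless_def by blast
  qed
  note edge = this
  have len: "0 < length vs" "1 < length vs" "2 < length vs" "3 mod length vs < length vs"
    using vs(1) by (auto intro!: mod_less_divisor)
  have inj: "i = j" if "vs ! i = c" "vs ! j = c" "i < length vs" "j < length vs" for i j
    using that vs(2) nth_eq_iff_index_eq by metis
  have "vs ! 0 = c \<or> vs ! 1 = c" "vs ! 1 = c \<or> vs ! 2 = c"
    using edge[OF len(1)] edge[OF len(2)] vs(1) by (simp_all add: numeral_2_eq_2)
  then have 1: "vs ! 1 = c" using inj[OF _ _ len(1,3)] by fastforce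
  have "vs ! 2 \<noteq> c" using inj[OF 1 _ len(2,3)] by fastforce
  then have "vs ! (3 mod length vs) = c"
    using edge[OF len(3)] by (simp add: numeral_3_eq_3)
  from inj[OF 1 this len(2,4)] have "3 mod length vs = 1" by simp
  \<comment> \<open>The position after 2 is 0 in a triangle and 3 in a longer cycle.\<close>
  moreover have "3 mod length vs \<noteq> 1"
  proof (cases "length vs = 3")
    case False
    then have "3 < length vs" using vs(1) by linarith
    then show ?thesis by simp
  qed simp
  ultimately show False by blast
qed

lemma acyclic_on_edgeless: "edgeless E X \<Longrightarrow> acyclic_on E X"
  unfolding acyclic_on_def edgeless_def
proof (intro notI, elim exE conjE)
  fix vs
  assume X: "\<forall>u\<in>X. \<forall>v\<in>X. \<not> E u v" and vs: "length vs \<ge> 3" "set vs \<subseteq> X"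
    "\<forall>i<length vs. E (vs ! i) (vs ! (Suc i mod length vs))"
  have 0: "0 < length vs" using vs(1) by linarith
  then have "Suc 0 mod length vs < length vs" by (rule mod_less_divisor)
  then have "vs ! 0 \<in> X" "vs ! (Suc 0 mod length vs) \<in> X"
    using 0 vs(2) nth_mem by blast+
  then show False using X vs(3) 0 by blast
qed

lemma not_acyclic_on_triangle:
  assumes "E a b" "E b c" "E c a" "distinct [a, b, c]" "{a, b, c} \<subseteq> X"
  shows "\<not> acyclic_on E X"
proof -
  let ?vs = "[a, b, c]"
  have "E (?vs ! i) (?vs ! (Suc i mod 3))" if i: "i < 3" for i
  proof -
    consider "i = 0" | "i = 1" | "i = 2" using i by linarith
    then show ?thesis using assms(1-3) by cases simp_all
  qed
  moreover have len: "length ?vs = 3" by simp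
  ultimately have "\<forall>i<length ?vs. E (?vs ! i) (?vs ! (Suc i mod length ?vs))"
    unfolding len by blast
  moreover have "length ?vs \<ge> 3" "distinct ?vs" "set ?vs \<subseteq> X"
    using assms(4,5) by simp_all
  ultimately show ?thesis
    unfolding acyclic_on_def by blast
qed

lemma not_acyclic_on_square:
  assumes "E a b" "E b c" "E c d" "E d a" "distinct [a, b, c, d]" "{a, b, c, d} \<subseteq> X"
  shows "\<not> acyclic_on E X"
proof -
  let ?vs = "[a, b, c, d]"
  have "E (?vs ! i) (?vs ! (Suc i mod 4))" if i: "i < 4" for i
  proof -
    consider "i = 0" | "i = 1" | "i = 2" | "i = 3" using i by linarith
    then show ?thesis using assms(1-4) by cases simp_all
  qed
  moreover have len: "length ?vs = 4" by simp
  ultimately have "\<forall>i<length ?vs. E (?vs ! i) (?vs ! (Suc i mod length ?vs))"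
    unfolding len by blast
  moreover have "length ?vs \<ge> 3" "distinct ?vs" "set ?vs \<subseteq> X"
    using assms(5,6) by simp_all
  ultimately show ?thesis
    unfolding acyclic_on_def by blast
qed

lemma connected_on_singleton: "connected_on E {v}"
  by (simp add: connected_on_def reachable_in_def)

text \<open>A fixed \<open>x0\<close> in \<open>X\<close> reaches \<open>Y\<close> in one step and
  the rest of \<open>X\<close> in two, through \<open>y0\<close>; symmetry provides the way
  back.\<close>

lemma connected_on_join:
  assumes "symp E" "\<forall>x\<in>X. \<forall>y\<in>Y. E x y" "X \<noteq> {}" "Y \<noteq> {}"
  shows "connected_on E (X \<union> Y)"
proof -
  obtain x0 y0 where 0: "x0 \<in> X" "y0 \<in> Y" using assms(3,4) by blast
  let ?R = "\<lambda>u v. u \<in> X \<union> Y \<and> v \<in> X \<union> Y \<and> E u v"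
  have sym: "?R u v \<Longrightarrow> ?R v u" for u v using assms(1) by (auto dest: sympD)
  have to: "?R\<^sup>*\<^sup>* x0 u" if "u \<in> X \<union> Y" for u
  proof (cases "u \<in> Y")
    case True
    then show ?thesis using 0 assms(2) by (intro r_into_rtranclp) auto
  next
    case False
    then have "?R x0 y0" "?R y0 u" using 0 that assms(2) sym by auto
    then show ?thesis by (rule rtranclp.rtrancl_into_rtrancl[OF r_into_rtranclp])
  qed
  have "?R\<^sup>*\<^sup>* u x0" if "u \<in> X \<union> Y" for u
  proof -
    have "symp ?R" using sym by (rule sympI)
    then have "symp ?R\<^sup>*\<^sup>*" by (rule symp_rtranclp)
    then show ?thesis using to[OF that] by (rule sympD)
  qed
  then have "?R\<^sup>*\<^sup>* u v" if "u \<in> X \<union> Y" "v \<in> X \<union> Y" for u v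
    using to that by (meson rtranclp_trans)
  then show ?thesis using 0 by (auto simp: connected_on_def reachable_in_def)
qed

lemma not_connected_on_union:
  assumes "\<forall>x\<in>X. \<forall>y\<in>Y. \<not> E x y" "X \<inter> Y = {}" "X \<noteq> {}" "Y \<noteq> {}"
  shows "\<not> connected_on E (X \<union> Y)"
proof
  assume con: "connected_on E (X \<union> Y)"
  obtain x y where xy: "x \<in> X" "y \<in> Y" using assms(3,4) by blast
  have "reachable_in E (X \<union> Y) x y"
    using con xy by (auto simp: connected_on_def)
  then have "y \<in> X"
    unfolding reachable_in_def
  proof (induction rule: rtranclp_induct)
    case (step y z)
    then show ?case using assms(1) by blast
  qed (rule xy(1))
  then show False using xy assms(2) by blast
qed

text \<open>The type of a set \<open>F\<close> that may become the forest: 0 if empty, 1 for a single vertex, 2 for at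
  least two edgeless vertices, 3 for a forest with an edge, 4 for a graph with a cycle.\<close>

definition forest_type :: "('a \<Rightarrow> 'a \<Rightarrow> bool) \<Rightarrow> 'a set \<Rightarrow> nat" where
  "forest_type E F = (if F = {} then 0 else if is_singleton F then 1
    else if edgeless E F then 2 else if acyclic_on E F then 3 else 4)"

text \<open>The empty set is kept apart because it is neutral for both operations, and because it is
  not connected in the sense of \<open>connected_on\<close>.\<close>

definition connection_type :: "('a \<Rightarrow> 'a \<Rightarrow> bool) \<Rightarrow> 'a set \<Rightarrow> nat" where
  "connection_type E S = (if S = {} then 0 else if connected_on E S then 1 else 2)"

text \<open>The types are numbered by growing complexity, hence the maximum; two nonempty parts have
  at least two vertices, hence at least 2.\<close>

definition forest_union :: "nat \<Rightarrow> nat \<Rightarrow> nat" where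
  "forest_union a b = (if a = 0 then b else if b = 0 then a else max 2 (max a b))"

text \<open>The value 3 is the star: one part a single vertex, the other edgeless. Any other join of
  nonempty parts contains a triangle or a square.\<close>

definition forest_join :: "nat \<Rightarrow> nat \<Rightarrow> nat" where
  "forest_join a b = (if a = 0 then b else if b = 0 then a
    else if min a b = 1 \<and> max a b \<le> 2 then 3 else 4)"

definition connection_union :: "nat \<Rightarrow> nat \<Rightarrow> nat" where
  "connection_union a b = (if a = 0 then b else if b = 0 then a else 2)"

definition connection_join :: "nat \<Rightarrow> nat \<Rightarrow> nat" where
  "connection_join a b = (if a = 0 then b else if b = 0 then a else 1)"

lemma connection_type_union:
  assumes "\<forall>x\<in>X. \<forall>y\<in>Y. \<not> E x y" "X \<inter> Y = {}"
  shows "connection_type E (X \<union> Y) = connection_union (connection_type E X) (connection_type E Y)"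
proof (cases "X = {} \<or> Y = {}")
  case False
  then show ?thesis
    using not_connected_on_union[of X Y E] assms by (simp add: connection_type_def connection_union_def)
qed (auto simp: connection_type_def connection_union_def)

lemma connection_type_join:
  assumes "symp E" "\<forall>x\<in>X. \<forall>y\<in>Y. E x y"
  shows "connection_type E (X \<union> Y) = connection_join (connection_type E X) (connection_type E Y)"
proof (cases "X = {} \<or> Y = {}")
  case False
  then show ?thesis
    using connected_on_join[of E X Y] assms by (simp add: connection_type_def connection_join_def)
qed (auto simp: connection_type_def connection_join_def)

lemma singleton_edgeless: "irreflp E \<Longrightarrow> is_singleton X \<Longrightarrow> edgeless E X"
  by (auto simp: is_singleton_def edgeless_def irreflp_def)

text \<open>Thanks to the order of the types, edgeless and acyclic become thresholds, and the laws
  of composition reduce to arithmetic on small numbers.\<close>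

lemma forest_type_le_2:
  "irreflp E \<Longrightarrow> X \<noteq> {} \<Longrightarrow> forest_type E X \<le> 2 \<longleftrightarrow> edgeless E X"
  by (auto simp: forest_type_def singleton_edgeless)

lemma forest_type_le_3: "irreflp E \<Longrightarrow> forest_type E X \<le> 3 \<longleftrightarrow> acyclic_on E X"
  using acyclic_on_edgeless[of E X] singleton_edgeless[of E X]
  by (auto simp: forest_type_def edgeless_def)

lemma forest_type_eqs:
  "forest_type E X = 0 \<longleftrightarrow> X = {}" "forest_type E X = 1 \<longleftrightarrow> is_singleton X" "forest_type E X \<le> 4"
  by (auto simp: forest_type_def is_singleton_def)

lemma forest_type_not_singleton:
  "X \<noteq> {} \<Longrightarrow> \<not> is_singleton X \<Longrightarrow>
    forest_type E X = (if edgeless E X then 2 else if acyclic_on E X then 3 else 4)"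
  by (simp add: forest_type_def)

lemma not_singleton_Un:
  assumes "X \<inter> Y = {}" "X \<noteq> {}" "Y \<noteq> {}"
  shows "\<not> is_singleton (X \<union> Y)"
proof
  assume "is_singleton (X \<union> Y)"
  then obtain z where z: "X \<union> Y = {z}" by (rule is_singletonE)
  obtain x y where "x \<in> X" "y \<in> Y" using assms(2,3) by blast
  moreover from this have "x \<in> {z}" "y \<in> {z}" using z by blast+
  ultimately show False using assms(1) by blast
qed

text \<open>A union without edges across is edgeless, or acyclic, exactly if both parts are; two
  nonempty disjoint parts exclude the types 0 and 1.\<close>

lemma forest_type_union:
  assumes E: "symp E" "irreflp E" and "\<forall>x\<in>X. \<forall>y\<in>Y. \<not> E x y" "X \<inter> Y = {}"
  shows "forest_type E (X \<union> Y) = forest_union (forest_type E X) (forest_type E Y)"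
proof (cases "X = {} \<or> Y = {}")
  case True
  then show ?thesis by (auto simp: forest_union_def forest_type_def)
next
  case False
  then have ne: "X \<union> Y \<noteq> {}" "\<not> is_singleton (X \<union> Y)"
    using not_singleton_Un[OF assms(4)] by auto
  let ?f = "forest_type E X" and ?g = "forest_type E Y"
  have ind: "edgeless E (X \<union> Y) \<longleftrightarrow> ?f \<le> 2 \<and> ?g \<le> 2"
  proof -
    have "edgeless E (X \<union> Y) \<longleftrightarrow> edgeless E X \<and> edgeless E Y"
      using assms(1,3) unfolding edgeless_def symp_def by blast
    then show ?thesis using False forest_type_le_2[OF E(2)] by blast
  qed
  have "acyclic_on E (X \<union> Y) \<longleftrightarrow> acyclic_on E X \<and> acyclic_on E Y"
    using acyclic_on_Un[OF _ _ assms(3,1)] acyclic_on_subset[of E "X \<union> Y"] by blast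
  then have acyc: "acyclic_on E (X \<union> Y) \<longleftrightarrow> ?f \<le> 3 \<and> ?g \<le> 3"
    by (simp only: forest_type_le_3[OF E(2)])
  have eq: "forest_type E (X \<union> Y) = (if ?f \<le> 2 \<and> ?g \<le> 2 then 2 else if ?f \<le> 3 \<and> ?g \<le> 3 then 3 else 4)"
    unfolding forest_type_not_singleton[OF ne] ind acyc ..
  have "?f \<noteq> 0" "?g \<noteq> 0" using False by (simp_all add: forest_type_eqs(1))
  moreover have "?f \<le> 4" "?g \<le> 4" by (rule forest_type_eqs(3))+
  moreover have "(if a \<le> 2 \<and> b \<le> 2 then 2 else if a \<le> 3 \<and> b \<le> 3 then 3 else 4) = forest_union a b"
    if "a \<noteq> 0" "b \<noteq> 0" "a \<le> 4" "b \<le> 4" for a b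
    using that by (simp add: forest_union_def max_def) arith
  ultimately show ?thesis unfolding eq by blast
qed

text \<open>An edge inside one part forms a triangle with any vertex of the other, and two vertices
  in each part form a square. Without these configurations only a star is left.\<close>

lemma acyclic_on_join:
  assumes "symp E" "irreflp E" "\<forall>x\<in>X. \<forall>y\<in>Y. E x y" "X \<inter> Y = {}" "X \<noteq> {}" "Y \<noteq> {}"
  shows "acyclic_on E (X \<union> Y) \<longleftrightarrow>
    edgeless E X \<and> edgeless E Y \<and> (is_singleton X \<or> is_singleton Y)"
proof
  assume acyc: "acyclic_on E (X \<union> Y)"
  have ind: "edgeless E A" if "A \<union> B = X \<union> Y" "B \<noteq> {}" "A \<inter> B = {}"
    and join: "\<forall>x\<in>A. \<forall>y\<in>B. E x y" for A B
    unfolding edgeless_def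
  proof (intro ballI notI)
    fix u v
    assume "u \<in> A" "v \<in> A" "E u v"
    moreover obtain w where "w \<in> B" using \<open>B \<noteq> {}\<close> by blast
    moreover have "u \<noteq> v" using \<open>E u v\<close> assms(2) by (auto simp: irreflp_def)
    ultimately show False
      using not_acyclic_on_triangle[of E u v w "A \<union> B"] acyc \<open>A \<union> B = X \<union> Y\<close> \<open>A \<inter> B = {}\<close>
        join sympD[OF assms(1), of u w] by auto
  qed
  have "is_singleton X \<or> is_singleton Y"
  proof (rule ccontr)
    assume "\<not> ?thesis"
    then obtain x x' y y' where "x \<in> X" "x' \<in> X" "x \<noteq> x'" "y \<in> Y" "y' \<in> Y" "y \<noteq> y'"
      using assms(5,6) by (metis is_singletonI')
    moreover from this have "E x y" "E y x'" "E x' y'" "E y' x"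
      using assms(1,3) by (auto dest: sympD)
    ultimately show False
      using not_acyclic_on_square[of E x y x' y' "X \<union> Y"] acyc assms(4) by auto
  qed
  moreover have "edgeless E X" using ind[of X Y] assms by blast
  moreover have "edgeless E Y" using ind[of Y X] assms by (auto dest: sympD)
  ultimately show "edgeless E X \<and> edgeless E Y \<and> (is_singleton X \<or> is_singleton Y)" by blast
next
  assume *: "edgeless E X \<and> edgeless E Y \<and> (is_singleton X \<or> is_singleton Y)"
  then show "acyclic_on E (X \<union> Y)"
    using acyclic_on_star[OF assms(2), of X] acyclic_on_star[OF assms(2), of Y]
    by (auto simp: is_singleton_def)
qed

lemma forest_type_join:
  assumes E: "symp E" "irreflp E" and "\<forall>x\<in>X. \<forall>y\<in>Y. E x y" "X \<inter> Y = {}"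
  shows "forest_type E (X \<union> Y) = forest_join (forest_type E X) (forest_type E Y)"
proof (cases "X = {} \<or> Y = {}")
  case True
  then show ?thesis by (auto simp: forest_join_def forest_type_def)
next
  case False
  then have ne: "X \<union> Y \<noteq> {}" "\<not> is_singleton (X \<union> Y)"
    using not_singleton_Un[OF assms(4)] by auto
  let ?f = "forest_type E X" and ?g = "forest_type E Y"
  have ind: "\<not> edgeless E (X \<union> Y)"
    using False assms(3) unfolding edgeless_def by blast
  have "edgeless E X \<longleftrightarrow> ?f \<le> 2" "edgeless E Y \<longleftrightarrow> ?g \<le> 2"
    using False forest_type_le_2[OF E(2)] by blast+
  then have acyc: "acyclic_on E (X \<union> Y) \<longleftrightarrow> ?f \<le> 2 \<and> ?g \<le> 2 \<and> (?f = 1 \<or> ?g = 1)"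
    using acyclic_on_join[OF assms] False forest_type_eqs(2)[of E] by blast
  have eq: "forest_type E (X \<union> Y) = (if ?f \<le> 2 \<and> ?g \<le> 2 \<and> (?f = 1 \<or> ?g = 1) then 3 else 4)"
    using forest_type_not_singleton[OF ne] ind acyc by simp
  have "?f \<noteq> 0" "?g \<noteq> 0" using False by (simp_all add: forest_type_eqs(1))
  moreover have "(if a \<le> 2 \<and> b \<le> 2 \<and> (a = 1 \<or> b = 1) then 3 else 4) = forest_join a b"
    if "a \<noteq> 0" "b \<noteq> 0" for a b
    using that by (simp add: forest_join_def min_def max_def) arith
  ultimately show ?thesis unfolding eq by blast
qed

section \<open>Tables of optimal sizes\<close>

definition set_type :: "('a \<Rightarrow> 'a \<Rightarrow> bool) \<Rightarrow> 'a set \<Rightarrow> 'a set \<Rightarrow> nat \<times> nat" where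
  "set_type E M F = (forest_type E F, connection_type E (M - F))"

fun compose_types :: "bool \<Rightarrow> nat \<times> nat \<Rightarrow> nat \<times> nat \<Rightarrow> nat \<times> nat" where
  "compose_types j (f, s) (f', s') = (if j then (forest_join f f', connection_join s s')
    else (forest_union f f', connection_union s s'))"

definition types :: "(nat \<times> nat) list" where
  "types = List.product [0..<5] [0..<3]"

lemma set_type_in_types: "set_type E M F \<in> set types"
proof -
  have "forest_type E F < 5" using forest_type_eqs(3)[of E F] by linarith
  moreover have "connection_type E (M - F) < 3" by (simp add: connection_type_def)
  ultimately show ?thesis by (simp add: types_def set_type_def)
qed

text \<open>The complement of \<open>F \<union> G\<close> in \<open>A \<union> B\<close> is the
  union of the complements taken in \<open>A\<close> and in \<open>B\<close>, so the two components
  of the type compose independently.\<close>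

lemma set_type_Un:
  assumes "symp E" "irreflp E" "A \<inter> B = {}" "\<forall>x\<in>A. \<forall>y\<in>B. E x y \<longleftrightarrow> j"
    and "F \<subseteq> A" "G \<subseteq> B"
  shows "set_type E (A \<union> B) (F \<union> G) = compose_types j (set_type E A F) (set_type E B G)"
proof -
  have diff: "(A \<union> B) - (F \<union> G) = (A - F) \<union> (B - G)"
    using assms(3,5,6) by blast
  have disj: "F \<inter> G = {}" "(A - F) \<inter> (B - G) = {}"
    using assms(3,5,6) by blast+
  show ?thesis
  proof (cases j)
    case True
    have 1: "\<forall>x\<in>F. \<forall>y\<in>G. E x y" and 2: "\<forall>x\<in>A - F. \<forall>y\<in>B - G. E x y"
      using assms(4-6) True by blast+
    show ?thesis
      using forest_type_join[OF assms(1,2) 1 disj(1)]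
        connection_type_join[OF assms(1) 2] True
      by (simp add: set_type_def diff)
  next
    case False
    have 1: "\<forall>x\<in>F. \<forall>y\<in>G. \<not> E x y" and 2: "\<forall>x\<in>A - F. \<forall>y\<in>B - G. \<not> E x y"
      using assms(4-6) False by blast+
    show ?thesis
      using forest_type_union[OF assms(1,2) 1 disj(1)] connection_type_union[OF 2 disj(2)] False
      by (simp add: set_type_def diff)
  qed
qed

text \<open>The value is shifted by one, so that 0 means that there is no such set.\<close>

definition best :: "('a \<Rightarrow> 'a \<Rightarrow> bool) \<Rightarrow> 'a set \<Rightarrow> 'a set \<Rightarrow> nat \<times> nat \<Rightarrow> nat" where
  "best E W M \<tau> = Max (insert 0 {Suc (card F) |F. F \<subseteq> M - W \<and> set_type E M F = \<tau>})"

text \<open>Both arguments are sizes shifted by one, so one shift has to be taken off their sum; 0,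
  standing for a missing set, is absorbing.\<close>

definition gain :: "nat \<Rightarrow> nat \<Rightarrow> nat" where
  "gain t u = (if t > 0 \<and> u > 0 then t + u - 1 else 0)"

text \<open>A max-plus convolution along \<open>compose_types\<close>, in which 0 plays the part of
  minus infinity.\<close>

definition combine :: "bool \<Rightarrow> (nat \<times> nat \<Rightarrow> nat) \<Rightarrow> (nat \<times> nat \<Rightarrow> nat) \<Rightarrow> nat \<times> nat \<Rightarrow> nat" where
  "combine j T U \<tau> = Max (insert 0 ((\<lambda>pq. gain (T (fst pq)) (U (snd pq))) `
    {pq \<in> set types \<times> set types. compose_types j (fst pq) (snd pq) = \<tau>}))"

lemma finite_best:
  assumes "finite M"
  shows "finite (insert 0 {Suc (card F) |F. F \<subseteq> M - W \<and> set_type E M F = \<tau>})"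
proof -
  have "finite ((\<lambda>F. Suc (card F)) ` Pow M)" using assms by simp
  then show ?thesis by (rule finite_subset[OF _ finite_insert[THEN iffD2], rotated]) auto
qed

lemma best_ge:
  assumes "finite M" "F \<subseteq> M - W"
  shows "Suc (card F) \<le> best E W M (set_type E M F)"
  unfolding best_def using assms by (intro Max_ge finite_best) auto

lemma best_attained:
  assumes "finite M" "best E W M \<tau> > 0"
  shows "\<exists>F. F \<subseteq> M - W \<and> set_type E M F = \<tau> \<and> best E W M \<tau> = Suc (card F)"
proof -
  have "best E W M \<tau> \<in> insert 0 {Suc (card F) |F. F \<subseteq> M - W \<and> set_type E M F = \<tau>}"
    unfolding best_def using finite_best[OF assms(1)] by (intro Max_in) auto
  then show ?thesis using assms(2) by auto
qed

lemma finite_combine: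
  "finite (insert 0 ((\<lambda>pq. gain (T (fst pq)) (U (snd pq))) `
    {pq \<in> set types \<times> set types. compose_types j (fst pq) (snd pq) = \<tau>}))"
  by simp

text \<open>An optimal set for \<open>A \<union> B\<close> splits into its traces on
  \<open>A\<close> and \<open>B\<close>, whose types compose to its own. Conversely, optimal sets of
  any two types unite to a set of the composed type, with sizes adding up.\<close>

lemma best_Un:
  assumes "symp E" "irreflp E" "A \<inter> B = {}" "\<forall>x\<in>A. \<forall>y\<in>B. E x y \<longleftrightarrow> j"
    and fin: "finite A" "finite B"
  shows "best E W (A \<union> B) = combine j (best E W A) (best E W B)"
proof (intro ext antisym)
  fix \<tau>
  show "best E W (A \<union> B) \<tau> \<le> combine j (best E W A) (best E W B) \<tau>"
  proof (cases "best E W (A \<union> B) \<tau> > 0")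
    case True
    then obtain H where H: "H \<subseteq> A \<union> B - W" "set_type E (A \<union> B) H = \<tau>"
        "best E W (A \<union> B) \<tau> = Suc (card H)"
      using best_attained[of "A \<union> B"] fin by blast
    define F G where "F = H \<inter> A" and "G = H \<inter> B"
    have FG: "F \<subseteq> A - W" "G \<subseteq> B - W" "H = F \<union> G" "F \<inter> G = {}"
      using H(1) assms(3) by (auto simp: F_def G_def)
    let ?p = "set_type E A F" and ?q = "set_type E B G"
    have "F \<subseteq> A" "G \<subseteq> B" by (auto simp: F_def G_def)
    then have tau: "compose_types j ?p ?q = \<tau>"
      using set_type_Un[OF assms(1-4)] H(2) unfolding FG(3) by metis
    have "card H = card F + card G"
      unfolding FG(3) using FG fin by (intro card_Un_disjoint) (auto intro: finite_subset)
    then have "best E W (A \<union> B) \<tau> \<le> gain (best E W A ?p) (best E W B ?q)"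
      using best_ge[OF fin(1) FG(1), of E] best_ge[OF fin(2) FG(2), of E] H(3)
      by (simp add: gain_def)
    also have "\<dots> \<le> combine j (best E W A) (best E W B) \<tau>"
      unfolding combine_def
    proof (intro Max_ge finite_combine insertI2 image_eqI CollectI conjI)
      show "gain (best E W A ?p) (best E W B ?q) =
        gain (best E W A (fst (?p, ?q))) (best E W B (snd (?p, ?q)))" by simp
    qed (use tau in \<open>simp_all add: set_type_in_types\<close>)
    finally show ?thesis .
  qed simp
  show "combine j (best E W A) (best E W B) \<tau> \<le> best E W (A \<union> B) \<tau>"
  proof -
    have "gain (best E W A p) (best E W B q) \<le> best E W (A \<union> B) (compose_types j p q)" for p q
    proof (cases "best E W A p > 0 \<and> best E W B q > 0")
      case True
      then obtain F G where F: "F \<subseteq> A - W" "set_type E A F = p" "best E W A p = Suc (card F)"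
        and G: "G \<subseteq> B - W" "set_type E B G = q" "best E W B q = Suc (card G)"
        using best_attained fin by metis
      have "card (F \<union> G) = card F + card G"
        using F(1) G(1) fin assms(3) by (intro card_Un_disjoint) (auto intro: finite_subset)
      moreover have "F \<subseteq> A" "G \<subseteq> B" using F(1) G(1) by blast+
      then have "compose_types j p q = set_type E (A \<union> B) (F \<union> G)"
        using set_type_Un[OF assms(1-4)] F(2) G(2) by metis
      moreover have "F \<union> G \<subseteq> A \<union> B - W" using F G by blast
      ultimately show ?thesis
        using best_ge[of "A \<union> B" "F \<union> G" W E] fin F(3) G(3) by (simp add: gain_def)
    qed (auto simp: gain_def)
    then show ?thesis
      unfolding combine_def by (intro Max.boundedI finite_combine) auto
  qed
qed

text \<open>There are only two choices: \<open>F\<close> empty leaves the connected set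
  \<open>{v}\<close> and has shifted size 1; \<open>F = {v}\<close> leaves nothing, has shifted size
  2 and is barred for \<open>v\<close> in \<open>W\<close>.\<close>

lemma best_singleton:
  assumes "irreflp E"
  shows "best E W {v} \<tau> = (if \<tau> = (0, 1) then 1 else if \<tau> = (1, 0) \<and> v \<notin> W then 2 else 0)"
proof -
  have 0: "set_type E {v} {} = (0, 1)"
    by (simp add: set_type_def forest_type_def connection_type_def connected_on_singleton)
  have 1: "set_type E {v} {v} = (1, 0)"
    by (simp add: set_type_def forest_type_def connection_type_def)
  have sub: "F \<subseteq> {v} - W \<longleftrightarrow> F = {} \<or> F = {v} \<and> v \<notin> W" for F
    by (cases "v \<in> W") (simp_all add: insert_Diff_if subset_singleton_iff)
  have "{Suc (card F) |F. F \<subseteq> {v} - W \<and> set_type E {v} F = \<tau>} =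
      {n. n = 1 \<and> (0, 1) = \<tau> \<or> n = 2 \<and> v \<notin> W \<and> (1, 0) = \<tau>}"
    unfolding sub conj_disj_distribR conj_disj_distribL ex_disj_distrib
    by (simp add: 0[unfolded One_nat_def] 1[unfolded One_nat_def] conj_commute numeral_2_eq_2 cong: conj_cong)
  also have "\<dots> = (if \<tau> = (0, 1) then {1} else if \<tau> = (1, 0) \<and> v \<notin> W then {2} else {})"
    by (cases \<tau>) auto
  finally show ?thesis unfolding best_def by simp
qed

text \<open>\<open>S\<close> and \<open>F\<close> are complements of each other in \<open>V\<close>.
  The types \<open>f < 4\<close> are the acyclic ones, and connection type 1 says that
  \<open>S\<close> is connected. As \<open>best\<close> is the size of \<open>F\<close> plus one,
  the strict inequality expresses that \<open>V - F\<close> has at most \<open>k\<close>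
  vertices.\<close>

lemma connected_feedback_iff_best:
  assumes "irreflp E" "finite V" "W \<subseteq> V"
  shows "(\<exists>S\<subseteq>V. acyclic_on E (V - S) \<and> connected_on E S \<and> W \<subseteq> S \<and> card S \<le> k) \<longleftrightarrow>
    (\<exists>f<4. best E W V (f, 1) > 0 \<and> card V < best E W V (f, 1) + k)"
proof (intro iffI; elim exE conjE)
  fix S
  assume S: "S \<subseteq> V" "acyclic_on E (V - S)" "connected_on E S" "W \<subseteq> S" "card S \<le> k"
  let ?f = "forest_type E (V - S)"
  have "V - (V - S) = S" using S(1) by blast
  moreover have "S \<noteq> {}" using S(3) by (auto simp: connected_on_def)
  ultimately have type: "set_type E V (V - S) = (?f, 1)"
    using S(3) by (simp add: set_type_def connection_type_def)
  have "?f < 4" using forest_type_le_3[OF assms(1), of "V - S"] S(2) by simp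
  moreover have "Suc (card (V - S)) \<le> best E W V (?f, 1)"
    using best_ge[OF assms(2), of "V - S" W E] S(4) by (simp add: type Diff_mono)
  moreover have "card (V - S) + card S = card V"
    using card_mono[OF assms(2) S(1)] S(1) assms(2) by (simp add: card_Diff_subset finite_subset)
  ultimately show "\<exists>f<4. best E W V (f, 1) > 0 \<and> card V < best E W V (f, 1) + k"
    using S(5) by (intro exI[of _ ?f]) auto
next
  fix f :: nat
  assume f: "f < 4" "best E W V (f, 1) > 0" "card V < best E W V (f, 1) + k"
  then obtain F where F: "F \<subseteq> V - W" "set_type E V F = (f, 1)" "best E W V (f, 1) = Suc (card F)"
    using best_attained[OF assms(2)] by blast
  have "V - (V - F) = F" using F(1) by blast
  moreover have "acyclic_on E F"
    using F(2) f(1) forest_type_le_3[OF assms(1), of F] by (simp add: set_type_def)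
  moreover have "connected_on E (V - F)"
    using F(2) by (auto simp: set_type_def connection_type_def split: if_splits)
  moreover have "card (V - F) \<le> k"
    using F(1,3) f(3) assms(2) by (subst card_Diff_subset) (auto intro: finite_subset)
  ultimately show "\<exists>S\<subseteq>V. acyclic_on E (V - S) \<and> connected_on E S \<and> W \<subseteq> S \<and> card S \<le> k"
    using F(1) assms(3) by (intro exI[of _ "V - F"]) auto
qed

section \<open>Modules represented by vertices\<close>

text \<open>Representatives belong to their modules, so the quotient graph is the subgraph induced
  by \<open>U\<close>: it inherits the absence of induced paths on four vertices, and no adjacency
  has to be recomputed after a merge.\<close>

definition module_partition :: "('a \<Rightarrow> 'a \<Rightarrow> bool) \<Rightarrow> 'a set \<Rightarrow> 'a set \<Rightarrow> ('a \<Rightarrow> 'a set) \<Rightarrow> bool" where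
  "module_partition E V U M \<longleftrightarrow> (\<forall>u\<in>U. u \<in> M u) \<and> (\<Union>u\<in>U. M u) = V \<and>
    (\<forall>u\<in>U. \<forall>v\<in>U. u \<noteq> v \<longrightarrow> M u \<inter> M v = {} \<and> (\<forall>x\<in>M u. \<forall>y\<in>M v. E x y \<longleftrightarrow> E u v))"

lemma module_partitionD:
  assumes "module_partition E V U M" "u \<in> U" "v \<in> U" "u \<noteq> v"
  shows "M u \<inter> M v = {}" "x \<in> M u \<Longrightarrow> y \<in> M v \<Longrightarrow> E x y \<longleftrightarrow> E u v"
  using assms unfolding module_partition_def by blast+

lemma module_partition_subset: "module_partition E V U M \<Longrightarrow> u \<in> U \<Longrightarrow> M u \<subseteq> V"
  unfolding module_partition_def by blast

lemma module_partition_singletons: "module_partition E V V (\<lambda>v. {v})"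
  by (auto simp: module_partition_def)

text \<open>Twins have the same adjacency to each other representative, so the union of their
  modules is uniform towards every other module, and \<open>u\<close> can represent it.\<close>

lemma module_partition_merge:
  assumes part: "module_partition E V U M" and "twins E U u v" "symp E"
  shows "module_partition E V (U - {v}) (M(u := M u \<union> M v))"
proof -
  have uv: "u \<in> U" "v \<in> U" "u \<noteq> v" and tw: "\<And>w. w \<in> U \<Longrightarrow> w \<noteq> u \<Longrightarrow> w \<noteq> v \<Longrightarrow> E u w \<longleftrightarrow> E v w"
    using assms(2) by (auto simp: twins_def)
  have sym: "E x y \<longleftrightarrow> E y x" for x y using assms(3) by (meson sympD)
  let ?M = "M(u := M u \<union> M v)"
  have *: "?M u \<inter> ?M w = {} \<and> (\<forall>x\<in>?M u. \<forall>y\<in>?M w. E x y \<longleftrightarrow> E u w)" if "w \<in> U - {v}" "w \<noteq> u" for w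
    using module_partitionD[OF part uv(1), of w] module_partitionD[OF part uv(2), of w] tw[of w] that
    by auto
  have cover: "(\<Union>w\<in>U - {v}. ?M w) = V"
  proof -
    have "(\<Union>w\<in>U - {v}. ?M w) = (\<Union>w\<in>U. M w)"
      using uv by (auto split: if_splits)
    then show ?thesis using part by (simp add: module_partition_def)
  qed
  have mem: "\<forall>w\<in>U - {v}. w \<in> ?M w"
    using part by (auto simp: module_partition_def)
  have "?M w \<inter> ?M w' = {} \<and> (\<forall>x\<in>?M w. \<forall>y\<in>?M w'. E x y \<longleftrightarrow> E w w')"
    if "w \<in> U - {v}" "w' \<in> U - {v}" "w \<noteq> w'" for w w'
  proof -
    consider "w = u" | "w' = u" | "w \<noteq> u" "w' \<noteq> u" by blast
    then show ?thesis
    proof cases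
      case 1
      then show ?thesis using *[of w'] that by blast
    next
      case 2
      then have "?M w' \<inter> ?M w = {} \<and> (\<forall>x\<in>?M w'. \<forall>y\<in>?M w. E x y \<longleftrightarrow> E w' w)"
        using *[of w] that by blast
      then show ?thesis using sym by (metis Int_commute)
    next
      case 3
      then have "?M w = M w" "?M w' = M w'" by simp_all
      moreover have "M w \<inter> M w' = {} \<and> (\<forall>x\<in>M w. \<forall>y\<in>M w'. E x y \<longleftrightarrow> E w w')"
        using module_partitionD[OF part, of w w'] that by blast
      ultimately show ?thesis by metis
    qed
  qed
  then have "\<forall>w\<in>U - {v}. \<forall>w'\<in>U - {v}. w \<noteq> w' \<longrightarrow>
      ?M w \<inter> ?M w' = {} \<and> (\<forall>x\<in>?M w. \<forall>y\<in>?M w'. E x y \<longleftrightarrow> E w w')"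
    by (intro ballI impI)
  with mem cover show ?thesis
    unfolding module_partition_def by (intro conjI)
qed

section \<open>Directed graphs as adjacency relations\<close>

definition adjacent :: "'a pair_pre_digraph \<Rightarrow> 'a \<Rightarrow> 'a \<Rightarrow> bool" where
  "adjacent G u v \<longleftrightarrow> (u, v) \<in> parcs G"

lemma symp_adjacent: "pair_graph G \<Longrightarrow> symp (adjacent G)"
proof (rule sympI)
  fix u v
  assume "pair_graph G" "adjacent G u v"
  then interpret pair_graph G by simp
  have "sym (parcs G)" using pair_sym_arcs by (simp add: symmetric_def)
  then show "adjacent G v u" using \<open>adjacent G u v\<close> by (auto simp: adjacent_def dest: symD)
qed

lemma irreflp_adjacent: "pair_graph G \<Longrightarrow> irreflp (adjacent G)"
proof (rule irreflpI, rule notI)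
  fix u
  assume "pair_graph G" "adjacent G u u"
  then interpret pair_graph G by simp
  show False using pair_no_loops[of "(u, u)"] \<open>adjacent G u u\<close> by (simp add: adjacent_def)
qed

text \<open>Each arc of a walk starts where the previous one ends, so the list of tails is the list
  of heads shifted by one. This passes from arc lists to vertex lists.\<close>

lemma cas_map_fst:
  assumes "tail H = fst" "head H = snd" "pre_digraph.cas H u p v"
  shows "map fst p @ [v] = u # map snd p" "pre_digraph.awalk_verts H u p = u # map snd p"
  using assms(3)
  by (induction p arbitrary: u) (auto simp: pre_digraph.cas.simps pre_digraph.awalk_verts.simps assms(1,2))

lemma cas_zip:
  assumes "tail H = fst" "head H = snd"
  shows "pre_digraph.cas H u (zip (u # vs) (vs @ [w])) w"
  by (induction vs arbitrary: u) (auto simp: pre_digraph.cas.simps assms)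

text \<open>The rotated list supplies the heads of the arcs of the cycle through \<open>vs\<close>;
  this links it to the successor modulo the length in \<open>acyclic_on\<close>.\<close>

lemma cycle_nth:
  assumes "vs \<noteq> []" "i < length vs"
  shows "(tl vs @ [hd vs]) ! i = vs ! (Suc i mod length vs)"
proof (cases "Suc i = length vs")
  case True
  then show ?thesis using assms True[symmetric] by (simp add: nth_append hd_conv_nth)
next
  case False
  then have "Suc i < length vs" using assms by simp
  moreover from this have "i < length (tl vs)" by simp
  ultimately show ?thesis by (simp only: nth_append nth_tl if_True mod_less)
qed

text \<open>A cycle of arcs is turned into the list of its heads; a closed vertex list, zipped with
  its rotation by one, is turned into a cycle of arcs.\<close>

lemma undirected_forest_iff:
  "undirected_forest (with_proj G \<restriction> X) \<longleftrightarrow> acyclic_on (adjacent G) X"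
proof -
  let ?H = "with_proj G \<restriction> X"
  have H: "tail ?H = fst" "head ?H = snd" by simp_all
  have "(\<exists>p. pre_digraph.cycle ?H p \<and> length p \<ge> 3) \<longleftrightarrow> (\<exists>vs. length vs \<ge> 3 \<and> distinct vs \<and> set vs \<subseteq> X \<and>
      (\<forall>i<length vs. adjacent G (vs ! i) (vs ! (Suc i mod length vs))))"
  proof (intro iffI; elim exE conjE)
    fix p
    assume "pre_digraph.cycle ?H p" and len: "length p \<ge> 3"
    then obtain u where p: "u \<in> X" "set p \<subseteq> arcs ?H" "pre_digraph.cas ?H u p u"
        "distinct (tl (pre_digraph.awalk_verts ?H u p))"
      by (auto simp: pre_digraph.cycle_def pre_digraph.awalk_def)
    note maps = cas_map_fst[OF H p(3)]
    have ne: "p \<noteq> []" using len by auto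
    have dist: "distinct (map snd p)" using p(4) maps(2) by simp
    have fst: "fst (p ! i) = (u # map snd p) ! i" if "i < length p" for i
      using arg_cong[OF maps(1), of "\<lambda>xs. xs ! i"] that by (simp add: nth_append)
    have last: "snd (p ! (length p - 1)) = u"
      using arg_cong[OF maps(1), of last] ne by (simp add: last_map last_conv_nth)
    let ?vs = "map snd p"
    have "adjacent G (?vs ! i) (?vs ! (Suc i mod length ?vs))" if "i < length ?vs" for i
    proof -
      have lt: "Suc i mod length p < length p" using ne by simp
      have "fst (p ! (Suc i mod length p)) = snd (p ! i)"
      proof (cases "Suc i = length p")
        case True
        then have "i = length p - 1" by simp
        then show ?thesis using fst[of 0] ne last True by simp
      next
        case False
        then have "Suc i < length p" using that by simp
        then show ?thesis using fst[of "Suc i"] by simp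
      qed
      moreover have "p ! (Suc i mod length p) \<in> parcs G"
        using p(2) nth_mem[OF lt] by auto
      ultimately show ?thesis
        using that lt by (simp add: adjacent_def) (metis prod.collapse)
    qed
    moreover have "set ?vs \<subseteq> X" using p(2) by auto
    ultimately show "\<exists>vs. length vs \<ge> 3 \<and> distinct vs \<and> set vs \<subseteq> X \<and>
        (\<forall>i<length vs. adjacent G (vs ! i) (vs ! (Suc i mod length vs)))"
      using dist len by (intro exI[of _ ?vs]) simp
  next
    fix vs
    assume vs: "length vs \<ge> 3" "distinct vs" "set vs \<subseteq> X"
      "\<forall>i<length vs. adjacent G (vs ! i) (vs ! (Suc i mod length vs))"
    have ne: "vs \<noteq> []" using vs(1) by auto
    let ?ws = "tl vs @ [hd vs]"
    let ?p = "zip vs ?ws"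
    have len: "length ?ws = length vs" using ne by simp
    have "e \<in> arcs ?H" if "e \<in> set ?p" for e
    proof -
      obtain i where i: "i < length vs" "e = (vs ! i, ?ws ! i)"
        using \<open>e \<in> set ?p\<close> len by (auto simp: set_zip)
      then have "e = (vs ! i, vs ! (Suc i mod length vs))" using cycle_nth[OF ne] by simp
      moreover have "Suc i mod length vs < length vs" using ne by simp
      ultimately show ?thesis
        using vs(3,4) i(1) by (auto simp: adjacent_def)
    qed
    moreover have cas: "pre_digraph.cas ?H (hd vs) ?p (hd vs)"
      using cas_zip[OF H, of "hd vs" "tl vs" "hd vs"] ne by simp
    moreover have "hd vs \<in> X" using ne vs(3) by auto
    moreover have "distinct (tl (pre_digraph.awalk_verts ?H (hd vs) ?p))"
    proof -
      have "map snd ?p = ?ws" using len by simp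
      moreover have "distinct ?ws" using vs(2) ne by (cases vs) auto
      ultimately show ?thesis using cas_map_fst(2)[OF H cas] by simp
    qed
    moreover have "length ?p = length vs" using len by simp
    moreover from this have "?p \<noteq> []" using ne by (metis length_0_conv)
    ultimately have "pre_digraph.cycle ?H ?p \<and> length ?p \<ge> 3"
      unfolding pre_digraph.cycle_def pre_digraph.awalk_def using vs(1)
      by (metis (no_types, lifting) induce_subgraph_verts subsetI)
    then show "\<exists>p. pre_digraph.cycle ?H p \<and> length p \<ge> 3" by blast
  qed
  then show ?thesis by (simp add: undirected_forest_def acyclic_on_def)
qed

text \<open>Connectedness of a digraph means strong connectedness of its symmetric closure. The arcs
  are symmetric already, so the closure adds nothing.\<close>

lemma connected_iff:
  assumes "pair_graph G" "S \<subseteq> pverts G"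
  shows "Digraph_Component.connected (with_proj G \<restriction> S) \<longleftrightarrow> connected_on (adjacent G) S"
proof -
  let ?R = "\<lambda>u v. u \<in> S \<and> v \<in> S \<and> adjacent G u v"
  let ?M = "mk_symmetric (with_proj G \<restriction> S)"
  have sym: "adjacent G u v \<longleftrightarrow> adjacent G v u" for u v
    using symp_adjacent[OF assms(1)] by (meson sympD)
  have arcs: "(u, v) \<in> parcs ?M \<longleftrightarrow> ?R u v" for u v
    using sym[of u v] by (force simp: parcs_mk_symmetric adjacent_def)
  have "(u, v) \<in> rtrancl_on S (parcs ?M) \<longleftrightarrow> ?R\<^sup>*\<^sup>* u v" if "u \<in> S" for u v
  proof
    assume "(u, v) \<in> rtrancl_on S (parcs ?M)"
    then show "?R\<^sup>*\<^sup>* u v"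
    proof (induction rule: rtrancl_on_induct)
      case (step y z)
      then have "?R y z" using arcs by blast
      with step(5) show ?case by (rule rtranclp.rtrancl_into_rtrancl)
    qed simp
  next
    assume "?R\<^sup>*\<^sup>* u v"
    then show "(u, v) \<in> rtrancl_on S (parcs ?M)"
    proof (induction rule: rtranclp_induct)
      case (step y z)
      then show ?case using arcs[of y z] by (meson rtrancl_on_into_rtrancl_on)
    qed (use that in simp)
  qed
  then show ?thesis
    by (simp add: Digraph_Component.connected_def strongly_connected_def reachable_def connected_on_def
        reachable_in_def)
qed

lemma wf_digraph_path_graph: "wf_digraph (with_proj (path_graph r))"
  unfolding wf_digraph_def by (simp add: path_graph_def)

text \<open>The vertices of \<open>path_graph 4\<close> are the positions in
  \<open>[a, b, c, d]\<close>, so list lookup is an isomorphism onto the induced subgraph.\<close>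

lemma induced_free_path_imp_p4_free:
  assumes G: "pair_graph G" and free: "induced_free (with_proj (path_graph 4)) (with_proj G)"
  shows "p4_free (adjacent G) (pverts G)"
  unfolding p4_free_def
proof (intro notI, elim bexE conjE)
  fix a b c d
  assume V: "a \<in> pverts G" "b \<in> pverts G" "c \<in> pverts G" "d \<in> pverts G"
    and dist: "distinct [a, b, c, d]"
    and E: "adjacent G a b" "adjacent G b c" "adjacent G c d"
    and nE: "\<not> adjacent G a c" "\<not> adjacent G a d" "\<not> adjacent G b d"
  interpret pair_graph G by (rule G)
  have sym: "adjacent G u v \<longleftrightarrow> adjacent G v u" for u v
    using symp_adjacent[OF G] by (meson sympD)
  have irr: "\<not> adjacent G u u" for u
    using irreflp_adjacent[OF G] by (meson irreflpD)
  define K where "K = with_proj G \<restriction> {a, b, c, d}"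
  have "induced_subgraph K (with_proj G)"
    unfolding K_def using V by (intro induced_induce) auto
  moreover have "digraph_iso (with_proj (path_graph 4)) K"
  proof -
    define f where "f = (!) [a, b, c, d]"
    let ?hom = "\<lparr>iso_verts = f, iso_arcs = map_prod f f, iso_head = snd, iso_tail = fst\<rparr>"
    have f: "f 0 = a" "f (Suc 0) = b" "f 2 = c" "f 3 = d"
      by (simp_all add: f_def)
    have set4: "{..<4::nat} = {0, Suc 0, 2, 3}" by auto
    have inj: "inj_on f {..<4}"
      unfolding f_def using dist by (simp add: inj_on_nth)
    have P: "verts (with_proj (path_graph 4)) = {..<4}"
      "arcs (with_proj (path_graph 4)) = {(0, Suc 0), (Suc 0, 0), (Suc 0, 2), (2, Suc 0), (2, 3), (3, 2)}"
      by (auto simp: path_graph_def)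
    note wf = wf_digraph_path_graph[of 4]
    have inj_arcs: "inj_on (map_prod f f) (arcs (with_proj (path_graph 4)))"
      by (rule inj_on_subset[OF map_prod_inj_on[OF inj inj]]) (auto simp: path_graph_def)
    have "pre_digraph.digraph_isomorphism (with_proj (path_graph 4)) ?hom"
      unfolding pre_digraph.digraph_isomorphism_def using wf inj inj_arcs P(1) by simp
    moreover have "K = app_iso ?hom (with_proj (path_graph 4))"
    proof -
      have "f ` {..<4} = {a, b, c, d}" unfolding set4 by (simp add: f)
      moreover have "map_prod f f ` arcs (with_proj (path_graph 4)) =
          {e \<in> parcs G. fst e \<in> {a, b, c, d} \<and> snd e \<in> {a, b, c, d}}"
      proof -
        have "map_prod f f ` arcs (with_proj (path_graph 4)) =
            {(a, b), (b, a), (b, c), (c, b), (c, d), (d, c)}"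
          unfolding P by (simp add: f)
        also have "\<dots> = {(u, v). adjacent G u v \<and> u \<in> {a, b, c, d} \<and> v \<in> {a, b, c, d}}"
          using E nE E[THEN sym[THEN iffD1]] nE[unfolded sym[of a] sym[of b d]] irr by auto
        finally show ?thesis by (auto simp: adjacent_def)
      qed
      ultimately show ?thesis
        unfolding K_def app_iso_def induce_subgraph_def using P(1) by simp
    qed
    ultimately show ?thesis unfolding digraph_iso_def by blast
  qed
  ultimately show False using free unfolding induced_free_def by blast
qed

lemma cfvse_iff_best:
  assumes "pair_graph G" "W \<subseteq> pverts G"
  shows "cfvse (G, W, k) \<longleftrightarrow> (\<exists>f<4. best (adjacent G) W (pverts G) (f, 1) > 0 \<and>
    card (pverts G) < best (adjacent G) W (pverts G) (f, 1) + k)"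
proof -
  interpret pair_graph G by (rule assms(1))
  have "cfvse (G, W, k) \<longleftrightarrow> (\<exists>S\<subseteq>pverts G. acyclic_on (adjacent G) (pverts G - S) \<and>
      connected_on (adjacent G) S \<and> W \<subseteq> S \<and> card S \<le> k)"
    unfolding cfvse_def connected_feedback_vertex_set_def feedback_vertex_set_def
    using connected_iff[OF assms(1)] undirected_forest_iff[of G] by auto
  also have "\<dots> \<longleftrightarrow> (\<exists>f<4. best (adjacent G) W (pverts G) (f, 1) > 0 \<and>
    card (pverts G) < best (adjacent G) W (pverts G) (f, 1) + k)"
    using irreflp_adjacent[OF assms(1)] pair_finite_verts assms(2) by (rule connected_feedback_iff_best)
  finally show ?thesis .
qed

section \<open>Runs of the random access machine\<close>

text \<open>Runs are counted in steps and may stop anywhere, so that they can be concatenated; cost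
  and halting are recovered only for the complete run.\<close>

inductive exec :: "instr list \<Rightarrow> nat \<Rightarrow> config \<Rightarrow> config \<Rightarrow> bool" for P where
  exec_refl: "exec P 0 c c"
| exec_step: "pc < length P \<Longrightarrow> exec P t (exec_instr (P ! pc) (pc, X, w)) c \<Longrightarrow>
    exec P (Suc t) (pc, X, w) c"

lemma exec_trans: "exec P t c c' \<Longrightarrow> exec P t' c' c'' \<Longrightarrow> exec P (t + t') c c''"
  by (induction rule: exec.induct) (auto intro: exec.intros)

lemma exec_one:
  "pc < length P \<Longrightarrow> P ! pc = a \<Longrightarrow> exec_instr a (pc, X, w) = c \<Longrightarrow> exec P 1 (pc, X, w) c"
  by (metis One_nat_def exec_refl exec_step)

text \<open>Constants are the only written values bounded neither by the current register contents
  nor by the input alphabet.\<close>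

fun constants_below :: "nat \<Rightarrow> instr \<Rightarrow> bool" where
  "constants_below B (Const i c) \<longleftrightarrow> c < B"
| "constants_below B _ \<longleftrightarrow> True"

lemma bit_length_le: "x < 2 ^ b \<Longrightarrow> b \<ge> 1 \<Longrightarrow> bit_length x \<le> b"
  by (auto simp: bit_length_def floorlog_le_iff)

lemma cost_le:
  assumes "\<And>i. X i < 2 ^ b" "constants_below (2 ^ b) a" "b \<ge> 2"
  shows "cost a (pc, X, w) \<le> 2 * b"
proof -
  have X: "bit_length (X i) \<le> b" for i
    using assms by (intro bit_length_le) auto
  \<comment> \<open>Input symbols, including the end marker 2, have to fit into \<open>b\<close>
    bits; this is why \<open>b\<close> is at least 2.\<close>
  have 4: "4 \<le> (2::nat) ^ b"
    using power_increasing[OF assms(3), of "2::nat"] by simp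
  have "next_symbol w < 2 ^ b"
    using 4 by (cases w) auto
  then have N: "bit_length (next_symbol w) \<le> b"
    using assms(3) by (intro bit_length_le) auto
  show ?thesis
  proof (cases a)
    case (Const i c)
    then have "bit_length c \<le> b" using assms by (intro bit_length_le) auto
    then show ?thesis using Const by simp
  next
    case (Add i j l) then show ?thesis using X[of j] X[of l] by simp
  next
    case (Sub i j l) then show ?thesis using X[of j] X[of l] by simp
  next
    case (Load i j) then show ?thesis using X[of j] X[of "X j"] by simp
  next
    case (Store i j) then show ?thesis using X[of i] X[of j] by simp
  next
    case (Read i) then show ?thesis using N by simp
  next
    case (JumpPos j m) then show ?thesis using X[of j] by simp
  qed
qed

lemma exec_instr_bound:
  assumes "\<And>i. X i < 2 ^ b" "constants_below (2 ^ b) a" "b \<ge> 2"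
  shows "fst (snd (exec_instr a (pc, X, w))) i < 2 ^ Suc b"
proof -
  have X: "X i < 2 * 2 ^ b" for i
    using assms(1)[of i] by simp
  have 4: "4 \<le> (2::nat) ^ b"
    using power_increasing[OF assms(3), of "2::nat"] by simp
  have S: "X j - X l < 2 * 2 ^ b" for j l
    using X[of j] by linarith
  have A: "X j + X l < 2 * 2 ^ b" for j l
    using assms(1)[of j] assms(1)[of l] by linarith
  have N: "next_symbol w < 2 * 2 ^ b"
    using 4 by (cases w) auto
  show ?thesis
    using assms(2) X S A N by (cases a) auto
qed

text \<open>Registers at most double in each step, so the logarithmic cost of a run is quadratic in the
  number of its steps, whatever the program computes.\<close>

lemma halts_in_exec:
  assumes "exec P t c c'" "fst c' \<ge> length P" "\<And>i. fst (snd c) i < 2 ^ b"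
    and "\<And>a. a \<in> set P \<Longrightarrow> constants_below (2 ^ b) a" "b \<ge> 2"
  shows "\<exists>T \<le> 2 * t * (b + t). halts_in P c T (fst (snd c'))"
  using assms
proof (induction arbitrary: b rule: exec.induct)
  case (exec_refl c)
  then show ?case by (cases c) (auto intro: halts_in.intros)
next
  case (exec_step pc t X w c')
  let ?c = "exec_instr (P ! pc) (pc, X, w)"
  have in_P: "P ! pc \<in> set P" using exec_step.hyps by simp
  have bounded: "fst (snd ?c) i < 2 ^ Suc b" for i
    using exec_instr_bound[of X b "P ! pc" pc w i] exec_step.prems in_P by auto
  have "constants_below (2 ^ Suc b) a" if "a \<in> set P" for a
    using exec_step.prems(3)[OF that] by (cases a) auto
  then obtain T where T: "T \<le> 2 * t * (Suc b + t)" "halts_in P ?c T (fst (snd c'))"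
    using exec_step.IH[of "Suc b"] bounded exec_step.prems by auto
  have "cost (P ! pc) (pc, X, w) \<le> 2 * b"
    using exec_step.prems in_P by (intro cost_le) auto
  then have "cost (P ! pc) (pc, X, w) + T \<le> 2 * Suc t * (b + Suc t)"
    using T(1) by (simp add: algebra_simps)
  moreover have "halts_in P (pc, X, w) (cost (P ! pc) (pc, X, w) + T) (fst (snd c'))"
    by (rule halts_in.step[OF exec_step.hyps(1) T(2)])
  ultimately show ?case by blast
qed

definition code_at :: "instr list \<Rightarrow> nat \<Rightarrow> instr list \<Rightarrow> bool" where
  "code_at P p cs \<longleftrightarrow> (\<exists>as bs. P = as @ cs @ bs \<and> length as = p)"

lemma code_at_append: "code_at P p (a @ b) \<Longrightarrow> code_at P p a \<and> code_at P (p + length a) b"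
  unfolding code_at_def by (metis append.assoc length_append)

lemma code_at_Cons:
  assumes "code_at P p (a # cs)"
  shows "p < length P \<and> P ! p = a \<and> code_at P (Suc p) cs"
proof -
  obtain as bs where "P = as @ (a # cs) @ bs" "length as = p"
    using assms unfolding code_at_def by blast
  then have "p < length P \<and> P ! p = a" "P = (as @ [a]) @ cs @ bs" "length (as @ [a]) = Suc p"
    by auto
  then show ?thesis unfolding code_at_def by blast
qed

lemma code_at_nth: "code_at P p cs \<Longrightarrow> i < length cs \<Longrightarrow> p + i < length P \<and> P ! (p + i) = cs ! i"
  unfolding code_at_def by (auto simp: nth_append)


section \<open>A loop language\<close>

text \<open>The memory \<open>m\<close> consists of named arrays; a variable is the entry 0 of an array. The entry \<open>i\<close>
  of array \<open>a < 63\<close> lives in register \<open>64 * i + a\<close>, and the registers \<open>64 * d + 63\<close> are temporaries.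
  Every loop runs once for each symbol of the input, whose length is the variable \<open>LEN\<close>.\<close>

type_synonym mem = "nat \<Rightarrow> nat \<Rightarrow> nat"

datatype expr = C nat | Plus expr expr | Minus expr expr | Get nat expr

datatype com = Skip | Asg nat expr expr | Seq com com | If expr com com | For nat com

definition LEN :: nat where "LEN = 1"
definition TAPE :: nat where "TAPE = 2"

definition upd :: "nat \<Rightarrow> nat \<Rightarrow> nat \<Rightarrow> mem \<Rightarrow> mem" where
  "upd a i v m = m(a := (m a)(i := v))"

fun eval :: "expr \<Rightarrow> mem \<Rightarrow> nat" where
  "eval (C n) m = n"
| "eval (Plus a b) m = eval a m + eval b m"
| "eval (Minus a b) m = eval a m - eval b m"
| "eval (Get a e) m = m a (eval e m)"

text \<open>The counter ends at the loop bound because that is the value with which the compiled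
  loop leaves it, so \<open>run\<close> describes the final memory exactly.\<close>

fun run :: "com \<Rightarrow> mem \<Rightarrow> mem" where
  "run Skip m = m"
| "run (Asg a e1 e2) m = upd a (eval e1 m) (eval e2 m) m"
| "run (Seq c d) m = run d (run c m)"
| "run (If e c d) m = (if eval e m > 0 then run c m else run d m)"
| "run (For i c) m = upd i 0 (m LEN 0) (fold (\<lambda>j m. run c (upd i 0 j m)) [0..<m LEN 0] m)"

fun assigned :: "com \<Rightarrow> nat set" where
  "assigned Skip = {}"
| "assigned (Asg a e1 e2) = {a}"
| "assigned (Seq c d) = assigned c \<union> assigned d"
| "assigned (If e c d) = assigned c \<union> assigned d"
| "assigned (For i c) = insert i (assigned c)"

fun wf_expr :: "expr \<Rightarrow> bool" where
  "wf_expr (C n) \<longleftrightarrow> True"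
| "wf_expr (Plus a b) \<longleftrightarrow> wf_expr a \<and> wf_expr b"
| "wf_expr (Minus a b) \<longleftrightarrow> wf_expr a \<and> wf_expr b"
| "wf_expr (Get a e) \<longleftrightarrow> a < 63 \<and> wf_expr e"

text \<open>A compiled loop keeps its counter in the variable \<open>i\<close> and compares it with
  \<open>LEN\<close> in every round. This agrees with the fold in \<open>run\<close> only if the
  body changes neither of them.\<close>

fun wf_com :: "com \<Rightarrow> bool" where
  "wf_com Skip \<longleftrightarrow> True"
| "wf_com (Asg a e1 e2) \<longleftrightarrow> a < 63 \<and> a \<noteq> LEN \<and> wf_expr e1 \<and> wf_expr e2"
| "wf_com (Seq c d) \<longleftrightarrow> wf_com c \<and> wf_com d"
| "wf_com (If e c d) \<longleftrightarrow> wf_expr e \<and> wf_com c \<and> wf_com d"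
| "wf_com (For i c) \<longleftrightarrow> i < 63 \<and> i \<noteq> LEN \<and> i \<notin> assigned c \<and> wf_com c"

lemma run_frame: "a \<notin> assigned c \<Longrightarrow> run c m a = m a"
proof (induction c arbitrary: m)
  case (For i c)
  have "fold (\<lambda>j m. run c (upd i 0 j m)) js m a = m a" for js m
    using For by (induction js arbitrary: m) (auto simp: upd_def)
  then show ?case using For.prems by (simp add: upd_def)
qed (auto simp: upd_def)

lemma LEN_not_assigned: "wf_com c \<Longrightarrow> LEN \<notin> assigned c"
  by (induction c) auto

section \<open>Compilation to machine code and its step count\<close>

definition temp :: "nat \<Rightarrow> nat" where "temp d = 64 * d + 63"

text \<open>The machine cannot multiply, so the factor 64 is obtained by six doublings.\<close>

definition address :: "nat \<Rightarrow> nat \<Rightarrow> instr list" where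
  "address d a = replicate 6 (Add (temp d) (temp d) (temp d))
    @ [Const (temp (Suc d)) a, Add (temp d) (temp d) (temp (Suc d))]"

text \<open>The temporaries form an evaluation stack: the value is left in \<open>temp d\<close>,
  and deeper ones are free for subexpressions.\<close>

fun compile_expr :: "nat \<Rightarrow> expr \<Rightarrow> instr list" where
  "compile_expr d (C n) = [Const (temp d) n]"
| "compile_expr d (Plus a b) =
    compile_expr d a @ compile_expr (Suc d) b @ [Add (temp d) (temp d) (temp (Suc d))]"
| "compile_expr d (Minus a b) =
    compile_expr d a @ compile_expr (Suc d) b @ [Sub (temp d) (temp d) (temp (Suc d))]"
| "compile_expr d (Get a e) = compile_expr d e @ address d a @ [Load (temp d) (temp d)]"

text \<open>Jumps lead past code that is yet to be placed, so lengths are computed independently of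
  positions.\<close>

fun code_length :: "com \<Rightarrow> nat" where
  "code_length Skip = 0"
| "code_length (Asg a e1 e2) = length (compile_expr 0 e1) + length (compile_expr 1 e2) + 9"
| "code_length (Seq c d) = code_length c + code_length d"
| "code_length (If e c d) = length (compile_expr 0 e) + code_length c + code_length d + 3"
| "code_length (For i c) = code_length c + 8"

text \<open>The first argument is the position of the code in the program, since jumps are absolute.\<close>

fun compile :: "nat \<Rightarrow> com \<Rightarrow> instr list" where
  "compile p Skip = []"
| "compile p (Asg a e1 e2) =
    compile_expr 0 e1 @ address 0 a @ compile_expr 1 e2 @ [Store (temp 0) (temp 1)]"
| "compile p (Seq c d) = compile p c @ compile (p + code_length c) d"
| "compile p (If e c d) =
    (let q = p + length (compile_expr 0 e); r = q + code_length d + 3 in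
      compile_expr 0 e @ [JumpPos (temp 0) r] @ compile (q + 1) d
      @ [Const (temp 0) 1, JumpPos (temp 0) (r + code_length c)] @ compile r c)"
| "compile p (For i c) =
    [Const i 0, Sub (temp 0) LEN i, JumpPos (temp 0) (p + 5), Const (temp 0) 1,
      JumpPos (temp 0) (p + code_length c + 8)] @ compile (p + 5) c
    @ [Const (temp 0) 1, Add i i (temp 0), JumpPos (temp 0) (p + 1)]"

lemma length_compile: "length (compile p c) = code_length c"
  by (induction c arbitrary: p) (auto simp: Let_def address_def)

text \<open>A step bound as a polynomial in the value of \<open>LEN\<close>. Both branches of
  \<open>If\<close> are added, as an upper bound for either that is again a polynomial. A loop
  spends five instructions per round besides its body, and five more on initialising the counter and
  leaving.\<close>

fun time :: "com \<Rightarrow> nat poly" where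
  "time Skip = 0"
| "time (Asg a e1 e2) = [:code_length (Asg a e1 e2):]"
| "time (Seq c d) = time c + time d"
| "time (If e c d) = time c + time d + [:length (compile_expr 0 e) + 3:]"
| "time (For i c) = [:0, 1:] * (time c + [:5:]) + [:5:]"

definition represents :: "(nat \<Rightarrow> nat) \<Rightarrow> mem \<Rightarrow> bool" where
  "represents X m \<longleftrightarrow> (\<forall>a<63. \<forall>i. X (64 * i + a) = m a i)"

lemma temp_inject [simp]: "temp d = temp d' \<longleftrightarrow> d = d'"
  by (simp add: temp_def)

lemma temp_eq_array [simp]: "a < 63 \<Longrightarrow> temp d \<noteq> 64 * i + a"
proof
  assume "a < 63" "temp d = 64 * i + a"
  then have "temp d mod 64 = (64 * i + a) mod 64" by simp
  then show False using \<open>a < 63\<close> by (simp add: temp_def)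
qed

lemma temp_eq_variable [simp]: "a < 63 \<Longrightarrow> temp d \<noteq> a"
  by (simp add: temp_def)

lemmas temp_neq [simp] = temp_eq_array[symmetric] temp_eq_variable[symmetric]

lemma array_inject:
  assumes "a < 63" "b < 63"
  shows "64 * i + a = 64 * j + b \<longleftrightarrow> a = b \<and> i = (j::nat)"
proof
  assume eq: "64 * i + a = 64 * j + b"
  have "(64 * i + a) div 64 = i" "(64 * j + b) div 64 = j" using assms by simp_all
  then have "i = j" using eq by simp
  then show "a = b \<and> i = j" using eq by simp
qed simp

lemma represents_cong:
  assumes "represents X m" "\<And>i. (\<And>d. i \<noteq> temp d) \<Longrightarrow> Y i = X i"
  shows "represents Y m"
  unfolding represents_def
proof (intro allI impI)
  fix a i :: nat
  assume "a < 63"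
  then have "Y (64 * i + a) = X (64 * i + a)" by (intro assms(2)) simp
  then show "Y (64 * i + a) = m a i" using assms(1) \<open>a < 63\<close> by (simp add: represents_def)
qed

lemma represents_temp [simp]: "represents X m \<Longrightarrow> represents (X(temp d := v)) m"
  by (erule represents_cong) auto

lemma represents_upd:
  assumes "represents X m" "a < 63"
  shows "represents (X(64 * i + a := v)) (upd a i v m)"
  using assms by (auto simp: represents_def upd_def array_inject)

lemma represents_upd_0: "represents X m \<Longrightarrow> a < 63 \<Longrightarrow> represents (X(a := v)) (upd a 0 v m)"
  using represents_upd[of X m a 0 v] by simp

lemma represents_variable: "represents X m \<Longrightarrow> a < 63 \<Longrightarrow> X a = m a 0"
  unfolding represents_def by (drule spec[of _ a]) (auto dest: spec[of _ 0])

lemma exec_address: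
  assumes "code_at P p (address d a)"
  shows "\<exists>Y. exec P 8 (p, X, w) (p + 8, Y, w) \<and> Y (temp d) = 64 * X (temp d) + a \<and>
    (\<forall>i. (\<forall>d' \<ge> d. i \<noteq> temp d') \<longrightarrow> Y i = X i)"
proof -
  have nth: "p + k < length P \<and> P ! (p + k) = address d a ! k" if "k < 8" for k
  proof -
    have "length (address d a) = 8" by (simp add: address_def)
    then show ?thesis using code_at_nth[OF assms, of k] that by simp
  qed
  have dbl: "exec P k (p, X, w) (p + k, X(temp d := 2 ^ k * X (temp d)), w)" if "k \<le> 6" for k
    using that
  proof (induction k)
    case 0
    then show ?case by (simp add: exec_refl)
  next
    case (Suc k)
    have "address d a ! k = Add (temp d) (temp d) (temp d)"
      using Suc.prems by (simp add: address_def nth_append)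
    then have "exec P 1 (p + k, X(temp d := 2 ^ k * X (temp d)), w)
        (p + Suc k, X(temp d := 2 ^ Suc k * X (temp d)), w)"
      using nth[of k] Suc.prems by (intro exec_one) (auto simp: mult_2[symmetric] mult.assoc)
    from exec_trans[OF Suc.IH this] Suc.prems show ?case by (simp del: fun_upd_apply)
  qed
  have c: "address d a ! 6 = Const (temp (Suc d)) a"
      "address d a ! 7 = Add (temp d) (temp d) (temp (Suc d))"
    by (simp_all add: address_def nth_append)
  let ?X = "X(temp d := 64 * X (temp d))"
  let ?Y = "?X(temp (Suc d) := a)"
  let ?Z = "?Y(temp d := 64 * X (temp d) + a)"
  have "exec P 6 (p, X, w) (p + 6, ?X, w)"
    using dbl[of 6] by simp
  moreover have "exec P 1 (p + 6, ?X, w) (p + 7, ?Y, w)"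
    using nth[of 6] c by (intro exec_one) auto
  moreover have "exec P 1 (p + 7, ?Y, w) (p + 8, ?Z, w)"
    using nth[of 7] c by (intro exec_one) auto
  ultimately have "exec P (6 + 1 + 1) (p, X, w) (p + 8, ?Z, w)"
    using exec_trans by blast
  then have "exec P 8 (p, X, w) (p + 8, ?Z, w)" by simp
  moreover have "?Z (temp d) = 64 * X (temp d) + a" "\<forall>i. (\<forall>d' \<ge> d. i \<noteq> temp d') \<longrightarrow> ?Z i = X i"
    by auto
  ultimately show ?thesis by blast
qed

text \<open>That only temporaries from \<open>d\<close> on change protects both the represented
  memory and a first operand in \<open>temp d\<close> while the second one is evaluated at depth
  \<open>Suc d\<close>.\<close>

lemma exec_compile_expr:
  assumes "code_at P p (compile_expr d e)" "represents X m" "wf_expr e"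
  shows "\<exists>Y. exec P (length (compile_expr d e)) (p, X, w) (p + length (compile_expr d e), Y, w) \<and>
    Y (temp d) = eval e m \<and> (\<forall>i. (\<forall>d' \<ge> d. i \<noteq> temp d') \<longrightarrow> Y i = X i)"
  using assms
proof (induction e arbitrary: p d X)
  case (C n)
  then have "exec P 1 (p, X, w) (p + 1, X(temp d := n), w)"
    by (intro exec_one) (auto dest: code_at_Cons)
  then have "exec P (length (compile_expr d (C n))) (p, X, w)
      (p + length (compile_expr d (C n)), X(temp d := n), w)" by simp
  moreover have "(X(temp d := n)) (temp d) = eval (C n) m"
    "\<forall>i. (\<forall>d' \<ge> d. i \<noteq> temp d') \<longrightarrow> (X(temp d := n)) i = X i" by auto
  ultimately show ?case by blast
next
  case (Plus a b)
  let ?la = "length (compile_expr d a)" and ?lb = "length (compile_expr (Suc d) b)"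
  have at: "code_at P p (compile_expr d a)" "code_at P (p + ?la) (compile_expr (Suc d) b)"
    "code_at P (p + ?la + ?lb) [Add (temp d) (temp d) (temp (Suc d))]"
    using Plus.prems(1) by (auto dest!: code_at_append)
  obtain Y where Y: "exec P ?la (p, X, w) (p + ?la, Y, w)" "Y (temp d) = eval a m"
      "\<forall>i. (\<forall>d' \<ge> d. i \<noteq> temp d') \<longrightarrow> Y i = X i"
    using Plus.IH(1)[OF at(1)] Plus.prems by auto
  have "represents Y m"
    using Plus.prems(2) Y(3) by (auto intro: represents_cong)
  then obtain Z where Z: "exec P ?lb (p + ?la, Y, w) (p + ?la + ?lb, Z, w)"
      "Z (temp (Suc d)) = eval b m" "\<forall>i. (\<forall>d' \<ge> Suc d. i \<noteq> temp d') \<longrightarrow> Z i = Y i"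
    using Plus.IH(2)[OF at(2)] Plus.prems by auto
  let ?R = "Z(temp d := eval (Plus a b) m)"
  have "Z (temp d) = eval a m" using Y(2) Z(3) by auto
  then have "exec P 1 (p + ?la + ?lb, Z, w) (p + ?la + ?lb + 1, ?R, w)"
    using code_at_Cons[OF at(3)] Z(2) by (intro exec_one) auto
  from exec_trans[OF exec_trans[OF Y(1) Z(1)] this] have
    "exec P (?la + ?lb + 1) (p, X, w) (p + ?la + ?lb + 1, ?R, w)" .
  moreover have "\<forall>i. (\<forall>d' \<ge> d. i \<noteq> temp d') \<longrightarrow> ?R i = X i"
    using Y(3) Z(3) by auto
  moreover have "?R (temp d) = eval (Plus a b) m" by simp
  moreover have "length (compile_expr d (Plus a b)) = ?la + ?lb + 1" by simp
  ultimately show ?case by (intro exI[of _ ?R]) (simp only: add.assoc simp_thms)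
next
  case (Minus a b)
  let ?la = "length (compile_expr d a)" and ?lb = "length (compile_expr (Suc d) b)"
  have at: "code_at P p (compile_expr d a)" "code_at P (p + ?la) (compile_expr (Suc d) b)"
    "code_at P (p + ?la + ?lb) [Sub (temp d) (temp d) (temp (Suc d))]"
    using Minus.prems(1) by (auto dest!: code_at_append)
  obtain Y where Y: "exec P ?la (p, X, w) (p + ?la, Y, w)" "Y (temp d) = eval a m"
      "\<forall>i. (\<forall>d' \<ge> d. i \<noteq> temp d') \<longrightarrow> Y i = X i"
    using Minus.IH(1)[OF at(1)] Minus.prems by auto
  have "represents Y m"
    using Minus.prems(2) Y(3) by (auto intro: represents_cong)
  then obtain Z where Z: "exec P ?lb (p + ?la, Y, w) (p + ?la + ?lb, Z, w)"
      "Z (temp (Suc d)) = eval b m" "\<forall>i. (\<forall>d' \<ge> Suc d. i \<noteq> temp d') \<longrightarrow> Z i = Y i"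
    using Minus.IH(2)[OF at(2)] Minus.prems by auto
  let ?R = "Z(temp d := eval (Minus a b) m)"
  have "Z (temp d) = eval a m" using Y(2) Z(3) by auto
  then have "exec P 1 (p + ?la + ?lb, Z, w) (p + ?la + ?lb + 1, ?R, w)"
    using code_at_Cons[OF at(3)] Z(2) by (intro exec_one) auto
  from exec_trans[OF exec_trans[OF Y(1) Z(1)] this] have
    "exec P (?la + ?lb + 1) (p, X, w) (p + ?la + ?lb + 1, ?R, w)" .
  moreover have "\<forall>i. (\<forall>d' \<ge> d. i \<noteq> temp d') \<longrightarrow> ?R i = X i"
    using Y(3) Z(3) by auto
  moreover have "?R (temp d) = eval (Minus a b) m" by simp
  moreover have "length (compile_expr d (Minus a b)) = ?la + ?lb + 1" by simp
  ultimately show ?case by (intro exI[of _ ?R]) (simp only: add.assoc simp_thms)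
next
  case (Get a e)
  let ?l = "length (compile_expr d e)"
  have len: "length (address d a) = 8" by (simp add: address_def)
  have at: "code_at P p (compile_expr d e)" "code_at P (p + ?l) (address d a)"
    "code_at P (p + ?l + 8) [Load (temp d) (temp d)]"
    using Get.prems(1) len by (auto dest!: code_at_append)
  obtain Y where Y: "exec P ?l (p, X, w) (p + ?l, Y, w)" "Y (temp d) = eval e m"
      "\<forall>i. (\<forall>d' \<ge> d. i \<noteq> temp d') \<longrightarrow> Y i = X i"
    using Get.IH[OF at(1)] Get.prems by auto
  obtain Z where Z: "exec P 8 (p + ?l, Y, w) (p + ?l + 8, Z, w)"
      "Z (temp d) = 64 * Y (temp d) + a" "\<forall>i. (\<forall>d' \<ge> d. i \<noteq> temp d') \<longrightarrow> Z i = Y i"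
    using exec_address[OF at(2)] by blast
  let ?R = "Z(temp d := Z (Z (temp d)))"
  have "exec P 1 (p + ?l + 8, Z, w) (p + ?l + 8 + 1, ?R, w)"
    using code_at_Cons[OF at(3)] by (intro exec_one) auto
  from exec_trans[OF exec_trans[OF Y(1) Z(1)] this] have
    ex: "exec P (?l + 8 + 1) (p, X, w) (p + ?l + 8 + 1, ?R, w)" .
  have "represents Z m"
    using Get.prems(2) Y(3) Z(3) by (auto intro: represents_cong)
  then have "Z (Z (temp d)) = eval (Get a e) m"
    using Y(2) Z(2) Get.prems(3) by (auto simp: represents_def)
  then have "?R (temp d) = eval (Get a e) m" by simp
  moreover have "\<forall>i. (\<forall>d' \<ge> d. i \<noteq> temp d') \<longrightarrow> ?R i = X i"
    using Y(3) Z(3) by auto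
  moreover have "length (compile_expr d (Get a e)) = ?l + 8 + 1"
    by (simp add: len)
  ultimately show ?case using ex by (intro exI[of _ ?R]) (simp only: add.assoc simp_thms)
qed

text \<open>The bound can refer to \<open>LEN\<close> in the initial memory because no well-formed
  command assigns this variable.\<close>

lemma exec_compile:
  assumes "code_at P p (compile p c)" "represents X m" "wf_com c"
  shows "\<exists>t Y. exec P t (p, X, w) (p + code_length c, Y, w) \<and> t \<le> poly (time c) (m LEN 0) \<and>
    represents Y (run c m)"
  using assms
proof (induction c arbitrary: p X m)
  case Skip
  then show ?case by (auto intro: exec_refl)
next
  case (Asg a e1 e2)
  let ?l1 = "length (compile_expr 0 e1)" and ?l2 = "length (compile_expr 1 e2)"
  have len: "length (address 0 a) = 8" by (simp add: address_def)
  have at: "code_at P p (compile_expr 0 e1)" "code_at P (p + ?l1) (address 0 a)"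
    "code_at P (p + ?l1 + 8) (compile_expr 1 e2)"
    "code_at P (p + ?l1 + 8 + ?l2) [Store (temp 0) (temp 1)]"
    using Asg.prems(1) len by (auto dest!: code_at_append)
  obtain Y where Y: "exec P ?l1 (p, X, w) (p + ?l1, Y, w)" "Y (temp 0) = eval e1 m"
      "\<forall>i. (\<forall>d'. i \<noteq> temp d') \<longrightarrow> Y i = X i"
    using exec_compile_expr[OF at(1) Asg.prems(2)] Asg.prems by auto
  obtain Z where Z: "exec P 8 (p + ?l1, Y, w) (p + ?l1 + 8, Z, w)"
      "Z (temp 0) = 64 * Y (temp 0) + a" "\<forall>i. (\<forall>d'. i \<noteq> temp d') \<longrightarrow> Z i = Y i"
    using exec_address[OF at(2)] by blast
  have "represents Z m"
    using Asg.prems(2) Y(3) Z(3) by (auto intro: represents_cong)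
  then obtain R where R: "exec P ?l2 (p + ?l1 + 8, Z, w) (p + ?l1 + 8 + ?l2, R, w)"
      "R (temp 1) = eval e2 m" "\<forall>i. (\<forall>d' \<ge> 1. i \<noteq> temp d') \<longrightarrow> R i = Z i"
    using exec_compile_expr[OF at(3) \<open>represents Z m\<close>, of w] Asg.prems(3) by auto
  have rep: "represents R m"
    using \<open>represents Z m\<close> R(3) by (auto intro: represents_cong)
  have "R (temp 0) = 64 * eval e1 m + a"
    using R(3) Z(2) Y(2) by auto
  then have "exec P 1 (p + ?l1 + 8 + ?l2, R, w)
      (p + ?l1 + 8 + ?l2 + 1, R(64 * eval e1 m + a := eval e2 m), w)"
    using code_at_Cons[OF at(4)] R(2) by (intro exec_one) auto
  from exec_trans[OF exec_trans[OF exec_trans[OF Y(1) Z(1)] R(1)] this]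
  have "exec P (?l1 + 8 + ?l2 + 1) (p, X, w)
      (p + code_length (Asg a e1 e2), R(64 * eval e1 m + a := eval e2 m), w)"
    by (simp add: algebra_simps)
  moreover have "represents (R(64 * eval e1 m + a := eval e2 m)) (run (Asg a e1 e2) m)"
    using represents_upd[OF rep] Asg.prems(3) by simp
  moreover have "?l1 + 8 + ?l2 + 1 \<le> poly (time (Asg a e1 e2)) (m LEN 0)" by simp
  ultimately show ?case by blast
next
  case (Seq c d)
  have at: "code_at P p (compile p c)" "code_at P (p + code_length c) (compile (p + code_length c) d)"
    using Seq.prems(1) by (auto dest!: code_at_append simp: length_compile)
  obtain t Y where Y: "exec P t (p, X, w) (p + code_length c, Y, w)" "t \<le> poly (time c) (m LEN 0)"
      "represents Y (run c m)"
    using Seq.IH(1)[OF at(1) Seq.prems(2)] Seq.prems(3) by auto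
  obtain s Z where Z: "exec P s (p + code_length c, Y, w) (p + code_length c + code_length d, Z, w)"
      "s \<le> poly (time d) (run c m LEN 0)" "represents Z (run d (run c m))"
    using Seq.IH(2)[OF at(2) Y(3)] Seq.prems by auto
  have "run c m LEN = m LEN"
    using Seq.prems(3) by (intro run_frame LEN_not_assigned) auto
  then have "t + s \<le> poly (time (Seq c d)) (m LEN 0)" using Y(2) Z(2) by simp
  moreover have "exec P (t + s) (p, X, w) (p + code_length (Seq c d), Z, w)"
    using exec_trans[OF Y(1) Z(1)] by (simp add: add.assoc)
  ultimately show ?case using Z(3) by auto
next
  case (If e c d)
  define l where "l = length (compile_expr 0 e)"
  define q where "q = p + l"
  define r where "r = q + code_length d + 3"
  have "code_at P p (compile_expr 0 e @ [JumpPos (temp 0) r] @ compile (q + 1) d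
      @ [Const (temp 0) 1, JumpPos (temp 0) (r + code_length c)] @ compile r c)"
    using If.prems(1) by (simp add: Let_def l_def q_def r_def add_ac)
  from code_at_append[OF this] have at1: "code_at P p (compile_expr 0 e)"
    and 1: "code_at P q ([JumpPos (temp 0) r] @ compile (q + 1) d
      @ [Const (temp 0) 1, JumpPos (temp 0) (r + code_length c)] @ compile r c)"
    by (simp_all add: q_def l_def)
  from code_at_append[OF 1] have at2: "code_at P q [JumpPos (temp 0) r]"
    and 2: "code_at P (q + 1) (compile (q + 1) d
      @ [Const (temp 0) 1, JumpPos (temp 0) (r + code_length c)] @ compile r c)"
    by simp_all
  from code_at_append[OF 2] have at3: "code_at P (q + 1) (compile (q + 1) d)"
    and 3: "code_at P (q + 1 + code_length d)
      ([Const (temp 0) 1, JumpPos (temp 0) (r + code_length c)] @ compile r c)"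
    by (simp_all add: length_compile)
  from code_at_append[OF 3] have at4: "code_at P (q + 1 + code_length d)
      [Const (temp 0) 1, JumpPos (temp 0) (r + code_length c)]"
    and at5: "code_at P r (compile r c)"
    by (simp_all add: r_def add_ac eval_nat_numeral)
  note at = at1 at2 at3 at4 at5
  obtain Y where Y: "exec P l (p, X, w) (q, Y, w)" "Y (temp 0) = eval e m"
      "\<forall>i. (\<forall>d'. i \<noteq> temp d') \<longrightarrow> Y i = X i"
    using exec_compile_expr[OF at(1) If.prems(2)] If.prems by (auto simp: l_def q_def)
  have rep: "represents Y m"
    using If.prems(2) Y(3) by (auto intro: represents_cong)
  have end_pos: "p + code_length (If e c d) = r + code_length c"
    by (simp add: q_def r_def l_def)
  show ?case
  proof (cases "eval e m > 0")
    case True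
    then have e: "exec P 1 (q, Y, w) (r, Y, w)"
      using code_at_Cons[OF at(2)] Y(2) by (intro exec_one) auto
    obtain t Z where Z: "exec P t (r, Y, w) (r + code_length c, Z, w)"
        "t \<le> poly (time c) (m LEN 0)" "represents Z (run c m)"
      using If.IH(1)[OF at(5) rep] If.prems by auto
    have "exec P (l + 1 + t) (p, X, w) (p + code_length (If e c d), Z, w)"
      unfolding end_pos by (rule exec_trans[OF exec_trans[OF Y(1) e] Z(1)])
    moreover have "l + 1 + t \<le> poly (time (If e c d)) (m LEN 0)" using Z(2) by (simp add: l_def)
    moreover have "represents Z (run (If e c d) m)" using True Z(3) by simp
    ultimately show ?thesis by blast
  next
    case False
    then have e1: "exec P 1 (q, Y, w) (q + 1, Y, w)"
      using code_at_Cons[OF at(2)] Y(2) by (intro exec_one) auto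
    obtain t Z where Z: "exec P t (q + 1, Y, w) (q + 1 + code_length d, Z, w)"
        "t \<le> poly (time d) (m LEN 0)" "represents Z (run d m)"
      using If.IH(2)[OF at(3) rep] If.prems by auto
    \<comment> \<open>The code of \<open>d\<close> comes first; a conditional jump on the constant 1
      then skips the code of \<open>c\<close>.\<close>
    have e2: "exec P 1 (q + 1 + code_length d, Z, w) (q + 1 + code_length d + 1, Z(temp 0 := 1), w)"
      using code_at_nth[OF at(4), of 0] by (intro exec_one) auto
    have e3: "exec P 1 (q + 1 + code_length d + 1, Z(temp 0 := 1), w)
        (r + code_length c, Z(temp 0 := 1), w)"
      using code_at_nth[OF at(4), of 1] by (intro exec_one) auto
    note exec_trans[OF exec_trans[OF exec_trans[OF exec_trans[OF Y(1) e1] Z(1)] e2] e3]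
    moreover have "l + 1 + t + 1 + 1 \<le> poly (time (If e c d)) (m LEN 0)" using Z(2) by (simp add: l_def)
    moreover have "represents (Z(temp 0 := 1)) (run (If e c d) m)" using False Z(3) by simp
    ultimately show ?thesis unfolding end_pos by blast
  qed
next
  case (For i c)
  define L where "L = m LEN 0"
  define q where "q = p + 5 + code_length c"
  have i: "i < 63" "i \<noteq> LEN" "i \<notin> assigned c" "wf_com c"
    using For.prems by auto
  from code_at_append[OF For.prems(1)[unfolded compile.simps]]
  have at1: "code_at P p [Const i 0, Sub (temp 0) LEN i, JumpPos (temp 0) (p + 5), Const (temp 0) 1,
      JumpPos (temp 0) (p + code_length c + 8)]"
    and 1: "code_at P (p + 5) (compile (p + 5) c
      @ [Const (temp 0) 1, Add i i (temp 0), JumpPos (temp 0) (p + 1)])"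
    by (simp_all add: eval_nat_numeral)
  from code_at_append[OF 1] have at2: "code_at P (p + 5) (compile (p + 5) c)"
    and at3: "code_at P q [Const (temp 0) 1, Add i i (temp 0), JumpPos (temp 0) (p + 1)]"
    by (simp_all add: length_compile q_def)
  note at = at1 at2 at3
  have head: "p < length P" "P ! p = Const i 0" "p + 1 < length P" "P ! (p + 1) = Sub (temp 0) LEN i"
    "p + 2 < length P" "P ! (p + 2) = JumpPos (temp 0) (p + 5)"
    "p + 3 < length P" "P ! (p + 3) = Const (temp 0) 1"
    "p + 4 < length P" "P ! (p + 4) = JumpPos (temp 0) (p + code_length c + 8)"
    using code_at_nth[OF at(1), of 0] code_at_nth[OF at(1), of 1] code_at_nth[OF at(1), of 2]
      code_at_nth[OF at(1), of 3] code_at_nth[OF at(1), of 4] by simp_all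
  have tail: "q < length P" "P ! q = Const (temp 0) 1" "q + 1 < length P" "P ! (q + 1) = Add i i (temp 0)"
    "q + 2 < length P" "P ! (q + 2) = JumpPos (temp 0) (p + 1)"
    using code_at_nth[OF at(3), of 0] code_at_nth[OF at(3), of 1] code_at_nth[OF at(3), of 2]
    by simp_all
  let ?body = "\<lambda>j m. run c (upd i 0 j m)"
  let ?end = "p + code_length (For i c)"
  \<comment> \<open>Induction on the number \<open>n\<close> of remaining rounds, entering at the
    test \<open>p + 1\<close> with the counter already set to \<open>j\<close>.\<close>
  have loop: "\<exists>t Y. exec P t (p + 1, X, w) (?end, Y, w) \<and> t \<le> n * (poly (time c) L + 5) + 4 \<and>
      represents Y (upd i 0 L (fold ?body [j..<L] m'))"
    if "represents X (upd i 0 j m')" "m' LEN 0 = L" "j + n = L" for n j X m'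
    using that
  proof (induction n arbitrary: j X m')
    case (0 j X m')
    have "X LEN = L" "X i = L"
      using represents_variable[OF 0(1), of LEN] represents_variable[OF 0(1), of i] 0 i
      by (auto simp: upd_def LEN_def)
    then have e1: "exec P 1 (p + 1, X, w) (p + 2, X(temp 0 := 0), w)"
      by (intro exec_one[OF head(3,4)]) simp
    have e2: "exec P 1 (p + 2, X(temp 0 := 0), w) (p + 3, X(temp 0 := 0), w)"
      by (rule exec_one[OF head(5,6)]) simp
    have e3: "exec P 1 (p + 3, X(temp 0 := 0), w) (p + 4, X(temp 0 := 1), w)"
      by (rule exec_one[OF head(7,8)]) simp
    have e4: "exec P 1 (p + 4, X(temp 0 := 1), w) (?end, X(temp 0 := 1), w)"
      by (rule exec_one[OF head(9,10)]) simp
    note exec_trans[OF exec_trans[OF exec_trans[OF e1 e2] e3] e4]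
    moreover have "represents (X(temp 0 := 1)) (upd i 0 L (fold ?body [j..<L] m'))" using 0 by simp
    moreover have "1 + 1 + 1 + 1 \<le> 0 * (poly (time c) L + 5) + (4::nat)" by simp
    ultimately show ?case by blast
  next
    case (Suc n j X m')
    have "X LEN = L" "X i = j"
      using represents_variable[OF Suc(2), of LEN] represents_variable[OF Suc(2), of i] Suc.prems i
      by (auto simp: upd_def LEN_def)
    \<comment> \<open>The truncated difference computed by the test is the number of remaining
      rounds, so it is positive exactly while the loop has to continue.\<close>
    then have "X LEN - X i = Suc n" using Suc.prems by simp
    then have e1: "exec P 1 (p + 1, X, w) (p + 2, X(temp 0 := Suc n), w)"
      by (intro exec_one[OF head(3,4)]) simp
    have e2: "exec P 1 (p + 2, X(temp 0 := Suc n), w) (p + 5, X(temp 0 := Suc n), w)"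
      by (rule exec_one[OF head(5,6)]) simp
    have L: "upd i 0 j m' LEN 0 = L" using i Suc.prems by (simp add: upd_def)
    obtain t Y where Y: "exec P t (p + 5, X(temp 0 := Suc n), w) (q, Y, w)"
        "t \<le> poly (time c) L" "represents Y (?body j m')"
      using For.IH[OF at(2) represents_temp[OF Suc.prems(1), of 0 "Suc n"] i(4)]
      unfolding q_def L by blast
    have "?body j m' i 0 = j" using run_frame[OF i(3)] by (simp add: upd_def)
    then have Yi: "Y i = j" using represents_variable[OF Y(3) i(1)] by simp
    let ?Y = "Y(temp 0 := 1)"
    let ?Z = "?Y(i := Suc j)"
    have e3: "exec P 1 (q, Y, w) (q + 1, ?Y, w)"
      by (rule exec_one[OF tail(1,2)]) simp
    have e4: "exec P 1 (q + 1, ?Y, w) (q + 2, ?Z, w)"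
      using Yi i(1) by (intro exec_one[OF tail(3,4)]) simp
    have e5: "exec P 1 (q + 2, ?Z, w) (p + 1, ?Z, w)"
      using i(1) by (intro exec_one[OF tail(5,6)]) simp
    note pre = exec_trans[OF exec_trans[OF exec_trans[OF exec_trans[OF exec_trans[OF e1 e2] Y(1)] e3] e4] e5]
    have "represents ?Z (upd i 0 (Suc j) (?body j m'))"
      using Y(3) i(1) by (intro represents_upd_0) auto
    moreover have "?body j m' LEN 0 = L"
      using run_frame[OF LEN_not_assigned[OF i(4)]] L by simp
    ultimately obtain s R where R: "exec P s (p + 1, ?Z, w) (?end, R, w)"
        "s \<le> n * (poly (time c) L + 5) + 4"
        "represents R (upd i 0 L (fold ?body [Suc j..<L] (?body j m')))"
      using Suc.IH[of ?Z "Suc j" "?body j m'"] Suc.prems(3) by (auto simp del: fun_upd_apply)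
    have "[j..<L] = j # [Suc j..<L]" using Suc.prems by (simp add: upt_conv_Cons)
    then have "represents R (upd i 0 L (fold ?body [j..<L] m'))" using R(3) by simp
    moreover have "1 + 1 + t + 1 + 1 + 1 + s \<le> Suc n * (poly (time c) L + 5) + 4"
      using R(2) Y(2) by simp
    ultimately show ?case using exec_trans[OF pre R(1)] by blast
  qed
  have e0: "exec P 1 (p, X, w) (p + 1, X(i := 0), w)"
    by (rule exec_one[OF head(1,2)]) simp
  obtain t Y where Y: "exec P t (p + 1, X(i := 0), w) (?end, Y, w)"
      "t \<le> L * (poly (time c) L + 5) + 4"
      "represents Y (upd i 0 L (fold ?body [0..<L] m))"
    using loop[of "X(i := 0)" 0 m L] represents_upd_0[OF For.prems(2) i(1)]
    by (auto simp: L_def simp del: fun_upd_apply)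
  have "1 + t \<le> poly (time (For i c)) (m LEN 0)" "represents Y (run (For i c) m)"
    using Y(2,3) by (simp_all add: L_def)
  then show ?case using exec_trans[OF e0 Y(1)] by blast
qed

section \<open>Loading the input into memory\<close>

text \<open>Subtracting a symbol from 2 gives a positive number for a bit and 0 for the end marker.
  The address of the next \<open>TAPE\<close> entry is kept in \<open>temp 2\<close> and advances by
  64, the distance between consecutive entries of an array. The compiled program follows at position
  13.\<close>

definition read_input :: "instr list" where
  "read_input = [Const (temp 2) TAPE, Read (temp 0), Const (temp 1) 2, Sub (temp 1) (temp 1) (temp 0),
    JumpPos (temp 1) 7, Const (temp 1) 1, JumpPos (temp 1) 13, Store (temp 2) (temp 0),
    Const (temp 1) 64, Add (temp 2) (temp 2) (temp 1), Const (temp 1) 1, Add LEN LEN (temp 1),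
    JumpPos (temp 1) 1]"

definition input_mem :: "bool list \<Rightarrow> mem" where
  "input_mem w = (\<lambda>a i. if a = LEN \<and> i = 0 then length w
    else if a = TAPE \<and> i < length w then of_bool (w ! i) else 0)"

lemma input_mem_snoc:
  "input_mem (u @ [b]) = upd LEN 0 (Suc (length u)) (upd TAPE (length u) (of_bool b) (input_mem u))"
  by (intro ext) (auto simp: input_mem_def upd_def nth_append LEN_def TAPE_def)

text \<open>\<open>u\<close> is the part already copied. Each further symbol takes 10 instructions,
  and 6 notice the end.\<close>

lemma exec_read_input_loop:
  assumes "code_at P 0 read_input" "represents X (input_mem u)" "X (temp 2) = 64 * length u + TAPE"
  shows "\<exists>t Y. exec P t (1, X, w) (13, Y, []) \<and> t = 10 * length w + 6 \<and>
    represents Y (input_mem (u @ w))"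
  using assms
proof (induction w arbitrary: X u)
  case Nil
  have nth: "i < length P \<and> P ! i = read_input ! i" if "i < 13" for i
    using code_at_nth[OF Nil.prems(1), of i] that by (simp add: read_input_def)
  let ?X = "X(temp 0 := 2)"
  have e1: "exec P 1 (1, X, []) (2, ?X, [])"
    using nth[of 1] by (intro exec_one) (auto simp: read_input_def)
  have e2: "exec P 1 (2, ?X, []) (3, ?X(temp 1 := 2), [])"
    using nth[of 2] by (intro exec_one) (auto simp: read_input_def)
  have e3: "exec P 1 (3, ?X(temp 1 := 2), []) (4, ?X(temp 1 := 0), [])"
    using nth[of 3] by (intro exec_one) (auto simp: read_input_def)
  have e4: "exec P 1 (4, ?X(temp 1 := 0), []) (5, ?X(temp 1 := 0), [])"
    using nth[of 4] by (intro exec_one) (auto simp: read_input_def)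
  have e5: "exec P 1 (5, ?X(temp 1 := 0), []) (6, ?X(temp 1 := 1), [])"
    using nth[of 5] by (intro exec_one) (auto simp: read_input_def)
  have e6: "exec P 1 (6, ?X(temp 1 := 1), []) (13, ?X(temp 1 := 1), [])"
    using nth[of 6] by (intro exec_one) (auto simp: read_input_def)
  note exec_trans[OF exec_trans[OF exec_trans[OF exec_trans[OF exec_trans[OF e1 e2] e3] e4] e5] e6]
  moreover have "represents (?X(temp 1 := 1)) (input_mem (u @ []))"
    using Nil.prems(2) by simp
  moreover have "1 + 1 + 1 + 1 + 1 + 1 = 10 * length ([] :: bool list) + 6" by simp
  ultimately show ?case by blast
next
  case (Cons b w)
  have nth: "i < length P \<and> P ! i = read_input ! i" if "i < 13" for i
    using code_at_nth[OF Cons.prems(1), of i] that by (simp add: read_input_def)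
  let ?X = "X(temp 0 := of_bool b)"
  let ?a = "64 * length u + TAPE"
  let ?Y = "?X(?a := of_bool b)"
  let ?Z = "?Y(temp 2 := ?a + 64)"
  let ?R = "(?Z(temp 1 := 1))(LEN := Suc (length u))"
  have names: "TAPE < 63" "LEN < 63" by (simp_all add: TAPE_def LEN_def)
  note [simp] = names
  have X: "X LEN = length u"
    using represents_variable[OF Cons.prems(2) names(2)] by (simp add: input_mem_def)
  have LEN_neq: "LEN \<noteq> ?a" by (simp add: TAPE_def LEN_def)
  have e1: "exec P 1 (1, X, b # w) (2, ?X, w)"
    using nth[of 1] by (intro exec_one) (auto simp: read_input_def)
  have e2: "exec P 1 (2, ?X, w) (3, ?X(temp 1 := 2), w)"
    using nth[of 2] by (intro exec_one) (auto simp: read_input_def)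
  have e3: "exec P 1 (3, ?X(temp 1 := 2), w) (4, ?X(temp 1 := 2 - of_bool b), w)"
    using nth[of 3] by (intro exec_one) (auto simp: read_input_def)
  have e4: "exec P 1 (4, ?X(temp 1 := 2 - of_bool b), w) (7, ?X(temp 1 := 2 - of_bool b), w)"
    using nth[of 4] by (intro exec_one) (auto simp: read_input_def)
  have e5: "exec P 1 (7, ?X(temp 1 := 2 - of_bool b), w) (8, ?Y(temp 1 := 2 - of_bool b), w)"
    using nth[of 7] Cons.prems(3)
    by (intro exec_one) (auto simp: read_input_def fun_upd_twist)
  have e6: "exec P 1 (8, ?Y(temp 1 := 2 - of_bool b), w) (9, ?Y(temp 1 := 64), w)"
    using nth[of 8] by (intro exec_one) (auto simp: read_input_def)
  have e7: "exec P 1 (9, ?Y(temp 1 := 64), w) (10, ?Z(temp 1 := 64), w)"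
    using nth[of 9] Cons.prems(3)
    by (intro exec_one) (auto simp: read_input_def fun_upd_twist)
  have e8: "exec P 1 (10, ?Z(temp 1 := 64), w) (11, ?Z(temp 1 := 1), w)"
    using nth[of 10] by (intro exec_one) (auto simp: read_input_def)
  have e9: "exec P 1 (11, ?Z(temp 1 := 1), w) (12, ?R, w)"
    using nth[of 11] X LEN_neq by (intro exec_one) (auto simp: read_input_def)
  have e10: "exec P 1 (12, ?R, w) (1, ?R, w)"
    using nth[of 12] by (intro exec_one) (auto simp: read_input_def)
  note pre = exec_trans[OF exec_trans[OF exec_trans[OF exec_trans[OF exec_trans[OF exec_trans[OF
    exec_trans[OF exec_trans[OF exec_trans[OF e1 e2] e3] e4] e5] e6] e7] e8] e9] e10]
  have "represents (?Z(temp 1 := 1)) (upd TAPE (length u) (of_bool b) (input_mem u))"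
    using represents_upd[of ?X "input_mem u" TAPE "length u" "of_bool b"] Cons.prems(2) by simp
  then have "represents ?R (input_mem (u @ [b]))"
    unfolding input_mem_snoc by (intro represents_upd_0) auto
  moreover have "?R (temp 2) = 64 * length (u @ [b]) + TAPE" by simp
  ultimately obtain t S where S: "exec P t (1, ?R, w) (13, S, [])" "t = 10 * length w + 6"
      "represents S (input_mem (u @ b # w))"
    using Cons.IH[OF Cons.prems(1), of ?R "u @ [b]"] by (auto simp del: fun_upd_apply)
  have "1 + 1 + 1 + 1 + 1 + 1 + 1 + 1 + 1 + 1 + t = 10 * length (b # w) + 6"
    using S(2) by simp
  then show ?case using exec_trans[OF pre S(1)] S(3) by blast
qed

lemma constants_bounded: "\<exists>b \<ge> 2. \<forall>a \<in> set P. constants_below (2 ^ b) a"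
proof (induction P)
  case (Cons a P)
  then obtain b where b: "b \<ge> 2" "\<forall>a \<in> set P. constants_below (2 ^ b) a" by blast
  obtain d where d: "constants_below (2 ^ d) a"
    by (cases a) (auto intro: less_exp)
  have mono: "constants_below (2 ^ max b d) a'" if "constants_below (2 ^ e) a'" "e \<le> max b d" for e a'
    using that power_increasing[of e "max b d" "2::nat"] by (cases a') (auto intro: less_le_trans)
  show ?case
    using b d by (intro exI[of _ "max b d"]) (auto intro: mono)
qed auto

theorem loop_program_poly_time:
  assumes "wf_com c"
  shows "\<exists>P p. \<forall>w. \<exists>t X. halts_in P (initial_config w) t X \<and> t \<le> poly p (length w) \<and>
    X 0 = run c (input_mem w) 0 0"
proof -
  let ?P = "read_input @ compile 13 c"
  obtain b where b: "b \<ge> 2" "\<forall>a \<in> set ?P. constants_below (2 ^ b) a"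
    using constants_bounded by blast
  \<comment> \<open>One initial instruction and \<open>10 * length w + 6\<close> for copying, then
    the compiled program. The polynomial \<open>p\<close> is the cost bound of
    \<open>halts_in_exec\<close> applied to \<open>q\<close> steps.\<close>
  define q where "q = [:7, 10:] + time c"
  define p where "p = 2 * q * ([:b:] + q)"
  have len: "length read_input = 13" by (simp add: read_input_def)
  have "code_at ?P 0 (read_input @ compile 13 c)"
    unfolding code_at_def by (intro exI[of _ "[]"]) simp
  from code_at_append[OF this] have at: "code_at ?P 0 read_input" "code_at ?P 13 (compile 13 c)"
    by (simp_all add: len)
  have "\<exists>t X. halts_in ?P (initial_config w) t X \<and> t \<le> poly p (length w) \<and>
    X 0 = run c (input_mem w) 0 0" for w
  proof -
    let ?X = "(\<lambda>_. 0 :: nat)(temp 2 := TAPE)"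
    have e1: "exec ?P 1 (0, \<lambda>_. 0, w) (1, ?X, w)"
      using code_at_nth[OF at(1), of 0] by (intro exec_one) (auto simp: read_input_def)
    have "represents ?X (input_mem [])"
      by (intro represents_temp) (auto simp: represents_def input_mem_def)
    then obtain s Y where Y: "exec ?P s (1, ?X, w) (13, Y, [])" "s = 10 * length w + 6"
        "represents Y (input_mem w)"
      using exec_read_input_loop[OF at(1), of ?X "[]" w] by auto
    obtain t Z where Z: "exec ?P t (13, Y, []) (13 + code_length c, Z, [])"
        "t \<le> poly (time c) (input_mem w LEN 0)" "represents Z (run c (input_mem w))"
      using exec_compile[OF at(2) Y(3) assms] by blast
    have t: "1 + s + t \<le> poly q (length w)"
      using Y(2) Z(2) by (simp add: q_def input_mem_def)
    obtain T where T: "T \<le> 2 * (1 + s + t) * (b + (1 + s + t))"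
        "halts_in ?P (initial_config w) T Z"
      using halts_in_exec[OF exec_trans[OF exec_trans[OF e1 Y(1)] Z(1)], of b] b
      by (auto simp: initial_config_def length_compile len)
    have "T \<le> 2 * poly q (length w) * (b + poly q (length w))"
      by (rule order_trans[OF T(1)]) (intro mult_mono add_mono t, auto)
    then have "T \<le> poly p (length w)" by (simp add: p_def)
    moreover have "Z 0 = run c (input_mem w) 0 0"
      using represents_variable[OF Z(3), of 0] by simp
    ultimately show ?thesis using T(2) by blast
  qed
  then show ?thesis by blast
qed

section \<open>The program\<close>

abbreviation (input) "OUT \<equiv> 0 :: nat"
abbreviation (input) "IDX \<equiv> 3 :: nat"
abbreviation (input) "SIZE \<equiv> 4 :: nat"
abbreviation (input) "BUDGET \<equiv> 5 :: nat"
abbreviation (input) "POS \<equiv> 6 :: nat"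
abbreviation (input) "ROW \<equiv> 7 :: nat"
abbreviation (input) "ALIVE \<equiv> 8 :: nat"
abbreviation (input) "ROUND \<equiv> 9 :: nat"
abbreviation (input) "FST \<equiv> 10 :: nat"
abbreviation (input) "SND \<equiv> 11 :: nat"
abbreviation (input) "THIRD \<equiv> 12 :: nat"
abbreviation (input) "BAD \<equiv> 13 :: nat"

text \<open>The 15 types get the arrays 16 to 30 for the tables and 32 to 46 for scratch values,
  clear of the named variables and of the temporaries.\<close>

definition table :: "nat \<times> nat \<Rightarrow> nat" where "table \<tau> = 16 + 3 * fst \<tau> + snd \<tau>"
definition fresh :: "nat \<times> nat \<Rightarrow> nat" where "fresh \<tau> = 32 + 3 * fst \<tau> + snd \<tau>"

abbreviation (input) "var a \<equiv> Get a (C 0)"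
abbreviation (input) "assign a e \<equiv> Asg a (C 0) e"
abbreviation (input) "adj_expr u v \<equiv> Get TAPE (Plus (Get ROW u) v)"
text \<open>Subtraction is truncated, so this is the absolute difference, positive exactly if the
  values differ.\<close>

abbreviation (input) "dist_expr a b \<equiv> Plus (Minus a b) (Minus b a)"
abbreviation (input) "When e c \<equiv> If e c Skip"

definition seqs :: "com list \<Rightarrow> com" where "seqs cs = foldr Seq cs Skip"

text \<open>While only ones have been read, \<open>SIZE\<close> equals \<open>IDX\<close>. The
  closing 0 stops the count, and from then on \<open>IDX\<close> exceeds \<open>SIZE\<close>, so all
  later bits are ignored.\<close>

definition read_size :: com where
  "read_size = For IDX (If (Minus (var IDX) (var SIZE)) Skip
    (When (Get TAPE (var IDX)) (assign SIZE (Plus (var SIZE) (C 1)))))"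

text \<open>The matrix follows \<open>n\<close> ones, a 0 and the vector of \<open>W\<close>, thus
  starts at \<open>2 * n + 1\<close>. Its row positions are accumulated by addition for lack of a
  product.\<close>

definition locate_rows :: com where
  "locate_rows = Seq (assign POS (Plus (Plus (var SIZE) (var SIZE)) (C 1)))
    (For IDX (Seq (Asg ROW (var IDX) (var POS)) (assign POS (Plus (var POS) (var SIZE)))))"

text \<open>The least significant bit comes first, so Horner's scheme reads backwards from the end
  of the input; the end of the matrix, kept in \<open>ROW\<close> at index \<open>SIZE\<close>,
  tells how many bits to take.\<close>

definition read_budget :: com where
  "read_budget = For IDX (When (Minus (Minus (var LEN) (Get ROW (var SIZE))) (var IDX))
    (assign BUDGET (Plus (Plus (var BUDGET) (var BUDGET))
      (Get TAPE (Minus (Minus (var LEN) (C 1)) (var IDX))))))"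

text \<open>The nonzero entries are those of \<open>best_singleton\<close>; the vector of
  \<open>W\<close> starts at tape position \<open>n + 1\<close>.\<close>

definition init_tables :: com where
  "init_tables = For IDX (When (Minus (var SIZE) (var IDX))
    (Seq (Asg ALIVE (var IDX) (C 1)) (Seq (Asg (table (0, 1)) (var IDX) (C 1))
      (If (Get TAPE (Plus (Plus (var SIZE) (C 1)) (var IDX))) Skip
        (Asg (table (1, 0)) (var IDX) (C 2))))))"

definition check_twins :: com where
  "check_twins = Seq (assign BAD (C 0)) (For THIRD (When (Get ALIVE (var THIRD))
    (When (dist_expr (var THIRD) (var FST)) (When (dist_expr (var THIRD) (var SND))
      (When (dist_expr (adj_expr (var FST) (var THIRD)) (adj_expr (var SND) (var THIRD)))
        (assign BAD (C 1)))))))"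

definition combine_step :: "bool \<Rightarrow> (nat \<times> nat) \<times> (nat \<times> nat) \<Rightarrow> com" where
  "combine_step j pq = (let t = Get (table (fst pq)) (var FST); u = Get (table (snd pq)) (var SND);
      c = fresh (compose_types j (fst pq) (snd pq)); g = Minus (Plus t u) (C 1) in
    When t (When u (When (Minus g (var c)) (assign c g))))"

text \<open>Results are collected in the \<open>fresh\<close> variables because every combination
  still reads the old entries at \<open>FST\<close>.\<close>

definition merge :: "bool \<Rightarrow> com" where
  "merge j = Seq (seqs (map (\<lambda>\<tau>. assign (fresh \<tau>) (C 0)) types))
    (Seq (seqs (map (combine_step j) (List.product types types)))
      (seqs (map (\<lambda>\<tau>. Asg (table \<tau>) (var FST) (var (fresh \<tau>))) types)))"

text \<open>Removing the larger twin keeps vertex 0 alive, so the final table is found at a fixed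
  entry. Loop indices beyond the vertices are filtered out by \<open>ALIVE\<close>.\<close>

definition try_merge :: com where
  "try_merge = When (Minus (var SND) (var FST)) (When (Get ALIVE (var FST)) (When (Get ALIVE (var SND))
    (Seq check_twins (If (var BAD) Skip
      (Seq (If (adj_expr (var FST) (var SND)) (merge True) (merge False))
        (Asg ALIVE (var SND) (C 0)))))))"

definition sweep :: com where
  "sweep = For FST (For SND try_merge)"

definition answer :: com where
  "answer = seqs (map (\<lambda>f. When (Get (table (f, 1)) (C 0))
    (When (Minus (Plus (Get (table (f, 1)) (C 0)) (var BUDGET)) (var SIZE)) (assign OUT (C 1)))) [0..<4])"

definition main :: com where
  "main = seqs [read_size, locate_rows, read_budget, init_tables, For ROUND sweep, answer]"

section \<open>Arrays written by the program, and its well-formedness\<close>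

lemma upd_apply: "upd a i v m b = (if b = a then (m a)(i := v) else m b)"
  by (simp add: upd_def)

lemma run_seqs: "run (seqs cs) m = fold run cs m"
  unfolding seqs_def by (induction cs arbitrary: m) auto

lemma assigned_seqs: "assigned (seqs cs) = (\<Union>c\<in>set cs. assigned c)"
  unfolding seqs_def by (induction cs) auto

lemma wf_com_seqs: "wf_com (seqs cs) \<longleftrightarrow> (\<forall>c\<in>set cs. wf_com c)"
  unfolding seqs_def by (induction cs) auto

lemma in_types_iff: "\<tau> \<in> set types \<longleftrightarrow> fst \<tau> < 5 \<and> snd \<tau> < 3"
  by (cases \<tau>) (simp add: types_def)

lemma compose_types_in_types:
  assumes "p \<in> set types" "q \<in> set types"
  shows "compose_types j p q \<in> set types"
proof -
  have *: "forest_join a b < 5" "forest_union a b < 5" if "a < 5" "b < 5" for a b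
    using that by (auto simp: forest_join_def forest_union_def)
  have **: "connection_join a b < 3" "connection_union a b < 3" if "a < 3" "b < 3" for a b
    using that by (auto simp: connection_join_def connection_union_def)
  obtain a b c d where pq: "p = (a, b)" "q = (c, d)" by (metis surj_pair)
  show ?thesis
    using assms * ** unfolding pq by (simp add: in_types_iff)
qed

lemma table_bounds: "\<tau> \<in> set types \<Longrightarrow> 16 \<le> table \<tau> \<and> table \<tau> \<le> 30"
  by (simp add: in_types_iff table_def)

lemma fresh_bounds: "\<tau> \<in> set types \<Longrightarrow> 32 \<le> fresh \<tau> \<and> fresh \<tau> \<le> 46"
  by (simp add: in_types_iff fresh_def)

lemma encoding_inject:
  assumes "s < 3" "s' < 3" "3 * f + s = 3 * f' + (s' :: nat)"
  shows "f = f' \<and> s = s'"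
proof -
  have "f = f'" using assms by linarith
  then show ?thesis using assms(3) by simp
qed

lemma table_inject: "\<tau> \<in> set types \<Longrightarrow> \<tau>' \<in> set types \<Longrightarrow> table \<tau> = table \<tau>' \<longleftrightarrow> \<tau> = \<tau>'"
  using encoding_inject[of "snd \<tau>" "snd \<tau>'" "fst \<tau>" "fst \<tau>'"]
  by (auto simp: in_types_iff table_def prod_eq_iff)

lemma fresh_inject: "\<tau> \<in> set types \<Longrightarrow> \<tau>' \<in> set types \<Longrightarrow> fresh \<tau> = fresh \<tau>' \<longleftrightarrow> \<tau> = \<tau>'"
  using encoding_inject[of "snd \<tau>" "snd \<tau>'" "fst \<tau>" "fst \<tau>'"]
  by (auto simp: in_types_iff fresh_def prod_eq_iff)

lemma assigned_combine_step:
  "pq \<in> set types \<times> set types \<Longrightarrow> assigned (combine_step j pq) \<subseteq> {32..46}"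
  using fresh_bounds[OF compose_types_in_types, of "fst pq" "snd pq" j]
  by (auto simp: combine_step_def Let_def)

lemma assigned_merge: "assigned (merge j) \<subseteq> {16..30} \<union> {32..46}"
proof -
  have "assigned (combine_step j pq) \<subseteq> {32..46}" if "pq \<in> set (List.product types types)" for pq
    using that by (intro assigned_combine_step) simp
  then show ?thesis
    using table_bounds fresh_bounds unfolding merge_def by (fastforce simp: assigned_seqs)
qed

lemma wf_combine_step: "pq \<in> set types \<times> set types \<Longrightarrow> wf_com (combine_step j pq)"
  using fresh_bounds[OF compose_types_in_types, of "fst pq" "snd pq" j]
    table_bounds[of "fst pq"] table_bounds[of "snd pq"]
  by (auto simp: combine_step_def Let_def LEN_def)

lemma wf_merge: "wf_com (merge j)"
proof -
  have "wf_com (combine_step j pq)" if "pq \<in> set (List.product types types)" for pq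
    using that by (intro wf_combine_step) simp
  moreover have "table \<tau> < 63 \<and> table \<tau> \<noteq> LEN \<and> fresh \<tau> < 63 \<and> fresh \<tau> \<noteq> LEN" if "\<tau> \<in> set types" for \<tau>
    using table_bounds[OF that] fresh_bounds[OF that] by (simp add: LEN_def)
  ultimately show ?thesis unfolding merge_def by (simp add: wf_com_seqs)
qed

lemma assigned_try_merge: "assigned try_merge \<subseteq> {ALIVE, THIRD, BAD} \<union> {16..30} \<union> {32..46}"
  using assigned_merge[of True] assigned_merge[of False]
  unfolding try_merge_def check_twins_def by auto

lemma wf_try_merge: "wf_com try_merge"
  unfolding try_merge_def check_twins_def by (simp add: wf_merge LEN_def TAPE_def)

lemma wf_main: "wf_com main"
proof -
  have "FST \<notin> assigned try_merge" "SND \<notin> assigned try_merge" "ROUND \<notin> assigned try_merge"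
    using assigned_try_merge by auto
  then have "wf_com (For ROUND sweep)"
    unfolding sweep_def by (simp add: wf_try_merge LEN_def)
  moreover have "wf_com answer"
    unfolding answer_def by (auto simp: wf_com_seqs table_def LEN_def)
  ultimately show ?thesis
    unfolding main_def by (simp add: wf_com_seqs read_size_def locate_rows_def read_budget_def
        init_tables_def LEN_def TAPE_def table_def)
qed

section \<open>Effect of loops and of a merge\<close>

text \<open>\<open>I j\<close> describes the memory before the counter is set to \<open>j\<close>,
  and \<open>I L\<close> the memory before its final value is stored; each use has to carry the
  invariant across that last update.\<close>

lemma For_invariant:
  assumes "m LEN 0 = L" "I 0 m" "\<And>j m. j < L \<Longrightarrow> I j m \<Longrightarrow> I (Suc j) (run c (upd i 0 j m))"
  shows "\<exists>m'. run (For i c) m = upd i 0 L m' \<and> I L m'"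
proof -
  have "I l (fold (\<lambda>j m. run c (upd i 0 j m)) [0..<l] m)" if "l \<le> L" for l
    using that by (induction l) (auto simp: assms)
  from this[of L] show ?thesis unfolding run.simps assms(1) by blast
qed

lemma run_combine_step:
  assumes "pq \<in> set types \<times> set types" "\<tau> \<in> set types"
  shows "run (combine_step j pq) m (fresh \<tau>) 0 = (if compose_types j (fst pq) (snd pq) = \<tau>
    then max (m (fresh \<tau>) 0) (gain (m (table (fst pq)) (m FST 0)) (m (table (snd pq)) (m SND 0)))
    else m (fresh \<tau>) 0)"
proof -
  have "compose_types j (fst pq) (snd pq) \<in> set types"
    using assms(1) by (intro compose_types_in_types) auto
  then have "fresh \<tau> = fresh (compose_types j (fst pq) (snd pq)) \<longleftrightarrow> compose_types j (fst pq) (snd pq) = \<tau>"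
    using fresh_inject[OF assms(2)] by metis
  then show ?thesis
    by (auto simp: combine_step_def Let_def upd_apply gain_def)
qed

text \<open>The steps write only \<open>fresh\<close> variables, so all gains refer to the tables
  before the merge and the variable for \<tau> keeps a running maximum.\<close>

lemma run_combine_steps:
  assumes "set pqs \<subseteq> set types \<times> set types" "\<tau> \<in> set types"
  shows "fold run (map (combine_step j) pqs) m (fresh \<tau>) 0 = Max (insert (m (fresh \<tau>) 0)
    ((\<lambda>pq. gain (m (table (fst pq)) (m FST 0)) (m (table (snd pq)) (m SND 0))) `
      {pq \<in> set pqs. compose_types j (fst pq) (snd pq) = \<tau>}))"
  using assms(1)
proof (induction pqs arbitrary: m)
  case (Cons pq pqs)
  let ?m = "run (combine_step j pq) m"
  let ?g = "\<lambda>pq. gain (m (table (fst pq)) (m FST 0)) (m (table (snd pq)) (m SND 0))"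
  let ?S = "{pq \<in> set pqs. compose_types j (fst pq) (snd pq) = \<tau>}"
  have pq: "pq \<in> set types \<times> set types" using Cons.prems by simp
  have frame: "?m a = m a" if "a < 32" for a
    using assigned_combine_step[OF pq, of j] that by (intro run_frame) auto
  have tables: "?m (table p) = m (table p)" if "p \<in> set types" for p
    using table_bounds[OF that] by (intro frame) simp
  have "(\<lambda>pq. gain (?m (table (fst pq)) (?m FST 0)) (?m (table (snd pq)) (?m SND 0))) ` ?S = ?g ` ?S"
  proof (intro image_cong refl)
    fix x assume "x \<in> ?S"
    then have "fst x \<in> set types" "snd x \<in> set types" using Cons.prems by auto
    then show "gain (?m (table (fst x)) (?m FST 0)) (?m (table (snd x)) (?m SND 0)) = ?g x"
      by (simp add: tables frame)
  qed
  then have "fold run (map (combine_step j) (pq # pqs)) m (fresh \<tau>) 0 = Max (insert (?m (fresh \<tau>) 0) (?g ` ?S))"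
    using Cons.IH[of ?m] Cons.prems by simp
  moreover have "{x \<in> set (pq # pqs). compose_types j (fst x) (snd x) = \<tau>} =
      (if compose_types j (fst pq) (snd pq) = \<tau> then insert pq ?S else ?S)" by auto
  moreover have "Max (insert (max a b) A) = Max (insert a (insert b A))" if "finite A" for a b :: nat and A
    using that by (cases "A = {}") (simp_all add: max.assoc)
  ultimately show ?case
    by (simp add: run_combine_step[OF pq assms(2)])
qed simp

lemma run_clear:
  assumes "set \<tau>s \<subseteq> set types" "\<tau> \<in> set types"
  shows "fold run (map (\<lambda>\<tau>. assign (fresh \<tau>) (C 0)) \<tau>s) m (fresh \<tau>) 0 =
    (if \<tau> \<in> set \<tau>s then 0 else m (fresh \<tau>) 0)"
  using assms(1)
  by (induction \<tau>s arbitrary: m) (auto simp: upd_apply fresh_inject[OF assms(2)])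

lemma run_copy:
  assumes "set \<tau>s \<subseteq> set types" "\<tau> \<in> set types"
  shows "fold run (map (\<lambda>\<tau>. Asg (table \<tau>) (var FST) (var (fresh \<tau>))) \<tau>s) m (table \<tau>) =
    (if \<tau> \<in> set \<tau>s then (m (table \<tau>))(m FST 0 := m (fresh \<tau>) 0) else m (table \<tau>))"
  using assms(1)
proof (induction \<tau>s arbitrary: m)
  case (Cons \<sigma> \<tau>s)
  let ?m = "run (Asg (table \<sigma>) (var FST) (var (fresh \<sigma>))) m"
  have "?m FST = m FST" "?m (fresh \<tau>) = m (fresh \<tau>)"
    using table_bounds[of \<sigma>] fresh_bounds[OF assms(2)] Cons.prems by (auto simp: upd_apply)
  moreover have "?m (table \<tau>) = (if \<tau> = \<sigma> then (m (table \<tau>))(m FST 0 := m (fresh \<tau>) 0) else m (table \<tau>))"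
    using table_inject[OF assms(2), of \<sigma>] Cons.prems by (auto simp: upd_apply)
  ultimately show ?case using Cons.IH[of ?m] Cons.prems by auto
qed simp

lemma run_merge:
  assumes "\<tau> \<in> set types"
  shows "run (merge j) m (table \<tau>) = (m (table \<tau>))(m FST 0 :=
    combine j (\<lambda>p. m (table p) (m FST 0)) (\<lambda>q. m (table q) (m SND 0)) \<tau>)"
proof -
  define m1 where "m1 = fold run (map (\<lambda>\<tau>. assign (fresh \<tau>) (C 0)) types) m"
  define m2 where "m2 = fold run (map (combine_step j) (List.product types types)) m1"
  have m1: "m1 a = m a" if "a < 32" for a
  proof -
    have "a \<notin> assigned (seqs (map (\<lambda>\<tau>. assign (fresh \<tau>) (C 0)) types))"
      using that by (auto simp: assigned_seqs dest: fresh_bounds)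
    then show ?thesis using run_frame by (simp add: m1_def run_seqs[symmetric])
  qed
  have m2: "m2 a = m1 a" if "a < 32" for a
  proof -
    have "assigned (combine_step j pq) \<subseteq> {32..46}" if "pq \<in> set (List.product types types)" for pq
      using that by (intro assigned_combine_step) simp
    then have "a \<notin> assigned (seqs (map (combine_step j) (List.product types types)))"
      using that by (fastforce simp: assigned_seqs)
    then show ?thesis using run_frame by (simp add: m2_def run_seqs[symmetric])
  qed
  have tables: "m1 (table p) = m (table p)" "m2 (table p) = m (table p)" if "p \<in> set types" for p
    using table_bounds[OF that] by (simp_all add: m1 m2)
  have "m2 (fresh \<tau>) 0 = Max (insert 0 ((\<lambda>pq. gain (m1 (table (fst pq)) (m FST 0)) (m1 (table (snd pq)) (m SND 0))) `
      {pq \<in> set types \<times> set types. compose_types j (fst pq) (snd pq) = \<tau>}))"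
    unfolding m2_def using run_combine_steps[of "List.product types types" \<tau> j m1] assms
    by (simp add: m1 run_clear[of types \<tau> m, folded m1_def])
  also have "\<dots> = combine j (\<lambda>p. m (table p) (m FST 0)) (\<lambda>q. m (table q) (m SND 0)) \<tau>"
    unfolding combine_def by (intro arg_cong[of _ _ Max] arg_cong[of _ _ "insert 0"] image_cong)
      (auto simp: tables)
  finally have "m2 (fresh \<tau>) 0 = combine j (\<lambda>p. m (table p) (m FST 0)) (\<lambda>q. m (table q) (m SND 0)) \<tau>" .
  moreover have "run (merge j) m = fold run (map (\<lambda>\<tau>. Asg (table \<tau>) (var FST) (var (fresh \<tau>))) types) m2"
    by (simp add: merge_def run_seqs m1_def m2_def)
  ultimately show ?thesis
    using run_copy[of types \<tau> m2] assms by (simp add: m1 m2 tables)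
qed

section \<open>Correctness of the program\<close>

text \<open>One step of Horner's scheme: appending bit \<open>e\<close> to the part of
  \<open>k\<close> above it.\<close>

lemma double_div_bit: "2 * (k div 2 ^ Suc e) + of_bool (bit k e) = k div 2 ^ e" for k :: nat
proof -
  have "k div 2 ^ Suc e = k div 2 ^ e div 2"
    unfolding power_Suc2 by (rule div_mult2_eq)
  then show ?thesis by (simp add: bit_iff_odd flip: mod_2_eq_odd)
qed

locale cfvse_input =
  fixes G :: "nat pair_pre_digraph" and W :: "nat set" and k n :: nat
  assumes graph: "pair_graph G" and verts: "pverts G = {..<n}" and W: "W \<subseteq> {..<n}"
    and p4_free: "p4_free (adjacent G) {..<n}"
begin

abbreviation "E \<equiv> adjacent G"
abbreviation "input \<equiv> encode (G, W, k)"
abbreviation "L \<equiv> length input"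
abbreviation "tape \<equiv> input_mem input TAPE"

section \<open>Layout of the encoded input and its parsing\<close>

lemma input_eq: "input = replicate n True @ [False] @ map (\<lambda>v. v \<in> W) [0..<n]
    @ map (\<lambda>uv. uv \<in> parcs G) (List.product [0..<n] [0..<n]) @ map (bit k) [0..<floorlog 2 k]"
  by (simp add: encode_def verts)

lemma L_eq: "L = 2 * n + 1 + n * n + floorlog 2 k"
  by (simp add: input_eq)

lemma n_less_L: "n < L"
  by (simp add: L_eq)

lemma tape_nth: "i < L \<Longrightarrow> tape i = of_bool (input ! i)"
  by (simp add: input_mem_def TAPE_def LEN_def)

lemma tape_size: "i \<le> n \<Longrightarrow> tape i = of_bool (i < n)"
  using tape_nth[of i] n_less_L by (auto simp: input_eq nth_append)

lemma tape_W: "v < n \<Longrightarrow> tape (n + 1 + v) = of_bool (v \<in> W)"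
  using tape_nth[of "n + 1 + v"] L_eq by (simp add: input_eq nth_append)

lemma tape_adjacent:
  assumes "u < n" "v < n"
  shows "tape (2 * n + 1 + u * n + v) = of_bool (E u v)"
proof -
  have lt: "u * n + v < n * n"
  proof -
    have "u * n + v < Suc u * n" using assms(2) by simp
    also have "\<dots> \<le> n * n" using assms(1) by (intro mult_right_mono) auto
    finally show ?thesis .
  qed
  have "List.product [0..<n] [0..<n] ! (u * n + v) = (u, v)"
    using lt assms by (simp add: product_nth)
  then have "input ! (2 * n + 1 + u * n + v) = E u v"
    using lt by (simp add: input_eq nth_append adjacent_def)
  then show ?thesis
    using tape_nth[of "2 * n + 1 + u * n + v"] lt by (simp add: L_eq)
qed

lemma tape_budget: "j < floorlog 2 k \<Longrightarrow> tape (2 * n + 1 + n * n + j) = of_bool (bit k j)"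
  using tape_nth[of "2 * n + 1 + n * n + j"] L_eq by (simp add: input_eq nth_append)

definition inputs_ok :: "mem \<Rightarrow> bool" where
  "inputs_ok m \<longleftrightarrow> m LEN 0 = L \<and> m TAPE = tape"

lemma inputs_ok_frame:
  assumes "inputs_ok m" "wf_com c" "TAPE \<notin> assigned c"
  shows "inputs_ok (run c m)"
  using assms run_frame[OF LEN_not_assigned[OF assms(2)]] run_frame[OF assms(3)]
  by (simp add: inputs_ok_def)

lemma inputs_ok_upd: "inputs_ok m \<Longrightarrow> a \<noteq> LEN \<Longrightarrow> a \<noteq> TAPE \<Longrightarrow> inputs_ok (upd a i v m)"
  by (simp add: inputs_ok_def upd_apply)

lemma inputs_ok_init: "inputs_ok (input_mem input)"
  by (simp add: inputs_ok_def) (simp add: input_mem_def)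

lemma run_read_size:
  assumes "inputs_ok m" "m SIZE 0 = 0"
  shows "run read_size m SIZE 0 = n"
proof -
  \<comment> \<open>The minimum expresses both phases: counting along the ones, then standing
    still.\<close>
  let ?I = "\<lambda>j m. inputs_ok m \<and> m SIZE 0 = min j n"
  have "\<exists>m'. run read_size m = upd IDX 0 L m' \<and> ?I L m'"
    unfolding read_size_def
  proof (rule For_invariant[where I = ?I])
    fix j m
    assume j: "j < L" and I: "?I j m"
    have tape: "m TAPE j = of_bool (j < n)" if "j \<le> n"
      using I tape_size[OF that] by (simp add: inputs_ok_def)
    show "?I (Suc j) (run (If (Minus (var IDX) (var SIZE)) Skip
        (When (Get TAPE (var IDX)) (assign SIZE (Plus (var SIZE) (C 1))))) (upd IDX 0 j m))"
      using I tape by (cases "j \<le> n") (auto simp: upd_apply inputs_ok_def LEN_def TAPE_def)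
  qed (use assms in \<open>auto simp: inputs_ok_def\<close>)
  then show ?thesis using n_less_L by (auto simp: upd_apply)
qed

text \<open>The index \<open>n\<close> is included although there is no such row: its position is
  where the binary digits of \<open>k\<close> begin.\<close>

definition rows_ok :: "mem \<Rightarrow> bool" where
  "rows_ok m \<longleftrightarrow> m SIZE 0 = n \<and> (\<forall>u\<le>n. m ROW u = 2 * n + 1 + u * n)"

lemma run_locate_rows:
  assumes "inputs_ok m" "m SIZE 0 = n"
  shows "rows_ok (run locate_rows m)"
proof -
  let ?I = "\<lambda>j m. inputs_ok m \<and> m SIZE 0 = n \<and> m POS 0 = 2 * n + 1 + j * n \<and>
    (\<forall>u<j. m ROW u = 2 * n + 1 + u * n)"
  let ?m = "run (assign POS (Plus (Plus (var SIZE) (var SIZE)) (C 1))) m"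
  have "\<exists>m'. run (For IDX (Seq (Asg ROW (var IDX) (var POS)) (assign POS (Plus (var POS) (var SIZE))))) ?m =
      upd IDX 0 L m' \<and> ?I L m'"
  proof (rule For_invariant[where I = ?I])
    fix j m
    assume "j < L" and I: "?I j m"
    let ?m' = "upd POS 0 (2 * n + 1 + Suc j * n) (upd ROW j (2 * n + 1 + j * n) (upd IDX 0 j m))"
    have "run (Seq (Asg ROW (var IDX) (var POS)) (assign POS (Plus (var POS) (var SIZE)))) (upd IDX 0 j m) = ?m'"
      using I by (simp add: upd_apply)
    moreover have "inputs_ok ?m'"
      using I by (intro inputs_ok_upd) (auto simp: LEN_def TAPE_def)
    moreover have "?m' ROW u = 2 * n + 1 + u * n" if "u < Suc j" for u
      using I that by (cases "u = j") (simp_all add: upd_apply)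
    ultimately show "?I (Suc j) (run (Seq (Asg ROW (var IDX) (var POS))
        (assign POS (Plus (var POS) (var SIZE)))) (upd IDX 0 j m))"
      using I by (simp add: upd_apply)
  qed (use assms in \<open>auto simp: inputs_ok_def upd_apply LEN_def TAPE_def\<close>)
  then obtain m' where m': "run (For IDX (Seq (Asg ROW (var IDX) (var POS))
      (assign POS (Plus (var POS) (var SIZE))))) ?m = upd IDX 0 L m'" "?I L m'" by blast
  have "run locate_rows m = upd IDX 0 L m'"
    unfolding locate_rows_def run.simps(3) by (rule m'(1))
  then show ?thesis using m'(2) n_less_L by (simp add: upd_apply rows_ok_def)
qed

lemma run_read_budget:
  assumes "inputs_ok m" "rows_ok m" "m BUDGET 0 = 0"
  shows "run read_budget m BUDGET 0 = k"
proof -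
  let ?d = "floorlog 2 k"
  \<comment> \<open>After \<open>j\<close> rounds the \<open>j\<close> leading bits of
    \<open>k\<close> have been read. Truncated subtraction makes this \<open>k\<close> itself once
    the bits are exhausted.\<close>
  let ?I = "\<lambda>j m. inputs_ok m \<and> rows_ok m \<and> m BUDGET 0 = k div 2 ^ (?d - j)"
  have small: "k < 2 ^ ?d"
    using floorlog_bounds[of k 2] by (cases "k = 0") auto
  have "\<exists>m'. run read_budget m = upd IDX 0 L m' \<and> ?I L m'"
    unfolding read_budget_def
  proof (rule For_invariant[where I = ?I])
    fix j m
    assume "j < L" and I: "?I j m"
    let ?c = "When (Minus (Minus (var LEN) (Get ROW (var SIZE))) (var IDX))
      (assign BUDGET (Plus (Plus (var BUDGET) (var BUDGET))
        (Get TAPE (Minus (Minus (var LEN) (C 1)) (var IDX)))))"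
    have m: "m LEN 0 = L" "m TAPE = tape" "m ROW n = 2 * n + 1 + n * n" "m SIZE 0 = n"
      using I by (auto simp: inputs_ok_def rows_ok_def)
    have ok: "inputs_ok (run ?c (upd IDX 0 j m))" "rows_ok (run ?c (upd IDX 0 j m))"
      using I by (auto simp: upd_apply inputs_ok_def rows_ok_def LEN_def TAPE_def)
    show "?I (Suc j) (run ?c (upd IDX 0 j m))"
    proof (cases "j < ?d")
      case True
      define e where "e = ?d - Suc j"
      have e: "?d - j = Suc e" "e < ?d" "L - 1 - j = 2 * n + 1 + n * n + e"
        using True by (auto simp: e_def L_eq)
      have "L - (2 * n + 1 + n * n) - j > 0" using True by (simp add: L_eq)
      then have "run ?c (upd IDX 0 j m) BUDGET 0 = 2 * m BUDGET 0 + tape (L - 1 - j)"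
        using m by (simp add: upd_apply LEN_def TAPE_def)
      also have "\<dots> = 2 * (k div 2 ^ Suc e) + of_bool (bit k e)"
        using I by (simp only: e(1) e(3) tape_budget[OF e(2)])
      also have "\<dots> = k div 2 ^ e"
        by (rule double_div_bit)
      finally show ?thesis using ok by (simp add: e_def)
    next
      case False
      then have "\<not> L - (2 * n + 1 + n * n) - j > 0" by (simp add: L_eq)
      then have "run ?c (upd IDX 0 j m) BUDGET 0 = m BUDGET 0"
        using m by (simp add: upd_apply LEN_def)
      then show ?thesis using ok I False by simp
    qed
  qed (use assms small in \<open>auto simp: inputs_ok_def\<close>)
  moreover have "?d - L = 0" by (simp add: L_eq)
  ultimately show ?thesis by (auto simp: upd_apply)
qed

section \<open>The invariant of the tables\<close>

definition alive :: "mem \<Rightarrow> nat set" where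
  "alive m = {v. m ALIVE v > 0}"

text \<open>Vertex 0 must survive because the answer is read there. The zeros beyond
  \<open>n\<close> serve the graph without vertices, for which the program still inspects entry
  0.\<close>

definition tables_ok :: "mem \<Rightarrow> bool" where
  "tables_ok m \<longleftrightarrow> inputs_ok m \<and> rows_ok m \<and> m BUDGET 0 = k \<and> alive m \<subseteq> {..<n} \<and>
    (n > 0 \<longrightarrow> 0 \<in> alive m) \<and> (\<forall>\<tau>\<in>set types. \<forall>u\<ge>n. m (table \<tau>) u = 0) \<and>
    (\<exists>M. module_partition E {..<n} (alive m) M \<and>
      (\<forall>\<tau>\<in>set types. \<forall>u\<in>alive m. m (table \<tau>) u = best E W (M u) \<tau>))"

lemma tables_ok_cong:
  assumes "tables_ok m" "\<And>a. a \<in> {LEN, TAPE, SIZE, ROW, BUDGET, ALIVE} \<union> {16..30} \<Longrightarrow> m' a = m a"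
  shows "tables_ok m'" "alive m' = alive m"
proof -
  have eq: "m' LEN = m LEN" "m' TAPE = m TAPE" "m' SIZE = m SIZE" "m' ROW = m ROW"
    "m' BUDGET = m BUDGET" "m' ALIVE = m ALIVE"
    using assms(2) by simp_all
  have "m' (table \<tau>) = m (table \<tau>)" if "\<tau> \<in> set types" for \<tau>
    using table_bounds[OF that] by (intro assms(2)) simp
  then show "tables_ok m'" "alive m' = alive m"
    using assms(1) by (simp_all add: tables_ok_def inputs_ok_def rows_ok_def alive_def eq)
qed

lemma tables_ok_upd:
  assumes "tables_ok m" "a \<in> {IDX, ROUND, FST, SND, THIRD, BAD}"
  shows "tables_ok (upd a i v m)" "alive (upd a i v m) = alive m"
proof -
  have "upd a i v m b = m b" if "b \<in> {LEN, TAPE, SIZE, ROW, BUDGET, ALIVE} \<union> {16..30}" for b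
    using that assms(2) by (auto simp: upd_apply LEN_def TAPE_def)
  then show "tables_ok (upd a i v m)" "alive (upd a i v m) = alive m"
    using tables_ok_cong[OF assms(1)] by blast+
qed

lemma run_init_tables:
  assumes "inputs_ok m" "rows_ok m" "m BUDGET 0 = k" "m ALIVE = (\<lambda>_. 0)"
    "\<And>\<tau>. \<tau> \<in> set types \<Longrightarrow> m (table \<tau>) = (\<lambda>_. 0)"
  shows "tables_ok (run init_tables m)"
proof -
  let ?I = "\<lambda>j m. inputs_ok m \<and> rows_ok m \<and> m BUDGET 0 = k \<and>
    (\<forall>u. m ALIVE u = of_bool (u < min j n)) \<and>
    (\<forall>\<tau>\<in>set types. \<forall>u. m (table \<tau>) u = (if u < min j n then best E W {u} \<tau> else 0))"
  have irr: "irreflp E" using irreflp_adjacent[OF graph] .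
  have table_neq: "table \<tau> \<noteq> LEN" "table \<tau> \<noteq> TAPE" "table \<tau> \<noteq> SIZE" "table \<tau> \<noteq> BUDGET"
    "table \<tau> \<noteq> ROW" "table \<tau> \<noteq> ALIVE" "table \<tau> \<noteq> IDX" for \<tau>
    by (simp_all add: table_def LEN_def TAPE_def)
  have in_types: "(0, 1) \<in> set types" "(1, 0) \<in> set types" by (simp_all add: in_types_iff)
  have "\<exists>m'. run init_tables m = upd IDX 0 L m' \<and> ?I L m'"
    unfolding init_tables_def
  proof (rule For_invariant[where I = ?I])
    fix j m
    assume "j < L" and I: "?I j m"
    let ?c = "When (Minus (var SIZE) (var IDX))
      (Seq (Asg ALIVE (var IDX) (C 1)) (Seq (Asg (table (0, 1)) (var IDX) (C 1))
        (If (Get TAPE (Plus (Plus (var SIZE) (C 1)) (var IDX))) Skip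
          (Asg (table (1, 0)) (var IDX) (C 2)))))"
    let ?m = "run ?c (upd IDX 0 j m)"
    show "?I (Suc j) ?m"
    proof (cases "j < n")
      case False
      then have "?m = upd IDX 0 j m" using I by (simp add: upd_apply rows_ok_def)
      then show ?thesis
        using False I table_neq by (simp add: upd_apply inputs_ok_def rows_ok_def LEN_def TAPE_def)
    next
      case True
      have "m TAPE (n + 1 + j) = of_bool (j \<in> W)"
        using I tape_W[OF True] by (simp add: inputs_ok_def)
      then have m: "?m = (let m' = upd (table (0, 1)) j 1 (upd ALIVE j 1 (upd IDX 0 j m)) in
          if j \<in> W then m' else upd (table (1, 0)) j 2 m')"
        using True I table_neq by (simp add: upd_apply rows_ok_def TAPE_def Let_def)
      have "?m (table \<tau>) u = (if u < min (Suc j) n then best E W {u} \<tau> else 0)" if "\<tau> \<in> set types" for \<tau> u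
      proof -
        have "m (table \<tau>) u = (if u < j then best E W {u} \<tau> else 0)"
          using I that True by simp
        then have "?m (table \<tau>) u = (if u < j then best E W {u} \<tau> else if u = j then best E W {j} \<tau> else 0)"
          unfolding m best_singleton[OF irr]
          using table_inject[OF that in_types(1)] table_inject[OF that in_types(2)]
            table_inject[OF in_types] table_neq
          by (auto simp: upd_apply Let_def)
        moreover have "u < min (Suc j) n \<longleftrightarrow> u < j \<or> u = j" using True by auto
        ultimately show ?thesis by (cases "u = j") (simp_all del: run.simps)
      qed
      moreover have "inputs_ok ?m" "rows_ok ?m" "?m BUDGET 0 = k" "?m ALIVE u = of_bool (u < min (Suc j) n)" for u
        using I True table_neq table_neq[symmetric] unfolding m
        by (auto simp: upd_apply inputs_ok_def rows_ok_def LEN_def TAPE_def Let_def)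
      ultimately show ?thesis by blast
    qed
  qed (use assms in \<open>auto simp: inputs_ok_def\<close>)
  then obtain m' where m': "run init_tables m = upd IDX 0 L m'" "?I L m'" by blast
  have "alive m' = {..<n}" using m'(2) n_less_L by (auto simp: alive_def)
  then have "tables_ok m'"
    using m'(2) n_less_L module_partition_singletons[of E "{..<n}"] by (auto simp: tables_ok_def)
  then show ?thesis using m'(1) tables_ok_upd by simp
qed

end

lemma combine_cong:
  assumes "\<And>p. p \<in> set types \<Longrightarrow> T p = T' p" "\<And>q. q \<in> set types \<Longrightarrow> U q = U' q"
  shows "combine j T U = combine j T' U'"
  unfolding combine_def using assms
  by (intro ext arg_cong[of _ _ Max] arg_cong[of _ _ "insert 0"] image_cong) auto

text \<open>Nothing remains outside \<open>F\<close>, so only connection type 0 occurs. This settles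
  the graph without vertices.\<close>

lemma best_empty: "s \<noteq> 0 \<Longrightarrow> best E W {} (f, s) = 0"
  by (simp add: best_def set_type_def connection_type_def)

context cfvse_input
begin

section \<open>Twin test, merges, sweeps and rounds\<close>

lemma run_check_twins:
  assumes ok: "tables_ok m" and uv: "m FST 0 \<in> alive m" "m SND 0 \<in> alive m" "m FST 0 \<noteq> m SND 0"
  shows "run check_twins m BAD 0 = 0 \<longleftrightarrow> twins E (alive m) (m FST 0) (m SND 0)"
    and "tables_ok (run check_twins m)" "alive (run check_twins m) = alive m"
    and "run check_twins m FST = m FST" "run check_twins m SND = m SND"
proof -
  have assigned: "assigned check_twins = {BAD, THIRD}" by (auto simp: check_twins_def)
  have frame: "run check_twins m a = m a" if "a \<noteq> BAD" "a \<noteq> THIRD" for a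
    using that by (intro run_frame) (simp add: assigned)
  have "run check_twins m b = m b" if "b \<in> {LEN, TAPE, SIZE, ROW, BUDGET, ALIVE} \<union> {16..30}" for b
    using that by (intro frame) (auto simp: LEN_def TAPE_def)
  then show "tables_ok (run check_twins m)" "alive (run check_twins m) = alive m"
    using tables_ok_cong[OF ok] by blast+
  show "run check_twins m FST = m FST" "run check_twins m SND = m SND"
    by (simp_all add: frame)
  define u v where "u = m FST 0" and "v = m SND 0"
  have alive_n: "alive m \<subseteq> {..<n}" using ok by (simp add: tables_ok_def)
  then have uv_n: "u < n" "v < n" using uv by (auto simp: u_def v_def)
  \<comment> \<open>\<open>P w\<close> says that the surviving vertex \<open>w\<close> tells
    \<open>u\<close> and \<open>v\<close> apart; the loop searches for such a witness.\<close>
  define P where "P w \<longleftrightarrow> w \<in> alive m \<and> w \<noteq> u \<and> w \<noteq> v \<and> (E u w \<longleftrightarrow> \<not> E v w)" for w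
  let ?I = "\<lambda>j m'. (\<forall>a. a \<noteq> BAD \<and> a \<noteq> THIRD \<longrightarrow> m' a = m a) \<and> (m' BAD 0 > 0 \<longleftrightarrow> (\<exists>w<j. P w))"
  let ?c = "When (Get ALIVE (var THIRD))
    (When (dist_expr (var THIRD) (var FST)) (When (dist_expr (var THIRD) (var SND))
      (When (dist_expr (adj_expr (var FST) (var THIRD)) (adj_expr (var SND) (var THIRD)))
        (assign BAD (C 1)))))"
  have "\<exists>m'. run (For THIRD ?c) (upd BAD 0 0 m) = upd THIRD 0 L m' \<and> ?I L m'"
  proof (rule For_invariant[where I = ?I])
    show "upd BAD 0 0 m LEN 0 = L"
      using ok by (simp add: tables_ok_def inputs_ok_def upd_apply LEN_def)
    show "?I 0 (upd BAD 0 0 m)" by (simp add: upd_apply)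
  next
    fix j m'
    assume I: "?I j m'"
    let ?m = "upd THIRD 0 j m'"
    have vals: "?m THIRD 0 = j" "?m FST 0 = u" "?m SND 0 = v" "?m ALIVE = m ALIVE" "?m BAD = m' BAD"
      using I by (simp_all add: upd_apply u_def v_def)
    have adj: "?m TAPE (?m ROW x + j) = of_bool (E x j)" if "x < n" "j < n" for x
    proof -
      have "?m TAPE = tape" "?m ROW x = 2 * n + 1 + x * n"
        using I ok that by (simp_all add: upd_apply tables_ok_def inputs_ok_def rows_ok_def TAPE_def)
      then show ?thesis using tape_adjacent[OF that] by simp
    qed
    have run: "run ?c ?m = (if P j then upd BAD 0 1 ?m else ?m)"
    proof (cases "j \<in> alive m")
      case False
      then show ?thesis using vals by (simp add: P_def alive_def)
    next
      case True
      then have "j < n" using alive_n by auto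
      then show ?thesis using True vals adj[OF uv_n(1)] adj[OF uv_n(2)]
        by (auto simp: P_def alive_def simp del: upd_apply)
    qed
    have "(\<exists>w<Suc j. P w) \<longleftrightarrow> P j \<or> (\<exists>w<j. P w)" by (auto simp: less_Suc_eq)
    then show "?I (Suc j) (run ?c ?m)"
      using I unfolding run by (simp add: upd_apply)
  qed
  then obtain m' where "run (For THIRD ?c) (upd BAD 0 0 m) = upd THIRD 0 L m' \<and> ?I L m'"
    by (rule exE)
  note m' = conjunct1[OF this] conjunct2[OF this]
  have "run check_twins m = upd THIRD 0 L m'"
    using m'(1) by (simp only: check_twins_def run.simps eval.simps)
  then have "run check_twins m BAD 0 = m' BAD 0" by (simp add: upd_apply)
  then have "run check_twins m BAD 0 = 0 \<longleftrightarrow> \<not> (\<exists>w<L. P w)"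
    using m'(2) by (metis neq0_conv)
  also have "\<dots> \<longleftrightarrow> (\<forall>w. \<not> P w)"
  proof -
    have "w < L" if "P w" for w
      using that subsetD[OF alive_n, of w] n_less_L by (simp add: P_def)
    then show ?thesis by blast
  qed
  also have "\<dots> \<longleftrightarrow> twins E (alive m) u v"
    using uv unfolding P_def twins_def u_def v_def by blast
  finally show "run check_twins m BAD 0 = 0 \<longleftrightarrow> twins E (alive m) (m FST 0) (m SND 0)"
    by (simp add: u_def v_def)
qed

text \<open>The modules of \<open>u\<close> and \<open>v\<close> are uniformly adjacent or
  non-adjacent according to \<open>E u v\<close>, so \<open>best_Un\<close> applies to their union;
  \<open>u < v\<close> guarantees that the removed vertex is not 0.\<close>

lemma tables_ok_merge:
  assumes ok: "tables_ok m" and u: "m FST 0 = u" and v: "m SND 0 = v"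
    and twins: "twins E (alive m) u v" and "u < v"
  shows "tables_ok (upd ALIVE v 0 (run (merge (E u v)) m))"
    and "alive (upd ALIVE v 0 (run (merge (E u v)) m)) = alive m - {v}"
proof -
  let ?m = "upd ALIVE v 0 (run (merge (E u v)) m)"
  obtain M where M: "module_partition E {..<n} (alive m) M"
      "\<And>\<tau> w. \<tau> \<in> set types \<Longrightarrow> w \<in> alive m \<Longrightarrow> m (table \<tau>) w = best E W (M w) \<tau>"
    using ok by (auto simp: tables_ok_def)
  have uv: "u \<in> alive m" "v \<in> alive m" "u \<noteq> v" using twins by (auto simp: twins_def)
  have alive_n: "alive m \<subseteq> {..<n}" using ok by (simp add: tables_ok_def)
  have frame: "run (merge (E u v)) m a = m a" if "a < 16" for a
    using assigned_merge[of "E u v"] that by (intro run_frame) auto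
  have sym: "symp E" and irr: "irreflp E"
    using symp_adjacent[OF graph] irreflp_adjacent[OF graph] by auto
  show alive: "alive ?m = alive m - {v}"
    by (auto simp: alive_def upd_apply frame)
  have table: "?m (table \<tau>) = (m (table \<tau>))(u := best E W (M u \<union> M v) \<tau>)" if "\<tau> \<in> set types" for \<tau>
  proof -
    have "table \<tau> \<noteq> ALIVE" using table_bounds[OF that] by simp
    then have "?m (table \<tau>) = (m (table \<tau>))(u :=
        combine (E u v) (\<lambda>p. m (table p) u) (\<lambda>q. m (table q) v) \<tau>)"
      using run_merge[OF that, of "E u v" m] u v by (simp add: upd_apply)
    moreover have "combine (E u v) (\<lambda>p. m (table p) u) (\<lambda>q. m (table q) v) =
        combine (E u v) (best E W (M u)) (best E W (M v))"
      using M(2) uv by (intro combine_cong) auto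
    moreover have "best E W (M u \<union> M v) = combine (E u v) (best E W (M u)) (best E W (M v))"
    proof (rule best_Un[OF sym irr])
      show "M u \<inter> M v = {}" "\<forall>x\<in>M u. \<forall>y\<in>M v. E x y \<longleftrightarrow> E u v"
        using module_partitionD[OF M(1) uv] by blast+
      show "finite (M u)" "finite (M v)"
        using module_partition_subset[OF M(1)] uv by (auto intro: finite_subset)
    qed
    ultimately show ?thesis by simp
  qed
  have "inputs_ok ?m" "rows_ok ?m" "?m BUDGET 0 = k"
    using ok by (simp_all add: tables_ok_def inputs_ok_def rows_ok_def upd_apply frame LEN_def TAPE_def)
  moreover have "alive ?m \<subseteq> {..<n}" "n > 0 \<longrightarrow> 0 \<in> alive ?m"
    using ok \<open>u < v\<close> unfolding alive by (auto simp: tables_ok_def)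
  moreover have "\<forall>\<tau>\<in>set types. \<forall>w\<ge>n. ?m (table \<tau>) w = 0"
  proof (intro ballI allI impI)
    fix \<tau> w
    assume "\<tau> \<in> set types" "w \<ge> n"
    moreover have "w \<noteq> u" using \<open>w \<ge> n\<close> uv alive_n by auto
    ultimately show "?m (table \<tau>) w = 0"
      using ok unfolding table[OF \<open>\<tau> \<in> set types\<close>] by (simp add: tables_ok_def)
  qed
  moreover have "\<exists>M. module_partition E {..<n} (alive ?m) M \<and>
      (\<forall>\<tau>\<in>set types. \<forall>w\<in>alive ?m. ?m (table \<tau>) w = best E W (M w) \<tau>)"
  proof (intro exI conjI ballI)
    show "module_partition E {..<n} (alive ?m) (M(u := M u \<union> M v))"
      unfolding alive by (rule module_partition_merge[OF M(1) twins sym])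
    show "?m (table \<tau>) w = best E W ((M(u := M u \<union> M v)) w) \<tau>"
      if "\<tau> \<in> set types" "w \<in> alive ?m" for \<tau> w
      using M(2)[OF that(1), of w] that(2) unfolding table[OF that(1)] alive by simp
  qed
  ultimately show "tables_ok ?m"
    unfolding tables_ok_def by (intro conjI)
qed

lemma run_try_merge:
  assumes ok: "tables_ok m" and u: "m FST 0 = u" and v: "m SND 0 = v"
  shows "tables_ok (run try_merge m) \<and> alive (run try_merge m) =
    (if u < v \<and> twins E (alive m) u v then alive m - {v} else alive m)"
proof (cases "u < v \<and> u \<in> alive m \<and> v \<in> alive m")
  case False
  then have "run try_merge m = m"
    unfolding try_merge_def using u v by (auto simp: alive_def)
  then show ?thesis using False ok by (auto simp: twins_def)
next
  case True
  let ?m = "run check_twins m"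
  have uv: "m FST 0 \<in> alive m" "m SND 0 \<in> alive m" "m FST 0 \<noteq> m SND 0"
    using True u v by auto
  note check = run_check_twins[OF ok uv]
  have n: "u < n" "v < n" using True ok by (auto simp: tables_ok_def)
  have "?m TAPE (?m ROW u + v) = of_bool (E u v)"
    using check(2) tape_adjacent[OF n] n by (simp add: tables_ok_def inputs_ok_def rows_ok_def)
  then have run: "run try_merge m = (if ?m BAD 0 > 0 then ?m else upd ALIVE v 0 (run (merge (E u v)) ?m))"
  proof -
    \<comment> \<open>After the merge, \<open>SND\<close> must still name the vertex to be
      removed.\<close>
    have frame: "run (merge j) ?m SND = m SND" for j
    proof -
      have "SND \<notin> assigned (merge j)" using subsetD[OF assigned_merge, of SND j] by auto
      then show ?thesis using check(5) run_frame by simp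
    qed
    show ?thesis
      using True u v check(4,5) \<open>?m TAPE (?m ROW u + v) = of_bool (E u v)\<close>
      by (simp add: try_merge_def alive_def frame)
  qed
  show ?thesis
  proof (cases "twins E (alive m) u v")
    case False
    then show ?thesis using run check u v by simp
  next
    case tw: True
    then have "run try_merge m = upd ALIVE v 0 (run (merge (E u v)) ?m)"
      using run check(1) u v by simp
    then show ?thesis
      using tables_ok_merge[OF check(2), of u v] check(3-5) tw True u v by simp
  qed
qed

text \<open>Survivors are only ever removed. If the set is the same after the sweep, it never
  changed, so every pair was tested against this very set and no twins were found; with two
  survivors this contradicts \<open>p4_free_twins\<close>.\<close>

lemma run_sweep:
  assumes ok: "tables_ok m"
  shows "tables_ok (run sweep m) \<and> alive (run sweep m) \<subseteq> alive m \<and>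
    (card (alive m) \<ge> 2 \<longrightarrow> alive (run sweep m) \<noteq> alive m)"
proof -
  define A where "A = alive m"
  let ?T = "\<lambda>a b. a < b \<and> twins E A a b"
  let ?I = "\<lambda>j m. tables_ok m \<and> alive m \<subseteq> A \<and> (alive m = A \<longrightarrow> (\<forall>a b. a < j \<longrightarrow> \<not> ?T a b))"
  have LEN: "m LEN 0 = L" if "tables_ok m" for m
    using that by (simp add: tables_ok_def inputs_ok_def)
  have A_n: "A \<subseteq> {..<n}" using ok by (simp add: A_def tables_ok_def)
  have "\<exists>m'. run sweep m = upd FST 0 L m' \<and> ?I L m'"
    unfolding sweep_def
  proof (rule For_invariant[where I = ?I])
    show "m LEN 0 = L" "?I 0 m" using ok LEN by (simp_all add: A_def)
  next
    fix u m
    assume I: "?I u m"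
    let ?J = "\<lambda>j m. tables_ok m \<and> alive m \<subseteq> A \<and> m FST 0 = u \<and>
      (alive m = A \<longrightarrow> (\<forall>a b. a < u \<or> a = u \<and> b < j \<longrightarrow> \<not> ?T a b))"
    have "\<exists>m'. run (For SND try_merge) (upd FST 0 u m) = upd SND 0 L m' \<and> ?J L m'"
    proof (rule For_invariant[where I = ?J])
      have "tables_ok (upd FST 0 u m)" "alive (upd FST 0 u m) = alive m"
        using I tables_ok_upd[of m FST] by simp_all
      then show "upd FST 0 u m LEN 0 = L" "?J 0 (upd FST 0 u m)"
        using I LEN by (simp_all add: upd_apply)
    next
      fix v m
      assume J: "?J v m"
      let ?m = "upd SND 0 v m"
      have m: "tables_ok ?m" "alive ?m = alive m" "?m FST 0 = u" "?m SND 0 = v"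
        using J tables_ok_upd[of m SND] by (simp_all add: upd_apply)
      note R = run_try_merge[OF m(1,3,4)]
      have "FST \<notin> assigned try_merge" using assigned_try_merge by auto
      then have FST: "run try_merge ?m FST 0 = u" using run_frame m(3) by simp
      define B where "B = alive (run try_merge ?m)"
      have B: "B = (if u < v \<and> twins E (alive m) u v then alive m - {v} else alive m)"
        using R unfolding B_def m(2) by blast
      then have "B \<subseteq> alive m" by auto
      then have "B \<subseteq> A" using J by blast
      moreover have "\<not> ?T a b" if eq: "B = A" and ab: "a < u \<or> a = u \<and> b < Suc v" for a b
      proof -
        \<comment> \<open>If the set is still complete after this test, it was complete before, so
          the earlier negative tests refer to \<open>A\<close> too.\<close>
        have A: "alive m = A" using eq \<open>B \<subseteq> alive m\<close> J by blast
        have "\<not> ?T u v"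
        proof
          assume T: "?T u v"
          then have "v \<in> A" by (simp add: twins_def)
          moreover have "B = A - {v}" using B T by (simp add: A)
          ultimately show False using eq by blast
        qed
        moreover have "a < u \<or> a = u \<and> b < v \<or> a = u \<and> b = v" using ab by linarith
        ultimately show ?thesis using J A by blast
      qed
      ultimately show "?J (Suc v) (run try_merge ?m)"
        using R FST unfolding B_def by blast
    qed
    then obtain m' where m': "run (For SND try_merge) (upd FST 0 u m) = upd SND 0 L m'" "?J L m'"
      by blast
    have "tables_ok (upd SND 0 L m')" "alive (upd SND 0 L m') = alive m'"
      using m'(2) tables_ok_upd[of m' SND] by simp_all
    moreover have "\<not> ?T a b" if "alive m' = A" "a < Suc u" for a b
    proof
      assume T: "?T a b"
      then have "b < L" using A_n n_less_L by (auto simp: twins_def)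
      then show False using m'(2) that T by (auto simp: less_Suc_eq)
    qed
    ultimately show "?I (Suc u) (run (For SND try_merge) (upd FST 0 u m))"
      using m' by auto
  qed
  then obtain m' where m': "run sweep m = upd FST 0 L m'" "?I L m'" by blast
  have eq: "tables_ok (run sweep m)" "alive (run sweep m) = alive m'"
    using m' tables_ok_upd[of m' FST] by simp_all
  have "alive m' \<noteq> A" if card: "card A \<ge> 2"
  proof
    assume "alive m' = A"
    have "finite A" "p4_free E A"
      using A_n finite_subset p4_free_subset[OF p4_free A_n] by auto
    then obtain a b where ab: "twins E A a b"
      using p4_free_twins[OF _ card symp_adjacent[OF graph]] by blast
    \<comment> \<open>Only pairs in increasing order are tested, which suffices because twins are
      symmetric.\<close>
    then have "?T a b \<or> ?T b a" using twins_sym[OF ab] by (auto simp: twins_def)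
    moreover have "a < L" "b < L" using ab A_n n_less_L by (auto simp: twins_def)
    ultimately show False using m'(2) \<open>alive m' = A\<close> by blast
  qed
  then show ?thesis using eq m'(2) by (simp add: A_def)
qed

lemma run_rounds:
  assumes ok: "tables_ok m"
  shows "tables_ok (run (For ROUND sweep) m)" "card (alive (run (For ROUND sweep) m)) \<le> 1"
proof -
  \<comment> \<open>Each sweep removes a vertex as long as two are left, and there are more than
    \<open>n\<close> rounds.\<close>
  let ?I = "\<lambda>j m. tables_ok m \<and> card (alive m) \<le> max 1 (n - j)"
  have fin: "finite (alive m)" "alive m \<subseteq> {..<n}" if "tables_ok m" for m
    using that by (auto simp: tables_ok_def intro: finite_subset)
  have "\<exists>m'. run (For ROUND sweep) m = upd ROUND 0 L m' \<and> ?I L m'"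
  proof (rule For_invariant[where I = ?I])
    show "m LEN 0 = L" using ok by (simp add: tables_ok_def inputs_ok_def)
    show "?I 0 m" using ok card_mono[OF _ fin(2)[OF ok]] by simp
  next
    fix j m
    assume I: "?I j m"
    let ?m = "upd ROUND 0 j m"
    have m: "tables_ok ?m" "alive ?m = alive m"
      using I tables_ok_upd[of m ROUND] by simp_all
    note R = run_sweep[OF m(1)]
    have "card (alive (run sweep ?m)) \<le> max 1 (n - Suc j)"
    proof (cases "card (alive m) \<ge> 2")
      case True
      then have "alive (run sweep ?m) \<subset> alive m" using R m(2) by auto
      then have "card (alive (run sweep ?m)) < card (alive m)"
        using fin(1) I by (intro psubset_card_mono) auto
      moreover have "card (alive m) \<le> max 1 (n - j)" using I by blast
      then have "card (alive m) \<le> n - j" using True by linarith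
      ultimately show ?thesis by linarith
    next
      case False
      moreover have "card (alive (run sweep ?m)) \<le> card (alive m)"
        using R m(2) fin(1) I by (intro card_mono) auto
      ultimately show ?thesis by simp
    qed
    then show "?I (Suc j) (run sweep ?m)" using R by blast
  qed
  then obtain m' where m': "run (For ROUND sweep) m = upd ROUND 0 L m'" "?I L m'" by blast
  then show "tables_ok (run (For ROUND sweep) m)" "card (alive (run (For ROUND sweep) m)) \<le> 1"
    using tables_ok_upd[of m' ROUND] n_less_L by (auto simp del: run.simps)
qed

lemma run_answer:
  assumes "m OUT 0 = 0"
  shows "run answer m OUT 0 > 0 \<longleftrightarrow>
    (\<exists>f<4. m (table (f, 1)) 0 > 0 \<and> m SIZE 0 < m (table (f, 1)) 0 + m BUDGET 0)"
proof -
  let ?c = "\<lambda>f. When (Get (table (f, 1)) (C 0))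
    (When (Minus (Plus (Get (table (f, 1)) (C 0)) (var BUDGET)) (var SIZE)) (assign OUT (C 1)))"
  have "fold run (map ?c [0..<l]) m = (if \<exists>f<l. m (table (f, 1)) 0 > 0 \<and>
      m SIZE 0 < m (table (f, 1)) 0 + m BUDGET 0 then upd OUT 0 1 m else m)" for l
  proof (induction l)
    case (Suc l)
    have "table (l, 1) \<noteq> OUT" by (simp add: table_def)
    moreover have "upd OUT 0 1 (upd OUT 0 1 m) = upd OUT 0 1 m" by (simp add: upd_def)
    ultimately show ?case using Suc by (auto simp: upd_apply less_Suc_eq)
  qed simp
  from this[of 4] show ?thesis
    using assms by (simp add: answer_def run_seqs upd_apply del: upt_Suc upt_rec_numeral)
qed

lemma run_main:
  "run main (input_mem input) OUT 0 > 0 \<longleftrightarrow> cfvse (G, W, k)"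
proof -
  define m0 where "m0 = input_mem input"
  define m1 where "m1 = run read_size m0"
  define m2 where "m2 = run locate_rows m1"
  define m3 where "m3 = run read_budget m2"
  define m4 where "m4 = run init_tables m3"
  define m5 where "m5 = run (For ROUND sweep) m4"
  have zero: "m0 a = (\<lambda>_. 0)" if "a \<noteq> LEN" "a \<noteq> TAPE" for a
    using that by (auto simp: m0_def input_mem_def)
  have a1: "assigned read_size = {IDX, SIZE}" by (auto simp: read_size_def)
  have a2: "assigned locate_rows = {IDX, POS, ROW}" by (auto simp: locate_rows_def)
  have a3: "assigned read_budget = {IDX, BUDGET}" by (auto simp: read_budget_def)
  have wf: "wf_com read_size" "wf_com locate_rows" "wf_com read_budget"
    using wf_main by (simp_all add: main_def wf_com_seqs)
  have f1: "m1 a = m0 a" if "a \<notin> {IDX, SIZE}" for a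
    using that unfolding m1_def by (intro run_frame) (simp add: a1)
  have f2: "m2 a = m1 a" if "a \<notin> {IDX, POS, ROW}" for a
    using that unfolding m2_def by (intro run_frame) (simp add: a2)
  have f3: "m3 a = m2 a" if "a \<notin> {IDX, BUDGET}" for a
    using that unfolding m3_def by (intro run_frame) (simp add: a3)
  have names: "a \<noteq> LEN" "a \<noteq> TAPE" if "a > 2 \<or> a = 0" for a
    using that by (auto simp: LEN_def TAPE_def)
  have i0: "inputs_ok m0" by (simp add: m0_def inputs_ok_init)
  have i1: "inputs_ok m1" unfolding m1_def by (rule inputs_ok_frame[OF i0 wf(1)]) (simp add: a1 TAPE_def)
  have i2: "inputs_ok m2" unfolding m2_def by (rule inputs_ok_frame[OF i1 wf(2)]) (simp add: a2 TAPE_def)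
  have i3: "inputs_ok m3" unfolding m3_def by (rule inputs_ok_frame[OF i2 wf(3)]) (simp add: a3 TAPE_def)
  have s1: "m1 SIZE 0 = n"
    unfolding m1_def by (rule run_read_size[OF i0]) (simp add: zero names)
  have r2: "rows_ok m2" unfolding m2_def by (rule run_locate_rows[OF i1 s1])
  have b3: "m3 BUDGET 0 = k"
    unfolding m3_def by (rule run_read_budget[OF i2 r2]) (simp add: f1 f2 zero names)
  have r3: "rows_ok m3" using r2 by (simp add: rows_ok_def f3)
  have z3: "m3 a = (\<lambda>_. 0)" if "a > 7 \<or> a = 0" for a
  proof -
    have *: "a \<notin> {IDX, SIZE}" "a \<notin> {IDX, POS, ROW}" "a \<notin> {IDX, BUDGET}" "a > 2 \<or> a = 0"
      using that by auto
    show ?thesis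
      using f3[OF *(3)] f2[OF *(2)] f1[OF *(1)] zero[OF names[OF *(4)]] by simp
  qed
  have t4: "tables_ok m4"
    unfolding m4_def
  proof (rule run_init_tables[OF i3 r3 b3])
    show "m3 ALIVE = (\<lambda>_. 0)" by (simp add: z3)
    show "m3 (table \<tau>) = (\<lambda>_. 0)" if "\<tau> \<in> set types" for \<tau>
      using table_bounds[OF that] by (intro z3) simp
  qed
  have t5: "tables_ok m5" "card (alive m5) \<le> 1"
    unfolding m5_def by (rule run_rounds[OF t4])+
  have "OUT \<notin> assigned init_tables" "OUT \<notin> assigned (For ROUND sweep)"
    using assigned_try_merge by (auto simp: init_tables_def sweep_def table_def)
  then have "m5 OUT 0 = 0"
    unfolding m5_def m4_def by (simp add: run_frame z3 del: run.simps)
  from run_answer[of m5, OF this] have "run main m0 OUT 0 > 0 \<longleftrightarrow>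
      (\<exists>f<4. m5 (table (f, 1)) 0 > 0 \<and> n < m5 (table (f, 1)) 0 + k)"
    using t5(1) by (simp add: main_def run_seqs m5_def m4_def m3_def m2_def m1_def tables_ok_def rows_ok_def
        del: run.simps)
  moreover have "m5 (table (f, 1)) 0 = best E W {..<n} (f, 1)" if "f < 4" for f
  proof (cases "n = 0")
    case True
    have "(f, 1) \<in> set types" using that by (simp add: in_types_iff)
    then have "\<forall>u\<ge>n. m5 (table (f, 1)) u = 0"
      using t5(1) unfolding tables_ok_def by blast
    then show ?thesis using True by (simp add: best_empty)
  next
    case False
    then have "0 \<in> alive m5" using t5(1) by (simp add: tables_ok_def)
    moreover have "finite (alive m5)"
      using t5(1) by (auto simp: tables_ok_def intro: finite_subset)
    ultimately have single: "alive m5 = {0}"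
      using t5(2) card_le_Suc0_iff_eq[of "alive m5"] by auto
    obtain M where M: "module_partition E {..<n} (alive m5) M"
        "\<And>\<tau> w. \<tau> \<in> set types \<Longrightarrow> w \<in> alive m5 \<Longrightarrow> m5 (table \<tau>) w = best E W (M w) \<tau>"
      using t5(1) by (auto simp: tables_ok_def)
    \<comment> \<open>The only remaining module is the whole graph, so its table holds the optimal
      values.\<close>
    have "M 0 = {..<n}" using M(1) by (simp add: module_partition_def single)
    then show ?thesis using M(2)[of "(f, 1)" 0] that by (simp add: single in_types_iff)
  qed
  ultimately show ?thesis
    using cfvse_iff_best[OF graph, of W k] W by (simp add: verts m0_def cong: conj_cong)
qed

end

theorem theorem3:
  shows "poly_time_solvable_on encode
    {(G, W, k). valid_instance (G, W, k) \<and> induced_free (with_proj (path_graph 4)) (with_proj G)}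
    cfvse"
proof -
  \<comment> \<open>Program and time bound are valid for arbitrary bit strings; the restriction on
    the graph enters only into the correctness of the answer.\<close>
  obtain P p where P: "\<And>w. \<exists>t X. halts_in P (initial_config w) t X \<and> t \<le> poly p (length w) \<and>
      X 0 = run main (input_mem w) 0 0"
    using loop_program_poly_time[OF wf_main] by blast
  have "\<exists>t X. halts_in P (initial_config (encode x)) t X \<and> t \<le> poly p (length (encode x)) \<and>
      (X 0 > 0 \<longleftrightarrow> cfvse x)"
    if in_class: "x \<in> {(G, W, k). valid_instance (G, W, k) \<and>
      induced_free (with_proj (path_graph 4)) (with_proj G)}" for x
  proof -
    obtain G W k where x: "x = (G, W, k)" by (cases x)
    obtain n where "pair_graph G" "pverts G = {..<n}" "W \<subseteq> pverts G"
        "induced_free (with_proj (path_graph 4)) (with_proj G)"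
      using in_class by (auto simp: x valid_instance_def)
    then interpret cfvse_input G W k n
      using induced_free_path_imp_p4_free[of G] by (simp add: cfvse_input_def)
    show ?thesis using P[of "encode x"] run_main by (simp add: x) metis
  qed
  then show ?thesis unfolding poly_time_solvable_on_def by blast
qed

end
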